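(* Let $\theta>0$, $\alpha=\frac2{2+\theta}$, $t_0>0$, $\tau_0=\log t_0$. Let $(u,m)\in C^1(\mathbb R\times(t_0,\infty))\times C(\mathbb R\times[t_0,\infty))$, $m\ge0$, satisfy $-u_t+\frac12u_x^2=m^\theta$ in the classical sense and $m_t-(mu_x)_x=0$ in the distributional sense in $\mathbb R\times(t_0,\infty)$. Assume there exist functions $\gamma_L<\gamma_R$ in $W^{1,\infty}_{\mathrm{loc}}((t_0,\infty))$ such that $\{m(\cdot,t)>0\}=(\gamma_L(t),\gamma_R(t))$ for every $t\in(t_0,\infty)$, and let $a=\int_{\mathbb R}m(\cdot,t_0)\,dx>0$. Let $(v,\mu)$ be the continuous rescaling of $(u,m)$ (see context). Assume further that $\mu$ is bounded and uniformly continuous on $\mathbb R\times(\tau_0,\infty)$, that for some constant $\rho>0$ $$\sup_{\tau_1\in(\tau_0+\rho,\infty)}\|\mu^\theta\|_{H^1(\mathbb R\times(\tau_1-\rho,\tau_1+\rho))}<\infty,$$ and that there exists a constant $R\ge R_a$ such that $\mathrm{supp}(\mu)\subset[-R,R]\times[\tau_0,\infty)$ and $Dv\in C^1(\{\mu>0\})\cap L^\infty((-R,R)\times(\tau_0,\infty))$. Then, for every $p\in[1,\infty]$ (with $\frac1\infty=0$), $$\lim_{t\to\infty}t^{\alpha(1-\frac1p)}\|m(\cdot,t)-\mathcal M_a(\cdot,t)\|_{L^p(\mathbb R)}=0,$$ $$\lim_{t\to\infty}t^{2-\alpha(1+\frac1p)}\big\|m(\cdot,t)|u_x(\cdot,t)-(\mathcal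 U_a)_x(\cdot,t)|^2\big\|_{L^p(\mathbb R)}=0,$$ $$\lim_{t\to\infty}t^{2-\alpha(1+\frac1p)}\big\|m(\cdot,t)|u_t(\cdot,t)-(\mathcal U_a)_t(\cdot,t)|\big\|_{L^p(\mathbb R)}=0.$$
   Context: Continuous rescaling: for $(\eta,\tau)\in\mathbb R\times[\tau_0,\infty)$ set $t=e^\tau$, $x=t^\alpha\eta$, and $\mu(\eta,\tau)=t^\alpha m(x,t)$, $v(\eta,\tau)=t^{1-2\alpha}u(x,t)$. $D=(\partial_\eta,\partial_\tau)$. Self-similar profile: $R_a>0$ is the unique constant with $\int_{\mathbb R}\big(R_a-\frac{\alpha(1-\alpha)}2\eta^2\big)_+^{1/\theta}d\eta=a$; $M_a(\eta)=\big(R_a-\frac{\alpha(1-\alpha)}2\eta^2\big)_+^{1/\theta}$; for $(x,t)\in\mathbb R\times(0,\infty)$, $\mathcal M_a(x,t)=t^{-\alpha}M_a(x/t^\alpha)$ and $\mathcal U_a(x,t)=t^{2\alpha-1}U_a(x/t^\alpha)+z(t)$, where $U_a(\eta)=-\frac\alpha2\eta^2$ and $z'(t)=-R_at^{2\alpha-2}$. *)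

theory Defs
  imports "HOL-Analysis.Analysis"
begin

section \<open>Partial derivatives, classical smoothness, test functions\<close>

definition partial_deriv :: "'a::euclidean_space \<Rightarrow> ('a \<Rightarrow> real) \<Rightarrow> 'a \<Rightarrow> real" where
  "partial_deriv b f x = frechet_derivative f (at x) b"

text \<open>Functions of space and time are functions of pairs, the space variable coming first.\<close>

abbreviation Dx :: "(real \<times> real \<Rightarrow> real) \<Rightarrow> real \<times> real \<Rightarrow> real" where
  "Dx \<equiv> partial_deriv (1, 0)"

abbreviation Dt :: "(real \<times> real \<Rightarrow> real) \<Rightarrow> real \<times> real \<Rightarrow> real" where
  "Dt \<equiv> partial_deriv (0, 1)"

text \<open>To be used for open sets only: the derivatives are full (two-sided) ones.\<close>

primrec Ck_on :: "nat \<Rightarrow> 'a::euclidean_space set \<Rightarrow> ('a \<Rightarrow> real) \<Rightarrow> bool" where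
  "Ck_on 0 \<Omega> f \<longleftrightarrow> continuous_on \<Omega> f"
| "Ck_on (Suc k) \<Omega> f \<longleftrightarrow>
     (\<forall>x\<in>\<Omega>. f differentiable (at x)) \<and> (\<forall>b\<in>Basis. Ck_on k \<Omega> (partial_deriv b f))"

definition test_functions :: "'a::euclidean_space set \<Rightarrow> ('a \<Rightarrow> real) set" where
  "test_functions \<Omega> =
     {\<phi>. (\<forall>k. Ck_on k UNIV \<phi>) \<and> compact (closure (support_on UNIV \<phi>)) \<and>
         closure (support_on UNIV \<phi>) \<subseteq> \<Omega>}"


section \<open>Lebesgue and Sobolev spaces\<close>

text \<open>Norms take values in \<^typ>\<open>ennreal\<close>, the value \<open>\<infinity>\<close> meaning that the function is not in the
  space.  The exponent is meant to satisfy \<open>1 \<le> p \<le> \<infinity>\<close>.\<close>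

definition Lp_norm :: "ennreal \<Rightarrow> 'a measure \<Rightarrow> ('a \<Rightarrow> real) \<Rightarrow> ennreal" where
  "Lp_norm p M f =
     (if f \<notin> borel_measurable M then \<infinity>
      else if p = \<infinity> then Inf {C. AE x in M. ennreal \<bar>f x\<bar> \<le> C}
      else let I = (\<integral>\<^sup>+ x. ennreal (\<bar>f x\<bar> powr enn2real p) \<partial>M)
           in if I = \<infinity> then \<infinity> else ennreal (enn2real I powr (1 / enn2real p)))"

definition locally_integrable :: "'a::euclidean_space set \<Rightarrow> ('a \<Rightarrow> real) \<Rightarrow> bool" where
  "locally_integrable \<Omega> f \<longleftrightarrow> (\<forall>K. compact K \<and> K \<subseteq> \<Omega> \<longrightarrow> integrable (lebesgue_on K) f)"

definition weak_partial_deriv ::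
    "'a::euclidean_space set \<Rightarrow> 'a \<Rightarrow> ('a \<Rightarrow> real) \<Rightarrow> ('a \<Rightarrow> real) \<Rightarrow> bool" where
  "weak_partial_deriv \<Omega> b f g \<longleftrightarrow>
     locally_integrable \<Omega> f \<and> locally_integrable \<Omega> g \<and>
     (\<forall>\<phi>\<in>test_functions \<Omega>.
        (LINT x|lebesgue_on \<Omega>. f x * partial_deriv b \<phi> x) = - (LINT x|lebesgue_on \<Omega>. g x * \<phi> x))"

text \<open>The weak gradient \<open>G\<close> is unique up to null sets, so the infimum ranges over at most one
  value; it is \<open>\<infinity>\<close> if there is no weak gradient.\<close>

definition H1_norm :: "'a::euclidean_space set \<Rightarrow> ('a \<Rightarrow> real) \<Rightarrow> ennreal" where
  "H1_norm \<Omega> f =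
     Inf {Lp_norm 2 (lebesgue_on \<Omega>) (\<lambda>x. sqrt ((f x)\<^sup>2 + (\<Sum>b\<in>Basis. (G b x)\<^sup>2))) | G.
            \<forall>b\<in>Basis. weak_partial_deriv \<Omega> b f (G b)}"

text \<open>As usual, an element of \<open>W\<^sup>1\<^sup>,\<^sup>\<infinity>\<^sub>l\<^sub>o\<^sub>c\<close> that is evaluated pointwise is identified with its
  continuous representative, whence the first conjunct.\<close>

definition W1inf_loc :: "'a::euclidean_space set \<Rightarrow> ('a \<Rightarrow> real) \<Rightarrow> bool" where
  "W1inf_loc \<Omega> f \<longleftrightarrow>
     continuous_on \<Omega> f \<and>
     (\<forall>K. compact K \<and> K \<subseteq> \<Omega> \<longrightarrow> Lp_norm \<infinity> (lebesgue_on K) f < \<infinity>) \<and>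
     (\<exists>G. \<forall>b\<in>Basis. weak_partial_deriv \<Omega> b f (G b) \<and>
        (\<forall>K. compact K \<and> K \<subseteq> \<Omega> \<longrightarrow> Lp_norm \<infinity> (lebesgue_on K) (G b) < \<infinity>))"


section \<open>Continuous rescaling and self-similar profile\<close>

definition rescaled_m :: "real \<Rightarrow> (real \<times> real \<Rightarrow> real) \<Rightarrow> real \<times> real \<Rightarrow> real" where
  "rescaled_m \<alpha> m = (\<lambda>(\<eta>, \<tau>). let t = exp \<tau> in t powr \<alpha> * m (t powr \<alpha> * \<eta>, t))"

definition rescaled_u :: "real \<Rightarrow> (real \<times> real \<Rightarrow> real) \<Rightarrow> real \<times> real \<Rightarrow> real" where
  "rescaled_u \<alpha> u = (\<lambda>(\<eta>, \<tau>). let t = exp \<tau> in t powr (1 - 2 * \<alpha>) * u (t powr \<alpha> * \<eta>, t))"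

definition profile :: "real \<Rightarrow> real \<Rightarrow> real \<Rightarrow> real \<Rightarrow> real" where
  "profile \<theta> \<alpha> r \<eta> = (max 0 (r - \<alpha> * (1 - \<alpha>) / 2 * \<eta>\<^sup>2)) powr (1 / \<theta>)"

definition R_const :: "real \<Rightarrow> real \<Rightarrow> real \<Rightarrow> real" where
  "R_const \<theta> \<alpha> a = (THE r. r > 0 \<and> (LINT \<eta>|lebesgue. profile \<theta> \<alpha> r \<eta>) = a)"

definition M_profile :: "real \<Rightarrow> real \<Rightarrow> real \<Rightarrow> real \<Rightarrow> real" where
  "M_profile \<theta> \<alpha> a = profile \<theta> \<alpha> (R_const \<theta> \<alpha> a)"

definition U_profile :: "real \<Rightarrow> real \<Rightarrow> real" where
  "U_profile \<alpha> \<eta> = - (\<alpha> / 2) * \<eta>\<^sup>2"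

definition selfsim_M :: "real \<Rightarrow> real \<Rightarrow> real \<Rightarrow> real \<times> real \<Rightarrow> real" where
  "selfsim_M \<theta> \<alpha> a = (\<lambda>(x, t). t powr (- \<alpha>) * M_profile \<theta> \<alpha> a (x / t powr \<alpha>))"

text \<open>The function \<open>z\<close> is determined only up to an additive constant, and is kept as a parameter.\<close>

definition selfsim_U :: "real \<Rightarrow> (real \<Rightarrow> real) \<Rightarrow> real \<times> real \<Rightarrow> real" where
  "selfsim_U \<alpha> z = (\<lambda>(x, t). t powr (2 * \<alpha> - 1) * U_profile \<alpha> (x / t powr \<alpha>) + z t)"

end

theory Submission imports Defs begin

text \<open>In the rescaled variables put \<open>p = v\<^sub>\<eta> + \<alpha> \<eta>\<close>. The particle positions \<open>X(y, \<tau>)\<close>, labelled by the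
  mass \<open>y\<close> to their left, satisfy \<open>X\<^sub>\<tau> = - p\<close> and
  \<open>X\<^sub>\<tau>\<^sub>\<tau> = (1 - 2\<alpha>) X\<^sub>\<tau> + \<alpha> (1 - \<alpha>) X + \<partial>\<^sub>y g(1 / X\<^sub>y)\<close> with \<open>g(s) = \<theta> / (\<theta> + 1) s\<^bsup>\<theta> + 1\<^esup>\<close>. This equation is
  elliptic, and since \<open>g\<close> vanishes at the ends of the support, the difference of two bounded solutions
  obeys a maximum principle without boundary conditions in \<open>y\<close>. The roots of
  \<open>s\<^sup>2 = (1 - 2\<alpha>) s + \<alpha> (1 - \<alpha>)\<close> are \<open>- \<alpha>\<close> and \<open>1 - \<alpha>\<close>, so such a difference decays like \<open>exp (- \<alpha> \<tau>)\<close>,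
  uniformly in \<open>y\<close>. Comparing \<open>X\<close> with its own time translates gives \<open>\<bar>p\<bar> \<le> C exp (- \<alpha> \<tau>)\<close> on
  \<open>{\<mu> > 0}\<close>. Comparing \<open>X\<close> with the stationary solution given by \<open>M\<^sub>a\<close> shows that the distribution
  functions of \<open>\<mu>\<close> and \<open>M\<^sub>a\<close> approach each other, and the uniform continuity of \<open>\<mu>\<close> upgrades this to
  uniform convergence of the densities. The \<open>L\<^sup>p\<close> statements follow because all supports lie
  in \<open>\<bar>x\<bar> \<le> const \<cdot> t\<^bsup>\<alpha>\<^esup>\<close>.\<close>

section \<open>A maximum principle without boundary conditions\<close>

text \<open>The obstacle is the free boundary. The derivatives of v are C^1 only where \<mu> > 0, so
  no equation may be differentiated across the edge of the support. In the mass coordinate the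
  moving support becomes the fixed interval (0, a), all equations hold classically inside it, and
  the edge survives only through the requirement that the flux be small near 0 and a. The uniform
  continuity of \<mu> provides this uniformly in time. Ellipticity in space-time asks for a
  condition at a final time too, and none is given. Boundedness of X replaces it: an arbitrarily
  small multiple of the growing solution with exponent 1 - \<alpha> eventually exceeds any bound and
  serves as a barrier at a late time. Positions are compared, not densities, so the degeneracy of
  the equation as \<mu> tends to 0 does no harm; only the monotonicity of g is used. The price is
  that X must be constructed with its derivatives. X inverts the distribution function of \<mu>, and
  the time derivative of that function has to be extracted from the distributional continuity
  equation with explicit smooth test functions.\<close>

lemma has_real_derivative_pos_part_square:
  fixes s :: real
  shows "((\<lambda>s. (max 0 s)\<^sup>2) has_real_derivative 2 * max 0 s) (at s within A)"
proof -
  have "((\<lambda>s::real. (max 0 s)\<^sup>2) has_real_derivative 2 * max 0 s) (at s)"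
  proof (cases "s = 0")
    case True
    have "((\<lambda>h::real. (max 0 h)\<^sup>2 / h) \<longlongrightarrow> 0) (at 0)"
    proof (rule Lim_null_comparison)
      show "eventually (\<lambda>h::real. norm ((max 0 h)\<^sup>2 / h) \<le> \<bar>h\<bar>) (at 0)"
        by (rule always_eventually) (auto simp: max_def power2_eq_square)
      show "((\<lambda>h::real. \<bar>h\<bar>) \<longlongrightarrow> 0) (at 0)"
        by (intro tendsto_rabs_zero tendsto_ident_at)
    qed
    then show ?thesis
      using True by (simp add: DERIV_def)
  next
    case False
    show ?thesis
    proof (cases "s > 0")
      case True
      have "((\<lambda>s::real. s\<^sup>2) has_real_derivative 2 * max 0 s) (at s)"
        using True by (auto intro!: derivative_eq_intros)
      then show ?thesis
        by (rule has_field_derivative_transform_within_open[where S="{0<..}"]) (use True in auto)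
    next
      case neg: False
      have "((\<lambda>s::real. 0) has_real_derivative 2 * max 0 s) (at s)"
        using neg by auto
      then show ?thesis
        by (rule has_field_derivative_transform_within_open[where S="{..<0}"])
           (use False neg in auto)
    qed
  qed
  then show ?thesis
    by (rule has_field_derivative_at_within)
qed

text \<open>The equation is degenerate at both ends of \<open>(0, a)\<close>, where no boundary values are prescribed;
  the flux \<open>D\<close> vanishes there instead.  One tests the equation with the square of the positive
  part of \<open>Y\<close>.\<close>

lemma no_flux_max_principle:
  fixes Y Yt Yy D Dy :: "real \<Rightarrow> real \<Rightarrow> real" and lam kap a C t1 t2 :: real
  assumes kap: "kap > 0" and t12: "t1 < t2"
    and Yt: "\<And>t y. t \<in> {t1..t2} \<Longrightarrow> y \<in> {0<..<a} \<Longrightarrow>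
      ((\<lambda>t. Y t y) has_real_derivative Yt t y) (at t within {t1..t2})"
    and Ytt: "\<And>t y. t \<in> {t1..t2} \<Longrightarrow> y \<in> {0<..<a} \<Longrightarrow>
      ((\<lambda>t. Yt t y) has_real_derivative lam * Yt t y + kap * Y t y + Dy t y) (at t within {t1..t2})"
    and Yy: "\<And>t y. t \<in> {t1..t2} \<Longrightarrow> y \<in> {0<..<a} \<Longrightarrow>
      (Y t has_real_derivative Yy t y) (at y)"
    and Dy: "\<And>t y. t \<in> {t1..t2} \<Longrightarrow> y \<in> {0<..<a} \<Longrightarrow>
      (D t has_real_derivative Dy t y) (at y)"
    and sign: "\<And>t y. t \<in> {t1..t2} \<Longrightarrow> y \<in> {0<..<a} \<Longrightarrow> Yy t y * D t y \<le> 0"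
    and cY: "continuous_on ({t1..t2} \<times> {0<..<a}) (\<lambda>(t, y). Y t y)"
    and cYt: "continuous_on ({t1..t2} \<times> {0<..<a}) (\<lambda>(t, y). Yt t y)"
    and cDy: "continuous_on ({t1..t2} \<times> {0<..<a}) (\<lambda>(t, y). Dy t y)"
    and flux: "\<And>e. e > 0 \<Longrightarrow> \<exists>r>0. \<forall>t\<in>{t1..t2}. \<forall>y\<in>{0<..<a}. y < r \<or> a - r < y \<longrightarrow> \<bar>D t y\<bar> \<le> e"
    and bdd: "\<And>t y. t \<in> {t1..t2} \<Longrightarrow> y \<in> {0<..<a} \<Longrightarrow> Y t y \<le> C"
    and init: "\<And>y. y \<in> {0<..<a} \<Longrightarrow> Y t1 y \<le> 0"
    and final: "\<And>y. y \<in> {0<..<a} \<Longrightarrow> Y t2 y \<le> 0"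
    and ts: "ts \<in> {t1..t2}" and ys: "ys \<in> {0<..<a}"
  shows "Y ts ys \<le> 0"
proof (rule ccontr)
  assume "\<not> Y ts ys \<le> 0"
  then have pos: "Y ts ys > 0" by simp
  have "C > 0" using bdd[OF ts ys] pos by linarith
  \<comment> \<open>The square is taken because \<phi> is differentiated in time and in y, and the
    positive part itself is not C^1. Both \<open>init\<close> and \<open>final\<close> make \<phi>
    (Y t y) vanish at the two end times.\<close>
  define \<phi> where "\<phi> = (\<lambda>s::real. (max 0 s)\<^sup>2)"
  have \<phi>_nonneg: "\<phi> s \<ge> 0" for s by (simp add: \<phi>_def)
  have \<phi>_mult: "\<phi> s * s \<ge> 0" for s by (auto simp: \<phi>_def max_def)
  have \<phi>_zero: "\<phi> s = 0" if "s \<le> 0" for s using that by (simp add: \<phi>_def max_def)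
  have \<phi>_deriv: "(\<phi> has_real_derivative 2 * max 0 s) (at s within A)" for s A
    unfolding \<phi>_def by (rule has_real_derivative_pos_part_square)
  have c\<phi>: "continuous_on A \<phi>" for A
    unfolding \<phi>_def by (intro continuous_intros)
  \<comment> \<open>Integrating factor: it cancels the first-order term lam * Yt, which has no
    sign.\<close>
  define w where "w = (\<lambda>t. exp (- lam * t))"
  have w_pos: "w t > 0" for t by (simp add: w_def)
  have cw: "continuous_on A w" for A unfolding w_def by (intro continuous_intros)
  define H where "H = (\<lambda>(t, y). w t * (kap * (\<phi> (Y t y) * Y t y)))"
  have H_nonneg: "H x \<ge> 0" for x
    using w_pos kap \<phi>_mult by (simp add: H_def case_prod_unfold mult_nonneg_nonneg less_imp_le)
  have cfst: "continuous_on A (\<lambda>x::real\<times>real. g (fst x))" if "continuous_on UNIV g" for g :: "real \<Rightarrow> real" and A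
    by (rule continuous_on_compose2[OF that]) (auto intro: continuous_intros)
  have c\<phi>Y: "continuous_on ({t1..t2} \<times> {0<..<a}) (\<lambda>(t, y). \<phi> (Y t y))"
    using continuous_on_compose2[OF c\<phi>[of UNIV] cY] by (simp add: case_prod_unfold)
  have cH: "continuous_on ({t1..t2} \<times> {0<..<a}) H"
    using cY c\<phi>Y unfolding H_def case_prod_unfold
    by (intro continuous_intros cfst cw)
  have cbox_eq: "cbox (t1, y1) (t2, y2) = {t1..t2} \<times> {y1..y2}" for y1 y2 :: real
    by (simp add: cbox_Pair_eq)
  have key: "\<exists>r>0. \<forall>y1 y2. 0 < y1 \<and> y1 < r \<and> a - r < y2 \<and> y2 < a \<and> y1 \<le> y2 \<longrightarrow>
       integral (cbox (t1, y1) (t2, y2)) H \<le> integral {t1..t2} w * (2 * C\<^sup>2 * e)" if e: "e > 0" for e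
  proof -
    obtain r where r: "r > 0"
      "\<And>t y. t \<in> {t1..t2} \<Longrightarrow> y \<in> {0<..<a} \<Longrightarrow> y < r \<or> a - r < y \<Longrightarrow> \<bar>D t y\<bar> \<le> e"
      using flux[OF e] by blast
    have "integral (cbox (t1, y1) (t2, y2)) H \<le> integral {t1..t2} w * (2 * C\<^sup>2 * e)"
      if y12: "0 < y1" "y1 < r" "a - r < y2" "y2 < a" "y1 \<le> y2" for y1 y2
    proof -
      have sub: "{y1..y2} \<subseteq> {0<..<a}" using y12 by auto
      \<comment> \<open>\<open>Gt\<close> is the time derivative of \<open>G\<close> with the
        equation for Yt inserted. Its time integral is zero because \<phi> (Y) vanishes at t1 and
        t2. Integrating \<phi> (Y) * Dy by parts in y turns every interior contribution into a
        nonnegative one, so that \<open>H\<close> is controlled by the flux at y1 and y2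
        alone.\<close>
      define G where "G = (\<lambda>t y. w t * \<phi> (Y t y) * Yt t y)"
      define Gt where "Gt = (\<lambda>t y. w t * (2 * max 0 (Y t y) * (Yt t y)\<^sup>2 + \<phi> (Y t y) * (kap * Y t y + Dy t y)))"
      have G_deriv: "((\<lambda>t. G t y) has_real_derivative Gt t y) (at t within {t1..t2})"
        if "t \<in> {t1..t2}" "y \<in> {y1..y2}" for t y
      proof -
        have y: "y \<in> {0<..<a}" using sub that by auto
        have 1: "((\<lambda>t. \<phi> (Y t y)) has_real_derivative 2 * max 0 (Y t y) * Yt t y) (at t within {t1..t2})"
          using DERIV_chain2[OF \<phi>_deriv[where A=UNIV] Yt[OF that(1) y]] .
        have 2: "(w has_real_derivative - lam * w t) (at t within {t1..t2})"
          unfolding w_def by (auto intro!: derivative_eq_intros)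
        show ?thesis
          unfolding G_def Gt_def
          by (rule DERIV_cong[OF DERIV_mult[OF DERIV_mult[OF 2 1] Ytt[OF that(1) y]]])
             (simp add: algebra_simps power2_eq_square)
      qed
      have cGt: "continuous_on ({t1..t2} \<times> {y1..y2}) (\<lambda>(t, y). Gt t y)"
        unfolding Gt_def case_prod_unfold
        by (intro continuous_intros cfst cw continuous_on_subset[OF cY, unfolded case_prod_unfold]
            continuous_on_subset[OF c\<phi>Y, unfolded case_prod_unfold]
            continuous_on_subset[OF cYt, unfolded case_prod_unfold]
            continuous_on_subset[OF cDy, unfolded case_prod_unfold]) (use sub in auto)
      have "integral {t1..t2} (\<lambda>t. Gt t y) = 0" if y: "y \<in> {y1..y2}" for y
      proof -
        have "((\<lambda>t. Gt t y) has_integral (G t2 y - G t1 y)) {t1..t2}"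
          by (rule fundamental_theorem_of_calculus)
             (use t12 G_deriv[OF _ y] in \<open>auto simp: has_real_derivative_iff_has_vector_derivative[symmetric]\<close>)
        moreover have "G t2 y = 0" "G t1 y = 0"
          using init final sub y by (auto simp: G_def \<phi>_zero)
        ultimately show ?thesis by (simp add: integral_unique)
      qed
      then have "integral {y1..y2} (\<lambda>y. integral {t1..t2} (\<lambda>t. Gt t y)) = integral {y1..y2} (\<lambda>y. 0)"
        by (rule integral_cong)
      moreover have "integral {t1..t2} (\<lambda>t. integral {y1..y2} (\<lambda>y. Gt t y)) =
          integral {y1..y2} (\<lambda>y. integral {t1..t2} (\<lambda>t. Gt t y))"
        using integral_swap_continuous[of t1 y1 t2 y2 Gt] cGt by (simp add: cbox_eq)
      ultimately have zero: "integral {t1..t2} (\<lambda>t. integral {y1..y2} (\<lambda>y. Gt t y)) = 0"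
        by simp
      have cHb: "continuous_on ({t1..t2} \<times> {y1..y2}) H"
        by (rule continuous_on_subset[OF cH]) (use sub in auto)
      have lower: "integral {y1..y2} (\<lambda>y. H (t, y)) - w t * (2 * C\<^sup>2 * e) \<le> integral {y1..y2} (\<lambda>y. Gt t y)"
        if t: "t \<in> {t1..t2}" for t
      proof -
        \<comment> \<open>This is the y-derivative of \<phi> (Y) * D. Replacing it by its boundary
          values discards 2 * max 0 Y * Yt^2 and the term with Yy * D, which have favourable
          signs.\<close>
        define q where "q = (\<lambda>y. 2 * max 0 (Y t y) * Yy t y * D t y + \<phi> (Y t y) * Dy t y)"
        have q: "(q has_integral (\<phi> (Y t y2) * D t y2 - \<phi> (Y t y1) * D t y1)) {y1..y2}"
        proof (rule fundamental_theorem_of_calculus[OF y12(5)])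
          fix y assume y: "y \<in> {y1..y2}"
          then have y': "y \<in> {0<..<a}" using sub by auto
          have 1: "((\<lambda>y. \<phi> (Y t y)) has_real_derivative 2 * max 0 (Y t y) * Yy t y) (at y)"
            using DERIV_chain2[OF \<phi>_deriv[where A=UNIV] Yy[OF t y']] .
          have "((\<lambda>y. \<phi> (Y t y) * D t y) has_real_derivative q y) (at y)"
            by (rule DERIV_cong[OF DERIV_mult[OF 1 Dy[OF t y']]]) (simp add: q_def algebra_simps)
          then show "((\<lambda>y. \<phi> (Y t y) * D t y) has_vector_derivative q y) (at y within {y1..y2})"
            by (metis has_real_derivative_iff_has_vector_derivative has_field_derivative_at_within)
        qed
        have sl: "continuous_on {y1..y2} (\<lambda>y. k (t, y))"
          if "continuous_on ({t1..t2} \<times> {y1..y2}) k" for k :: "real \<times> real \<Rightarrow> real"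
          by (rule continuous_on_compose2[OF that]) (use t in \<open>auto intro!: continuous_intros\<close>)
        have iH: "(\<lambda>y. H (t, y)) integrable_on {y1..y2}"
          by (intro integrable_continuous_real sl cHb)
        have iG: "(\<lambda>y. Gt t y) integrable_on {y1..y2}"
          using integrable_continuous_real[OF sl[OF cGt]] by simp
        have \<phi>b: "\<phi> (Y t y) \<le> C\<^sup>2" if "y \<in> {y1..y2}" for y
        proof -
          have "y \<in> {0<..<a}" using that sub by auto
          then have "max 0 (Y t y) \<le> C"
            using bdd[OF t, of y] \<open>C > 0\<close> by auto
          then show ?thesis unfolding \<phi>_def by (intro power_mono) auto
        qed
        have prodb: "\<bar>\<phi> (Y t y) * D t y\<bar> \<le> C\<^sup>2 * e" if "y \<in> {y1..y2}" "\<bar>D t y\<bar> \<le> e" for y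
          unfolding abs_mult using \<phi>b[OF that(1)] that(2) \<phi>_nonneg by (intro mult_mono) auto
        have "\<bar>D t y1\<bar> \<le> e" by (rule r(2)[OF t]) (use y12 in auto)
        moreover have "\<bar>D t y2\<bar> \<le> e" by (rule r(2)[OF t]) (use y12 in auto)
        ultimately have qb: "integral {y1..y2} q \<ge> - (2 * C\<^sup>2 * e)"
          using prodb[of y1] prodb[of y2] y12 integral_unique[OF q] by auto
        have iwq: "(\<lambda>y. w t * q y) integrable_on {y1..y2}"
          using has_integral_mult_right[OF q] by blast
        have "H (t, y) + w t * q y \<le> Gt t y" if y: "y \<in> {y1..y2}" for y
        proof -
          have y': "y \<in> {0<..<a}" using sub y by auto
          have "2 * max 0 (Y t y) * (Yy t y * D t y) \<le> 0"
            by (rule mult_nonneg_nonpos[OF _ sign[OF t y']]) auto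
          then have "2 * max 0 (Y t y) * Yy t y * D t y \<le> 2 * max 0 (Y t y) * (Yt t y)\<^sup>2"
            by (smt (verit) mult.assoc mult_nonneg_nonneg zero_le_power2)
          then have "w t * (2 * max 0 (Y t y) * Yy t y * D t y) \<le> w t * (2 * max 0 (Y t y) * (Yt t y)\<^sup>2)"
            using w_pos[of t] by (intro mult_left_mono) auto
          then show ?thesis
            by (simp add: H_def q_def Gt_def algebra_simps)
        qed
        then have "integral {y1..y2} (\<lambda>y. H (t, y) + w t * q y) \<le> integral {y1..y2} (\<lambda>y. Gt t y)"
          using iH iG iwq by (intro integral_le integrable_add) auto
        also have "integral {y1..y2} (\<lambda>y. H (t, y) + w t * q y) =
            integral {y1..y2} (\<lambda>y. H (t, y)) + w t * integral {y1..y2} q"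
          using iH iwq by (simp add: integral_add)
        finally show ?thesis
          using mult_left_mono[OF qb less_imp_le[OF w_pos[of t]]] by simp
      qed
      have i1: "(\<lambda>t. integral {y1..y2} (\<lambda>y. H (t, y))) integrable_on {t1..t2}"
        using integral_integrable_2dim[of t1 y1 t2 y2 H] cHb by (simp add: cbox_eq)
      have i2: "(\<lambda>t. integral {y1..y2} (\<lambda>y. Gt t y)) integrable_on {t1..t2}"
        using integral_integrable_2dim[of t1 y1 t2 y2 "\<lambda>(t, y). Gt t y"] cGt by (simp add: cbox_eq)
      have iw: "(\<lambda>t. w t * c) integrable_on {t1..t2}" for c
        by (intro integrable_continuous_real continuous_intros cw)
      have "integral {t1..t2} (\<lambda>t. integral {y1..y2} (\<lambda>y. H (t, y)) - w t * (2 * C\<^sup>2 * e)) \<le> 0"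
        unfolding zero[symmetric] using lower i1 i2 iw
        by (intro integral_le integrable_diff) auto
      also have "integral {t1..t2} (\<lambda>t. integral {y1..y2} (\<lambda>y. H (t, y)) - w t * (2 * C\<^sup>2 * e)) =
          integral {t1..t2} (\<lambda>t. integral {y1..y2} (\<lambda>y. H (t, y))) - integral {t1..t2} w * (2 * C\<^sup>2 * e)"
        using i1 iw by (simp add: integral_diff)
      also have "integral {t1..t2} (\<lambda>t. integral {y1..y2} (\<lambda>y. H (t, y))) = integral (cbox (t1, y1) (t2, y2)) H"
        using integral_prod_continuous[of t1 y1 t2 y2 H] cHb by (simp add: cbox_eq)
      finally show ?thesis by simp
    qed
    then show ?thesis using r(1) by blast
  qed
  \<comment> \<open>A fixed window around ys. Since H \<ge> 0, its integral over this window is at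
    most that over any larger [y1, y2], and the latter can be pushed towards (0, a), where the flux
    is as small as desired.\<close>
  define u1 u2 where "u1 = ys / 2" and "u2 = (ys + a) / 2"
  have u12: "0 < u1" "u1 < ys" "ys < u2" "u2 < a" using ys by (auto simp: u1_def u2_def)
  define K where "K = integral (cbox (t1, u1) (t2, u2)) H"
  have cHu: "continuous_on (cbox (t1, y1) (t2, y2)) H" if "0 < y1" "y2 < a" for y1 y2
    unfolding cbox_eq by (rule continuous_on_subset[OF cH]) (use that in auto)
  define W where "W = integral {t1..t2} w * (2 * C\<^sup>2)"
  have W: "W \<ge> 0"
    unfolding W_def by (intro mult_nonneg_nonneg integral_nonneg integrable_continuous_real cw)
      (auto intro: less_imp_le[OF w_pos])
  have Kle: "K \<le> W * e" if e: "e > 0" for e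
  proof -
    obtain r where r: "r > 0" "\<And>y1 y2. 0 < y1 \<and> y1 < r \<and> a - r < y2 \<and> y2 < a \<and> y1 \<le> y2 \<Longrightarrow>
       integral (cbox (t1, y1) (t2, y2)) H \<le> integral {t1..t2} w * (2 * C\<^sup>2 * e)"
      using key[OF e] by blast
    define y1 y2 where "y1 = min u1 (r / 2)" and "y2 = max u2 (a - r / 2)"
    have y: "0 < y1" "y1 < r" "a - r < y2" "y2 < a" "y1 \<le> y2" "y1 \<le> u1" "u2 \<le> y2"
      using u12 r(1) by (auto simp: y1_def y2_def)
    have "K \<le> integral (cbox (t1, y1) (t2, y2)) H"
      unfolding K_def by (intro integral_subset_le integrable_continuous cHu)
        (use y u12 H_nonneg in \<open>auto simp: cbox_eq\<close>)
    also have "\<dots> \<le> integral {t1..t2} w * (2 * C\<^sup>2 * e)"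
      by (rule r(2)) (use y in auto)
    finally show ?thesis by (simp add: W_def)
  qed
  have "K \<le> 0 + e" if "e > 0" for e
  proof -
    have "K \<le> W * (e / (W + 1))"
      by (rule Kle) (use W that in simp)
    also have "\<dots> \<le> e" using W that by (simp add: field_simps)
    finally show ?thesis by simp
  qed
  then have "K \<le> 0" by (rule field_le_epsilon)
  moreover have "K \<ge> 0" unfolding K_def
    by (intro integral_nonneg integrable_continuous cHu) (use u12 H_nonneg in auto)
  ultimately have "K = 0" by simp
  then have "(H has_integral 0) (cbox (t1, u1) (t2, u2))"
    using integrable_continuous[OF cHu[OF u12(1,4)]] by (metis K_def integrable_integral)
  then have "H (ts, ys) = 0"
    by (rule has_integral_0_cbox_imp_0[OF cHu[OF u12(1,4)] H_nonneg])
       (use t12 u12 ts in \<open>auto simp: box_ne_empty Basis_prod_def cbox_eq\<close>)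
  then show False
    using pos kap w_pos[of ts] by (auto simp: H_def \<phi>_def)
qed

section \<open>Comparison of flows in the mass coordinate\<close>

text \<open>The barrier S combines both exponential solutions of s'' = (1 - 2\<alpha>) s' + \<alpha>
  (1 - \<alpha>) s. The decaying one dominates Z at t1, and a small multiple of the growing one
  dominates the bound C at some later t2. As S does not depend on y, subtracting it leaves the
  y-derivative and the flux unchanged, so the sign condition carries over to Z - S. The multiple is
  sent to zero at the end.\<close>

lemma comparison_decay:
  fixes Z Zt Zy D Dy :: "real \<Rightarrow> real \<Rightarrow> real" and \<alpha> a A C T t1 :: real
  assumes \<alpha>: "0 < \<alpha>" "\<alpha> < 1" and t1: "T < t1" and A: "A \<ge> 0"
    and Zt: "\<And>t y. t > T \<Longrightarrow> y \<in> {0<..<a} \<Longrightarrow> ((\<lambda>t. Z t y) has_real_derivative Zt t y) (at t)"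
    and Ztt: "\<And>t y. t > T \<Longrightarrow> y \<in> {0<..<a} \<Longrightarrow>
      ((\<lambda>t. Zt t y) has_real_derivative (1 - 2 * \<alpha>) * Zt t y + \<alpha> * (1 - \<alpha>) * Z t y + Dy t y) (at t)"
    and Zy: "\<And>t y. t > T \<Longrightarrow> y \<in> {0<..<a} \<Longrightarrow> (Z t has_real_derivative Zy t y) (at y)"
    and Dy: "\<And>t y. t > T \<Longrightarrow> y \<in> {0<..<a} \<Longrightarrow> (D t has_real_derivative Dy t y) (at y)"
    and sign: "\<And>t y. t > T \<Longrightarrow> y \<in> {0<..<a} \<Longrightarrow> Zy t y * D t y \<le> 0"
    and cZ: "continuous_on ({T<..} \<times> {0<..<a}) (\<lambda>(t, y). Z t y)"
    and cZt: "continuous_on ({T<..} \<times> {0<..<a}) (\<lambda>(t, y). Zt t y)"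
    and cDy: "continuous_on ({T<..} \<times> {0<..<a}) (\<lambda>(t, y). Dy t y)"
    and flux: "\<And>e. e > 0 \<Longrightarrow> \<exists>r>0. \<forall>t>T. \<forall>y\<in>{0<..<a}. y < r \<or> a - r < y \<longrightarrow> \<bar>D t y\<bar> \<le> e"
    and bdd: "\<And>t y. t > T \<Longrightarrow> y \<in> {0<..<a} \<Longrightarrow> Z t y \<le> C"
    and init: "\<And>y. y \<in> {0<..<a} \<Longrightarrow> Z t1 y \<le> A"
    and ts: "ts \<ge> t1" and ys: "ys \<in> {0<..<a}"
  shows "Z ts ys \<le> A * exp (- \<alpha> * (ts - t1))"
proof -
  have "Z ts ys \<le> A * exp (- \<alpha> * (ts - t1)) + e" if e: "e > 0" for e
  proof -
    \<comment> \<open>Chosen so that the growing part of the barrier contributes exactly e at the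
      time ts.\<close>
    define B where "B = e / exp ((1 - \<alpha>) * (ts - t1))"
    have B: "B > 0" using e by (simp add: B_def)
    define S where "S = (\<lambda>t. A * exp (- \<alpha> * (t - t1)) + B * exp ((1 - \<alpha>) * (t - t1)))"
    define S' where "S' = (\<lambda>t. - \<alpha> * A * exp (- \<alpha> * (t - t1)) + (1 - \<alpha>) * B * exp ((1 - \<alpha>) * (t - t1)))"
    have S_nonneg: "S t \<ge> 0" for t unfolding S_def using A B by simp
    have S1: "(S has_real_derivative S' t) (at t within X)" for t X
      unfolding S_def S'_def by (auto intro!: derivative_eq_intros)
    have S2: "(S' has_real_derivative (1 - 2 * \<alpha>) * S' t + \<alpha> * (1 - \<alpha>) * S t) (at t within X)" for t X
      unfolding S_def S'_def
      by (auto intro!: derivative_eq_intros simp: algebra_simps)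
    have cS: "continuous_on X S" "continuous_on X S'" for X
      unfolding S_def S'_def by (auto intro!: continuous_intros)
    obtain t2 where t2: "t2 > ts" "C \<le> S t2"
    proof -
      \<comment> \<open>The estimate exp s \<ge> 1 + s makes the growing part reach C by this
        time.\<close>
      define t2 where "t2 = max (ts + 1) (t1 + C / B / (1 - \<alpha>))"
      have "C / B = (1 - \<alpha>) * (C / B / (1 - \<alpha>))" using \<alpha> by simp
      also have "\<dots> \<le> (1 - \<alpha>) * (t2 - t1)"
        using \<alpha> by (intro mult_left_mono) (auto simp: t2_def)
      also have "\<dots> \<le> exp ((1 - \<alpha>) * (t2 - t1))"
        using exp_ge_add_one_self[of "(1 - \<alpha>) * (t2 - t1)"] by linarith
      finally have "C \<le> B * exp ((1 - \<alpha>) * (t2 - t1))"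
        using B by (simp add: field_simps)
      also have "\<dots> \<le> S t2" using A by (simp add: S_def)
      finally show ?thesis by (intro that[of t2]) (auto simp: t2_def)
    qed
    have c2: "continuous_on ({t1..t2} \<times> {0<..<a}) (\<lambda>(t, y). k t y - h t)"
      if "continuous_on ({T<..} \<times> {0<..<a}) (\<lambda>(t, y). k t y)" "continuous_on UNIV h"
      for k :: "real \<Rightarrow> real \<Rightarrow> real" and h :: "real \<Rightarrow> real"
    proof -
      have "continuous_on ({t1..t2} \<times> {0<..<a}) (\<lambda>x. k (fst x) (snd x))"
        by (rule continuous_on_subset[OF that(1)[unfolded case_prod_unfold]]) (use t1 in auto)
      moreover have "continuous_on ({t1..t2} \<times> {0<..<a}) (\<lambda>x. h (fst x))"
        by (rule continuous_on_compose2[OF that(2)]) (auto intro: continuous_intros)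
      ultimately show ?thesis
        unfolding case_prod_unfold by (rule continuous_on_diff)
    qed
    have "Z ts ys - S ts \<le> 0"
    proof (rule no_flux_max_principle[where Y = "\<lambda>t y. Z t y - S t" and Yt = "\<lambda>t y. Zt t y - S' t"
          and Yy = Zy and D = D and Dy = Dy and lam = "1 - 2 * \<alpha>" and kap = "\<alpha> * (1 - \<alpha>)"
          and ?t1.0 = t1 and ?t2.0 = t2 and a = a and C = C])
      show "\<alpha> * (1 - \<alpha>) > 0" using \<alpha> by simp
      show "t1 < t2" using t2 ts by simp
      show "ts \<in> {t1..t2}" "ys \<in> {0<..<a}" using ts t2 ys by auto
      show "continuous_on ({t1..t2} \<times> {0<..<a}) (\<lambda>(t, y). Z t y - S t)" by (rule c2[OF cZ cS(1)])
      show "continuous_on ({t1..t2} \<times> {0<..<a}) (\<lambda>(t, y). Zt t y - S' t)" by (rule c2[OF cZt cS(2)])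
      show "continuous_on ({t1..t2} \<times> {0<..<a}) (\<lambda>(t, y). Dy t y)"
        by (rule continuous_on_subset[OF cDy]) (use t1 in auto)
      show "Z t1 y - S t1 \<le> 0" if "y \<in> {0<..<a}" for y
        using init[OF that] B by (simp add: S_def)
      show "Z t2 y - S t2 \<le> 0" if "y \<in> {0<..<a}" for y
        using bdd[OF _ that, of t2] t2 ts t1 by auto
      show "\<exists>r>0. \<forall>t\<in>{t1..t2}. \<forall>y\<in>{0<..<a}. y < r \<or> a - r < y \<longrightarrow> \<bar>D t y\<bar> \<le> e" if "e > 0" for e
        using flux[OF that] t1 by (meson atLeastAtMost_iff less_le_trans)
      fix t y assume t: "t \<in> {t1..t2}" and y: "y \<in> {0<..<a}"
      have tT: "t > T" using t t1 by auto
      show "((\<lambda>t. Z t y - S t) has_real_derivative Zt t y - S' t) (at t within {t1..t2})"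
        by (rule DERIV_diff[OF has_field_derivative_at_within[OF Zt[OF tT y]] S1])
      show "((\<lambda>t. Zt t y - S' t) has_real_derivative
          (1 - 2 * \<alpha>) * (Zt t y - S' t) + \<alpha> * (1 - \<alpha>) * (Z t y - S t) + Dy t y) (at t within {t1..t2})"
        by (rule DERIV_cong[OF DERIV_diff[OF has_field_derivative_at_within[OF Ztt[OF tT y]] S2]])
           (simp add: algebra_simps)
      show "((\<lambda>y. Z t y - S t) has_real_derivative Zy t y) (at y)"
        by (rule DERIV_cong[OF DERIV_diff[OF Zy[OF tT y] DERIV_const]]) simp
      show "(D t has_real_derivative Dy t y) (at y)" by (rule Dy[OF tT y])
      show "Zy t y * D t y \<le> 0" by (rule sign[OF tT y])
      show "Z t y - S t \<le> C" using bdd[OF tT y] S_nonneg[of t] by simp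
    qed
    then show ?thesis by (simp add: S_def B_def)
  qed
  then show ?thesis by (rule field_le_epsilon)
qed

text \<open>In the mass coordinate \<open>y\<close>, \<open>X t y\<close> is the position at time \<open>t\<close> of the particle that has mass
  \<open>y\<close> to its left; \<open>V\<close> is its velocity, \<open>u\<close> the density and \<open>F\<close> the pressure gradient there.\<close>

definition lagrangian_flow ::
    "real \<Rightarrow> real \<Rightarrow> real \<Rightarrow> real \<Rightarrow> real \<Rightarrow> (real \<Rightarrow> real \<Rightarrow> real) \<Rightarrow> (real \<Rightarrow> real \<Rightarrow> real) \<Rightarrow>
     (real \<Rightarrow> real \<Rightarrow> real) \<Rightarrow> (real \<Rightarrow> real \<Rightarrow> real) \<Rightarrow> bool" where
  "lagrangian_flow \<alpha> \<theta> a R T X V u F \<longleftrightarrow>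
     (\<forall>t>T. \<forall>y\<in>{0<..<a}.
        ((\<lambda>t. X t y) has_real_derivative V t y) (at t) \<and>
        ((\<lambda>t. V t y) has_real_derivative (1 - 2 * \<alpha>) * V t y + \<alpha> * (1 - \<alpha>) * X t y + F t y) (at t) \<and>
        (X t has_real_derivative 1 / u t y) (at y) \<and>
        ((\<lambda>y. \<theta> / (\<theta> + 1) * u t y powr (\<theta> + 1)) has_real_derivative F t y) (at y) \<and>
        u t y > 0 \<and> \<bar>X t y\<bar> \<le> R) \<and>
     continuous_on ({T<..} \<times> {0<..<a}) (\<lambda>(t, y). X t y) \<and>
     continuous_on ({T<..} \<times> {0<..<a}) (\<lambda>(t, y). V t y) \<and>
     continuous_on ({T<..} \<times> {0<..<a}) (\<lambda>(t, y). F t y) \<and>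
     (\<forall>e>0. \<exists>r>0. \<forall>t>T. \<forall>y\<in>{0<..<a}. y < r \<or> a - r < y \<longrightarrow> u t y \<le> e)"

text \<open>The two flows enter the difference through D = g(u1) - g(u2). Ellipticity is
  monotonicity: 1 / u decreases in u while g increases, so the y-derivative of X1 - X2 and D have
  opposite signs. D is small near 0 and a because each density is. The bound is one-sided;
  exchanging the flows gives the other side.\<close>

lemma lagrangian_flow_contraction:
  assumes \<alpha>: "0 < \<alpha>" "\<alpha> < 1" and \<theta>: "\<theta> > 0" and t1: "T < t1" and A: "A \<ge> 0"
    and 1: "lagrangian_flow \<alpha> \<theta> a R1 T X1 V1 u1 F1"
    and 2: "lagrangian_flow \<alpha> \<theta> a R2 T X2 V2 u2 F2"
    and init: "\<And>y. y \<in> {0<..<a} \<Longrightarrow> X1 t1 y - X2 t1 y \<le> A"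
    and ts: "ts \<ge> t1" and ys: "ys \<in> {0<..<a}"
  shows "X1 ts ys - X2 ts ys \<le> A * exp (- \<alpha> * (ts - t1))"
proof -
  define g where "g = (\<lambda>s. \<theta> / (\<theta> + 1) * s powr (\<theta> + 1))"
  have g_mono: "g r \<le> g s" if "0 \<le> r" "r \<le> s" for r s
    unfolding g_def using that \<theta> by (intro mult_left_mono powr_mono2) auto
  have g_nonneg: "g s \<ge> 0" for s unfolding g_def using \<theta> by simp
  have g_small: "\<exists>d>0. \<forall>s. 0 < s \<and> s \<le> d \<longrightarrow> g s \<le> e" if e: "e > 0" for e
  proof (intro exI conjI allI impI)
    show "e powr (1 / (\<theta> + 1)) > 0" using e by simp
    fix s assume s: "0 < s \<and> s \<le> e powr (1 / (\<theta> + 1))"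
    have "g s \<le> 1 * s powr (\<theta> + 1)"
      unfolding g_def using \<theta> by (intro mult_right_mono) auto
    also have "\<dots> \<le> 1 * (e powr (1 / (\<theta> + 1))) powr (\<theta> + 1)"
      using s \<theta> by (intro mult_left_mono powr_mono2) auto
    also have "\<dots> = e" using e \<theta> by (simp add: powr_powr)
    finally show "g s \<le> e" .
  qed
  note d1 = 1[unfolded lagrangian_flow_def, folded g_def]
  note d2 = 2[unfolded lagrangian_flow_def, folded g_def]
  have cdiff: "continuous_on S (\<lambda>(t, y). k t y - h t y)"
    if "continuous_on S (\<lambda>(t, y). k t y)" "continuous_on S (\<lambda>(t, y). h t y)"
    for k h :: "real \<Rightarrow> real \<Rightarrow> real" and S
    using continuous_on_diff[OF that] by (simp add: case_prod_unfold)
  show ?thesis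
  proof (rule comparison_decay[where Z = "\<lambda>t y. X1 t y - X2 t y" and Zt = "\<lambda>t y. V1 t y - V2 t y"
        and Zy = "\<lambda>t y. 1 / u1 t y - 1 / u2 t y" and D = "\<lambda>t y. g (u1 t y) - g (u2 t y)"
        and Dy = "\<lambda>t y. F1 t y - F2 t y" and C = "R1 + R2" and T = T and a = a])
    show "continuous_on ({T<..} \<times> {0<..<a}) (\<lambda>(t, y). X1 t y - X2 t y)"
         "continuous_on ({T<..} \<times> {0<..<a}) (\<lambda>(t, y). V1 t y - V2 t y)"
         "continuous_on ({T<..} \<times> {0<..<a}) (\<lambda>(t, y). F1 t y - F2 t y)"
      using d1 d2 by (auto intro: cdiff)
    show "\<exists>r>0. \<forall>t>T. \<forall>y\<in>{0<..<a}. y < r \<or> a - r < y \<longrightarrow> \<bar>g (u1 t y) - g (u2 t y)\<bar> \<le> e"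
      if e: "e > 0" for e
    proof -
      obtain d where d: "d > 0" "\<And>s. 0 < s \<Longrightarrow> s \<le> d \<Longrightarrow> g s \<le> e" using g_small[OF e] by blast
      obtain r1 where r1: "r1 > 0" "\<And>t y. t > T \<Longrightarrow> y \<in> {0<..<a} \<Longrightarrow> y < r1 \<or> a - r1 < y \<Longrightarrow> u1 t y \<le> d"
        using d1 d(1) by meson
      obtain r2 where r2: "r2 > 0" "\<And>t y. t > T \<Longrightarrow> y \<in> {0<..<a} \<Longrightarrow> y < r2 \<or> a - r2 < y \<Longrightarrow> u2 t y \<le> d"
        using d2 d(1) by meson
      show ?thesis
      proof (intro exI[of _ "min r1 r2"] conjI allI ballI impI)
        show "min r1 r2 > 0" using r1 r2 by simp
        fix t y assume ty: "T < t" "y \<in> {0<..<a}" "y < min r1 r2 \<or> a - min r1 r2 < y"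
        have "0 \<le> g (u1 t y)" "g (u1 t y) \<le> e" "0 \<le> g (u2 t y)" "g (u2 t y) \<le> e"
          using r1(2)[OF ty(1,2)] r2(2)[OF ty(1,2)] ty(3) g_nonneg
            conjunct1[OF d1, rule_format, OF ty(1,2)] conjunct1[OF d2, rule_format, OF ty(1,2)]
          by (auto intro!: d(2) simp: min_def split: if_splits)
        then show "\<bar>g (u1 t y) - g (u2 t y)\<bar> \<le> e" by linarith
      qed
    qed
    fix t y assume ty: "t > T" "y \<in> {0<..<a}"
    note e1 = conjunct1[OF d1, rule_format, OF ty]
    note e2 = conjunct1[OF d2, rule_format, OF ty]
    show "((\<lambda>t. X1 t y - X2 t y) has_real_derivative V1 t y - V2 t y) (at t)"
      using e1 e2 by (intro DERIV_diff) auto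
    have "((\<lambda>t. V1 t y - V2 t y) has_real_derivative ((1 - 2 * \<alpha>) * V1 t y + \<alpha> * (1 - \<alpha>) * X1 t y + F1 t y) -
        ((1 - 2 * \<alpha>) * V2 t y + \<alpha> * (1 - \<alpha>) * X2 t y + F2 t y)) (at t)"
      using e1 e2 by (intro DERIV_diff) auto
    then show "((\<lambda>t. V1 t y - V2 t y) has_real_derivative
        (1 - 2 * \<alpha>) * (V1 t y - V2 t y) + \<alpha> * (1 - \<alpha>) * (X1 t y - X2 t y) + (F1 t y - F2 t y)) (at t)"
      by (rule DERIV_cong) (simp add: algebra_simps)
    show "((\<lambda>y. X1 t y - X2 t y) has_real_derivative 1 / u1 t y - 1 / u2 t y) (at y)"
      using e1 e2 by (intro DERIV_diff) auto
    show "((\<lambda>y. g (u1 t y) - g (u2 t y)) has_real_derivative F1 t y - F2 t y) (at y)"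
      using e1 e2 unfolding g_def by (intro DERIV_diff) auto
    have u: "u1 t y > 0" "u2 t y > 0" using e1 e2 by auto
    show "(1 / u1 t y - 1 / u2 t y) * (g (u1 t y) - g (u2 t y)) \<le> 0"
    proof (cases "u1 t y \<le> u2 t y")
      case True
      then have "1 / u1 t y \<ge> 1 / u2 t y" using u by (intro divide_left_mono) auto
      then show ?thesis using g_mono[of "u1 t y" "u2 t y"] True u by (intro mult_nonneg_nonpos) auto
    next
      case False
      then have "1 / u1 t y \<le> 1 / u2 t y" using u by (intro divide_left_mono) auto
      then show ?thesis using g_mono[of "u2 t y" "u1 t y"] False u by (intro mult_nonpos_nonneg) auto
    qed
    show "X1 t y - X2 t y \<le> R1 + R2" using e1 e2 by linarith
  qed (use \<alpha> t1 A init ts ys in auto)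
qed

corollary lagrangian_flow_contraction_abs:
  assumes "0 < \<alpha>" "\<alpha> < 1" "\<theta> > 0" "T < t1"
    and "lagrangian_flow \<alpha> \<theta> a R1 T X1 V1 u1 F1" "lagrangian_flow \<alpha> \<theta> a R2 T X2 V2 u2 F2"
    and init: "\<And>y. y \<in> {0<..<a} \<Longrightarrow> \<bar>X1 t1 y - X2 t1 y\<bar> \<le> A"
    and "ts \<ge> t1" and ys: "ys \<in> {0<..<a}"
  shows "\<bar>X1 ts ys - X2 ts ys\<bar> \<le> A * exp (- \<alpha> * (ts - t1))"
proof -
  have A: "A \<ge> 0" using init[OF ys] by linarith
  have "X1 t1 y - X2 t1 y \<le> A" "X2 t1 y - X1 t1 y \<le> A" if "y \<in> {0<..<a}" for y
    using init[OF that] by linarith+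
  then have "X1 ts ys - X2 ts ys \<le> A * exp (- \<alpha> * (ts - t1))"
    "X2 ts ys - X1 ts ys \<le> A * exp (- \<alpha> * (ts - t1))"
    using lagrangian_flow_contraction[OF assms(1-4) A assms(5,6) _ assms(8,9)]
      lagrangian_flow_contraction[OF assms(1-4) A assms(6,5) _ assms(8,9)] by auto
  then show ?thesis by linarith
qed

text \<open>The system is autonomous, so a flow may be compared with its own later positions. The
  shift must go forward because the flow exists only after T.\<close>

lemma lagrangian_flow_shift:
  assumes "lagrangian_flow \<alpha> \<theta> a R T X V u F" and h: "h \<ge> 0"
  shows "lagrangian_flow \<alpha> \<theta> a R T (\<lambda>t. X (t + h)) (\<lambda>t. V (t + h)) (\<lambda>t. u (t + h)) (\<lambda>t. F (t + h))"
proof -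
  have c: "continuous_on ({T<..} \<times> {0<..<a}) (\<lambda>(t, y). k (t + h) y)"
    if "continuous_on ({T<..} \<times> {0<..<a}) (\<lambda>(t, y). k t y)" for k :: "real \<Rightarrow> real \<Rightarrow> real"
  proof -
    have "continuous_on ({T<..} \<times> {0<..<a}) (\<lambda>x. case (fst x + h, snd x) of (t, y) \<Rightarrow> k t y)"
      by (rule continuous_on_compose2[OF that]) (use h in \<open>auto intro!: continuous_intros\<close>)
    then show ?thesis by (simp add: case_prod_unfold)
  qed
  note d = assms(1)[unfolded lagrangian_flow_def]
  show ?thesis
    unfolding lagrangian_flow_def
  proof (intro conjI allI impI ballI c)
    fix t y assume ty: "T < t" "y \<in> {0<..<a}"
    then have th: "T < t + h" using h by simp
    note e = conjunct1[OF d, rule_format, OF th ty(2)]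
    show "((\<lambda>t. X (t + h) y) has_real_derivative V (t + h) y) (at t)"
      using e by (subst DERIV_shift[symmetric]) simp
    show "((\<lambda>t. V (t + h) y) has_real_derivative
         (1 - 2 * \<alpha>) * V (t + h) y + \<alpha> * (1 - \<alpha>) * X (t + h) y + F (t + h) y) (at t)"
      using e DERIV_shift[of "\<lambda>t. V t y" _ t h] by simp
  next
    fix e :: real assume "e > 0"
    then obtain r where "r > 0" "\<forall>t>T. \<forall>y\<in>{0<..<a}. y < r \<or> a - r < y \<longrightarrow> u t y \<le> e"
      using d by meson
    then show "\<exists>r>0. \<forall>t>T. \<forall>y\<in>{0<..<a}. y < r \<or> a - r < y \<longrightarrow> u (t + h) y \<le> e"
      using h by (intro exI[of _ r]) auto
  qed (use d h in auto)
qed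

text \<open>X and its translate by h are two flows, at distance at most B * h at time t1 by the mean
  value theorem. The contraction, divided by h, passes to the limit h to 0. Working with difference
  quotients avoids an equation for V, for which the pressure gradient F would have to be
  differentiated.\<close>

lemma lagrangian_flow_velocity_decay:
  assumes \<alpha>: "0 < \<alpha>" "\<alpha> < 1" and \<theta>: "\<theta> > 0" and t1: "T < t1"
    and flow: "lagrangian_flow \<alpha> \<theta> a R T X V u F"
    and B: "\<And>t y. t \<ge> t1 \<Longrightarrow> y \<in> {0<..<a} \<Longrightarrow> \<bar>V t y\<bar> \<le> B"
    and ts: "ts \<ge> t1" and ys: "ys \<in> {0<..<a}"
  shows "\<bar>V ts ys\<bar> \<le> B * exp (- \<alpha> * (ts - t1))"
proof -
  have Xt: "((\<lambda>t. X t y) has_real_derivative V t y) (at t)" if "t > T" "y \<in> {0<..<a}" for t y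
    using flow that unfolding lagrangian_flow_def by blast
  have quot: "\<bar>(X (ts + h) ys - X ts ys) / h\<bar> \<le> B * exp (- \<alpha> * (ts - t1))" if h: "h > 0" for h
  proof -
    have "\<bar>X (t1 + h) y - X t1 y\<bar> \<le> B * h" if y: "y \<in> {0<..<a}" for y
    proof -
      have "\<exists>z. t1 < z \<and> z < t1 + h \<and> X (t1 + h) y - X t1 y = (t1 + h - t1) * V z y"
        by (rule MVT2) (use h t1 y Xt in auto)
      then obtain z where z: "t1 < z" "X (t1 + h) y - X t1 y = h * V z y" by auto
      show ?thesis using B[OF _ y, of z] z h by (simp add: abs_mult)
    qed
    then have "\<bar>X (ts + h) ys - X ts ys\<bar> \<le> B * h * exp (- \<alpha> * (ts - t1))"
      using lagrangian_flow_contraction_abs[OF \<alpha> \<theta> t1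
          lagrangian_flow_shift[OF flow less_imp_le[OF h]] flow _ ts ys] by simp
    then show ?thesis using h by (simp add: field_simps abs_divide)
  qed
  have "((\<lambda>h. (X (ts + h) ys - X ts ys) / h) \<longlongrightarrow> V ts ys) (at_right 0)"
    using Xt[of ts ys] t1 ts ys by (auto simp: DERIV_def intro: tendsto_mono[OF at_le])
  then have "((\<lambda>h. \<bar>(X (ts + h) ys - X ts ys) / h\<bar>) \<longlongrightarrow> \<bar>V ts ys\<bar>) (at_right 0)"
    by (rule tendsto_rabs)
  then show ?thesis
    by (rule tendsto_upperbound)
       (use quot in \<open>auto simp: eventually_at_right_field intro!: exI[of _ 1]\<close>)
qed

section \<open>From Eulerian to Lagrangian variables\<close>

text \<open>Continuity of one partial derivative near the point is enough; the other has to exist at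
  the point only. Convexity of Y permits the mean value argument along the second variable.\<close>

lemma has_derivative_continuous_partials:
  fixes f d :: "real \<times> real \<Rightarrow> real"
  assumes X: "open X" "x \<in> X" and Y: "open Y" "convex Y" "t \<in> Y"
    and fx: "((\<lambda>x. f (x, t)) has_real_derivative c) (at x)"
    and ft: "\<And>x t. x \<in> X \<Longrightarrow> t \<in> Y \<Longrightarrow> ((\<lambda>t. f (x, t)) has_real_derivative d (x, t)) (at t)"
    and d: "continuous_on (X \<times> Y) d"
  shows "(f has_derivative (\<lambda>(h, k). c * h + d (x, t) * k)) (at (x, t))"
proof -
  have "((\<lambda>(x, t). f (x, t)) has_derivative
      (\<lambda>(h, k). c * h + blinfun_apply (blinfun_mult_right (d (x, t))) k)) (at (x, t) within X \<times> Y)"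
  proof (rule has_derivative_partialsI)
    have "continuous_on (X \<times> Y) (\<lambda>z. blinfun_mult_right (d z))"
      by (rule bounded_linear.continuous_on[OF bounded_linear_blinfun_mult_right d])
    then show "continuous (at (x, t) within X \<times> Y) (\<lambda>(x, t). blinfun_mult_right (d (x, t)))"
      using X Y by (simp add: case_prod_unfold continuous_on_eq_continuous_within)
  qed (use fx ft Y in \<open>auto simp: has_field_derivative_def intro: has_derivative_at_withinI\<close>)
  moreover have "at (x, t) within X \<times> Y = at (x, t)"
    by (rule at_within_open) (use X Y in \<open>auto intro: open_Times\<close>)
  ultimately show ?thesis by (simp only: blinfun_mult_right.rep_eq case_prod_eta)
qed

text \<open>Here \<open>(x, t)\<close> are the rescaled variables, written \<open>(\<eta>, \<tau>)\<close> in the paper; \<open>\<mu>\<close> is the density and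
  \<open>p = \<partial>\<^sub>x (v + \<alpha> x\<^sup>2 / 2)\<close>.  The stationary profile is the instance \<open>p = 0\<close>.\<close>

locale rescaled_flow =
  fixes \<alpha> \<theta> a R T :: real and \<mu> p px pt :: "real \<times> real \<Rightarrow> real"
  assumes theta: "\<theta> > 0" and mass_pos: "a > 0"
    and mu_uc: "uniformly_continuous_on (UNIV \<times> {T<..}) \<mu>"
    and mu_nonneg: "\<And>x t. t > T \<Longrightarrow> \<mu> (x, t) \<ge> 0"
    and mu_zero: "\<And>x t. t > T \<Longrightarrow> \<bar>x\<bar> > R \<Longrightarrow> \<mu> (x, t) = 0"
    and mu_interval: "\<And>t. t > T \<Longrightarrow> \<exists>l r. {x. \<mu> (x, t) > 0} = {l<..<r}"
    and mass: "\<And>t. t > T \<Longrightarrow> integral {- R..R} (\<lambda>s. \<mu> (s, t)) = a"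
    and transport: "\<And>x t. t > T \<Longrightarrow>
      ((\<lambda>t. integral {- R..x} (\<lambda>s. \<mu> (s, t))) has_real_derivative \<mu> (x, t) * p (x, t)) (at t)"
    and p_cont: "continuous_on (UNIV \<times> {T<..}) p"
    and p_deriv: "\<And>x t. t > T \<Longrightarrow> \<mu> (x, t) > 0 \<Longrightarrow>
      (p has_derivative (\<lambda>(h, k). h * px (x, t) + k * pt (x, t))) (at (x, t))"
    and px_cont: "continuous_on {z. snd z > T \<and> \<mu> z > 0} px"
    and pt_cont: "continuous_on {z. snd z > T \<and> \<mu> z > 0} pt"
    and momentum: "\<And>x t. t > T \<Longrightarrow> \<mu> (x, t) > 0 \<Longrightarrow>
      ((\<lambda>s. \<mu> (s, t) powr \<theta>) has_real_derivative
        p (x, t) * px (x, t) - pt (x, t) + (1 - 2 * \<alpha>) * p (x, t) - \<alpha> * (1 - \<alpha>) * x) (at x)"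
begin

section \<open>Distribution function and particle positions\<close>

definition \<Omega> where "\<Omega> = {z. snd z > T \<and> \<mu> z > 0}"
definition cdf where "cdf x t = integral {- R..x} (\<lambda>s. \<mu> (s, t))"
definition X where "X t y = (THE x. \<mu> (x, t) > 0 \<and> cdf x t = y)"
text \<open>By \<open>momentum\<close> this is the pressure gradient, the x-derivative of \<mu> powr
  \<theta>. Written through p and its derivatives it is visibly continuous on \<Omega>.\<close>

definition F where "F = (\<lambda>(x, t). p (x, t) * px (x, t) - pt (x, t) + (1 - 2 * \<alpha>) * p (x, t) - \<alpha> * (1 - \<alpha>) * x)"

lemma mu_cont: "continuous_on (UNIV \<times> {T<..}) \<mu>"
  using mu_uc by (rule uniformly_continuous_imp_continuous)

lemma mu_cont_slice: "t > T \<Longrightarrow> continuous_on A (\<lambda>s. \<mu> (s, t))"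
  by (rule continuous_on_compose2[OF mu_cont]) (auto intro!: continuous_intros)

lemma mu_integrable: "t > T \<Longrightarrow> (\<lambda>s. \<mu> (s, t)) integrable_on {l..r}"
  by (intro integrable_continuous_real mu_cont_slice)

lemma open_\<Omega>: "open \<Omega>"
proof -
  have "open ((UNIV \<times> {T<..}) \<inter> \<mu> -` {0<..})"
    by (rule continuous_open_preimage[OF mu_cont]) (auto intro: open_Times)
  also have "(UNIV \<times> {T<..}) \<inter> \<mu> -` {0<..} = \<Omega>"
    by (auto simp: \<Omega>_def)
  finally show ?thesis .
qed

lemma interval_bounds:
  assumes "t > T"
  obtains l r where "{x. \<mu> (x, t) > 0} = {l<..<r}" "- R \<le> l" "l < r" "r \<le> R"
proof -
  obtain l r where lr: "{x. \<mu> (x, t) > 0} = {l<..<r}" using mu_interval[OF assms] by blast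
  have "l < r"
  proof (rule ccontr)
    assume "\<not> l < r"
    then have "{x. \<mu> (x, t) > 0} = {}" using lr by simp
    then have "\<mu> (s, t) = 0" for s using mu_nonneg[OF assms, of s] by (auto simp: less_le)
    then show False using mass[OF assms] mass_pos by simp
  qed
  have "{l<..<r} \<subseteq> {- R..R}"
  proof
    fix x assume "x \<in> {l<..<r}"
    then have "\<mu> (x, t) > 0" using lr by auto
    then have "\<not> \<bar>x\<bar> > R" using mu_zero[OF assms, of x] by auto
    then show "x \<in> {- R..R}" by auto
  qed
  then have "- R \<le> l" "r \<le> R" using \<open>l < r\<close> by (auto simp: greaterThanLessThan_subseteq_atLeastAtMost_iff)
  then show ?thesis using that lr \<open>l < r\<close> by blast
qed

lemma R_pos: "R > 0"
proof -
  have "T + 1 > T" by simp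
  then show ?thesis by (rule interval_bounds) linarith
qed

lemma pos_imp_bounds: "t > T \<Longrightarrow> \<mu> (x, t) > 0 \<Longrightarrow> - R < x \<and> x < R"
  by (rule interval_bounds[of t]) (auto simp: set_eq_iff)

text \<open>The base point -R is arbitrary: there is no mass to its left, so starting at any -L
  \<le> -R gives the same function. This covers x1 < -R as well, where the integral defining
  \<open>cdf\<close> runs over an empty interval.\<close>

lemma cdf_diff:
  assumes t: "t > T" and le: "x1 \<le> x2"
  shows "cdf x2 t - cdf x1 t = integral {x1..x2} (\<lambda>s. \<mu> (s, t))"
proof -
  have ext: "cdf x t = integral {- L..x} (\<lambda>s. \<mu> (s, t))" if L: "L \<ge> R" for x L
  proof (cases "x < - R")
    case True
    have "integral {- L..x} (\<lambda>s. \<mu> (s, t)) = integral {- L..x} (\<lambda>s. 0)"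
      by (rule integral_cong) (use True R_pos in \<open>auto intro!: mu_zero[OF t]\<close>)
    then show ?thesis using True by (simp add: cdf_def)
  next
    case False
    have "integral {- L..- R} (\<lambda>s. \<mu> (s, t)) = integral {- L..- R} (\<lambda>s. 0)"
    proof (rule integral_spike[of "{- R}"])
      show "0 = \<mu> (x, t)" if "x \<in> {- L..- R} - {- R}" for x
        using mu_zero[OF t, of x] that R_pos by auto
    qed auto
    moreover have "integral {- L..- R} (\<lambda>s. \<mu> (s, t)) + integral {- R..x} (\<lambda>s. \<mu> (s, t)) = integral {- L..x} (\<lambda>s. \<mu> (s, t))"
      by (rule Henstock_Kurzweil_Integration.integral_combine) (use False L mu_integrable[OF t] in auto)
    ultimately show ?thesis by (simp add: cdf_def)
  qed
  define L where "L = max R (- x1)"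
  have "integral {- L..x1} (\<lambda>s. \<mu> (s, t)) + integral {x1..x2} (\<lambda>s. \<mu> (s, t)) = integral {- L..x2} (\<lambda>s. \<mu> (s, t))"
    by (rule Henstock_Kurzweil_Integration.integral_combine) (use le mu_integrable[OF t] in \<open>auto simp: L_def\<close>)
  then show ?thesis using ext[of L x1] ext[of L x2] by (simp add: L_def)
qed

lemma cdf_mono: "t > T \<Longrightarrow> x1 \<le> x2 \<Longrightarrow> cdf x1 t \<le> cdf x2 t"
  using cdf_diff[of t x1 x2] integral_nonneg[OF mu_integrable, of t x1 x2] mu_nonneg[of t] by simp

lemma cdf_lipschitz:
  assumes t: "t > T" and C: "\<And>s. \<mu> (s, t) \<le> C"
  shows "\<bar>cdf x2 t - cdf x1 t\<bar> \<le> C * \<bar>x2 - x1\<bar>"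
proof -
  have *: "\<bar>cdf x2 t - cdf x1 t\<bar> \<le> C * \<bar>x2 - x1\<bar>" if le: "x1 \<le> x2" for x1 x2
  proof -
    have "integral {x1..x2} (\<lambda>s. \<mu> (s, t)) \<le> integral {x1..x2} (\<lambda>s. C)"
      by (intro integral_le mu_integrable[OF t] C) auto
    then show ?thesis
      using cdf_diff[OF t le] cdf_mono[OF t le] le by (simp add: mult.commute)
  qed
  show ?thesis using *[of x1 x2] *[of x2 x1] by (cases "x1 \<le> x2") (auto simp: abs_minus_commute)
qed

lemma cdf_deriv:
  assumes t: "t > T" and x: "- R < x" "x < R"
  shows "((\<lambda>x. cdf x t) has_real_derivative \<mu> (x, t)) (at x)"
proof -
  have "((\<lambda>x. cdf x t) has_real_derivative \<mu> (x, t)) (at x within {- R..R})"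
    unfolding cdf_def by (rule integral_has_real_derivative[OF mu_cont_slice[OF t]]) (use x in auto)
  then show ?thesis using at_within_Icc_at[OF x] by simp
qed

text \<open>The positivity set is an interval, so there is no vacuum between x1 and x2 and the
  derivative \<mu> of \<open>cdf\<close> is positive all the way. This is what makes particle
  positions unique.\<close>

lemma cdf_strict:
  assumes t: "t > T" and pos: "\<mu> (x1, t) > 0" "\<mu> (x2, t) > 0" and less: "x1 < x2"
  shows "cdf x1 t < cdf x2 t"
proof -
  obtain l r where lr: "{x. \<mu> (x, t) > 0} = {l<..<r}" "- R \<le> l" "l < r" "r \<le> R"
    using interval_bounds[OF t] .
  have b: "l < x1" "x2 < r" using pos lr(1) by (auto simp: set_eq_iff)
  show ?thesis
  proof (rule DERIV_pos_imp_increasing[OF less])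
    fix x assume x: "x1 \<le> x" "x \<le> x2"
    then have "x \<in> {x. \<mu> (x, t) > 0}" unfolding lr(1) using b by auto
    then show "\<exists>y. ((\<lambda>x. cdf x t) has_real_derivative y) (at x) \<and> 0 < y"
      using cdf_deriv[OF t, of x] x b lr by auto
  qed
qed

lemma cdf_range:
  assumes t: "t > T" and pos: "\<mu> (x, t) > 0"
  shows "cdf x t \<in> {0<..<a}"
proof -
  obtain l r where lr: "{x. \<mu> (x, t) > 0} = {l<..<r}" "- R \<le> l" "l < r" "r \<le> R"
    using interval_bounds[OF t] .
  have b: "l < x" "x < r" using pos lr(1) by (auto simp: set_eq_iff)
  define x1 x2 where "x1 = (l + x) / 2" and "x2 = (r + x) / 2"
  have "x1 \<in> {x. \<mu> (x, t) > 0}" "x2 \<in> {x. \<mu> (x, t) > 0}"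
    unfolding lr(1) using b by (auto simp: x1_def x2_def)
  then have "cdf x1 t < cdf x t" "cdf x t < cdf x2 t"
    using cdf_strict[OF t _ pos] cdf_strict[OF t pos] b by (auto simp: x1_def x2_def)
  moreover have "cdf (- R) t \<le> cdf x1 t" "cdf x2 t \<le> cdf R t"
    using b lr by (auto intro!: cdf_mono[OF t] simp: x1_def x2_def)
  moreover have "cdf (- R) t = 0" "cdf R t = a"
    using mass[OF t] by (auto simp: cdf_def)
  ultimately show ?thesis by auto
qed

lemma X_eqI: "t > T \<Longrightarrow> \<mu> (x, t) > 0 \<Longrightarrow> X t (cdf x t) = x"
  unfolding X_def
proof (rule the_equality)
  fix x' assume "t > T" "\<mu> (x, t) > 0" "\<mu> (x', t) > 0 \<and> cdf x' t = cdf x t"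
  then show "x' = x"
    using cdf_strict[of t x x'] cdf_strict[of t x' x] by (cases x x' rule: linorder_cases) auto
qed auto

text \<open>The intermediate value theorem yields a point with distribution value y. It lies
  strictly inside the support interval, since to the left of it the value would be 0 and to the
  right of it a.\<close>

lemma X_props:
  assumes t: "t > T" and y: "y \<in> {0<..<a}"
  shows X_pos: "\<mu> (X t y, t) > 0" and cdf_X: "cdf (X t y) t = y"
proof -
  obtain l r where lr: "{x. \<mu> (x, t) > 0} = {l<..<r}" "- R \<le> l" "l < r" "r \<le> R"
    using interval_bounds[OF t] .
  have z: "\<mu> (s, t) = 0" if "s \<le> l \<or> r \<le> s" for s
  proof -
    have "s \<notin> {x. \<mu> (x, t) > 0}" unfolding lr(1) using that by auto
    then show ?thesis using mu_nonneg[OF t, of s] by auto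
  qed
  have ends: "cdf (- R) t = 0" "cdf R t = a" using mass[OF t] by (auto simp: cdf_def)
  have "continuous_on {- R..R} (\<lambda>x. cdf x t)"
    unfolding cdf_def by (rule indefinite_integral_continuous_1[OF mu_integrable[OF t]])
  then obtain x where x: "- R \<le> x" "x \<le> R" "cdf x t = y"
    using IVT'[of "\<lambda>x. cdf x t" "- R" y R] ends y R_pos by auto
  have "l < x"
  proof (rule ccontr)
    assume "\<not> l < x"
    then have "integral {- R..x} (\<lambda>s. \<mu> (s, t)) = integral {- R..x} (\<lambda>s. 0)"
      by (intro integral_cong z) auto
    then show False using x y by (simp add: cdf_def)
  qed
  moreover have "x < r"
  proof (rule ccontr)
    assume "\<not> x < r"
    then have "integral {x..R} (\<lambda>s. \<mu> (s, t)) = integral {x..R} (\<lambda>s. 0)"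
      by (intro integral_cong z) auto
    then show False using cdf_diff[OF t x(2)] x y ends by simp
  qed
  ultimately have "x \<in> {x. \<mu> (x, t) > 0}" unfolding lr(1) by simp
  then have "X t y = x" "\<mu> (x, t) > 0" using X_eqI[OF t, of x] x by auto
  then show "\<mu> (X t y, t) > 0" "cdf (X t y) t = y" using x by auto
qed

lemma cdf_has_derivative:
  assumes t: "t > T" and x: "- R < x" "x < R"
  shows "((\<lambda>z. cdf (fst z) (snd z)) has_derivative (\<lambda>(h, k). \<mu> (x, t) * h + \<mu> (x, t) * p (x, t) * k)) (at (x, t))"
proof (rule has_derivative_continuous_partials[where X = UNIV and Y = "{T<..}" and d = "\<lambda>z. \<mu> z * p z"])
  show "continuous_on (UNIV \<times> {T<..}) (\<lambda>z. \<mu> z * p z)" by (intro continuous_intros mu_cont p_cont)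
qed (use t cdf_deriv[OF t x] transport in \<open>auto simp: cdf_def\<close>)

text \<open>Inverse function theorem for (x, t) \<mapsto> (cdf x t, t), with the inverse (y, t)
  \<mapsto> (X t y, t) already at hand. Inverting the triangular derivative with entries \<mu>,
  \<mu> * p and 1 gives 1 / \<mu> in y and -p in t; the density cancels in the latter, so particles
  move with velocity -p.\<close>

lemma X_has_derivative:
  assumes t: "t > T" and y: "y \<in> {0<..<a}"
  shows "((\<lambda>(y, t). X t y) has_derivative
    (\<lambda>(h, k). h / \<mu> (X t y, t) - p (X t y, t) * k)) (at (y, t))"
proof -
  define x where "x = X t y"
  have pos: "\<mu> (x, t) > 0" and cy: "cdf x t = y"
    using X_pos[OF t y] cdf_X[OF t y] by (auto simp: x_def)
  define f where "f = (\<lambda>z. (cdf (fst z) (snd z), snd z))"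
  define f' where "f' = (\<lambda>z. (\<mu> (x, t) * fst z + \<mu> (x, t) * p (x, t) * snd z, snd z))"
  define g where "g = (\<lambda>z. (X (snd z) (fst z), snd z))"
  define g' where "g' = (\<lambda>z. (fst z / \<mu> (x, t) - p (x, t) * snd z, snd z))"
  have der: "(f has_derivative (\<lambda>z. (\<mu> w * fst z + \<mu> w * p w * snd z, snd z))) (at w)" if "w \<in> \<Omega>" for w
  proof -
    obtain x t where w: "w = (x, t)" by (cases w)
    have xt: "t > T" "- R < x" "x < R" using that pos_imp_bounds[of t x] w by (auto simp: \<Omega>_def)
    show ?thesis
      unfolding f_def w
      using cdf_has_derivative[OF xt] by (auto intro!: derivative_eq_intros simp: case_prod_unfold)
  qed
  have "(g has_derivative g') (at (f (x, t)))"
  proof (rule has_derivative_inverse_strong[OF open_\<Omega>, where f = f and x = "(x, t)" and f' = f'])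
    show "(x, t) \<in> \<Omega>" using pos t by (simp add: \<Omega>_def)
    then show "(f has_derivative f') (at (x, t))" using der by (simp add: f'_def)
    show "continuous_on \<Omega> f"
      by (rule continuous_at_imp_continuous_on) (use der in \<open>auto intro: has_derivative_continuous\<close>)
    show "g (f x) = x" if "x \<in> \<Omega>" for x
      using that X_eqI by (cases x) (auto simp: g_def f_def \<Omega>_def)
    show "f' \<circ> g' = id"
      using pos by (auto simp: f'_def g'_def fun_eq_iff algebra_simps)
  qed
  then have "((\<lambda>z. fst (g z)) has_derivative (\<lambda>z. fst (g' z))) (at (f (x, t)))"
    by (rule has_derivative_fst)
  then show ?thesis
    unfolding f_def g_def g'_def fst_conv snd_conv cy case_prod_unfold by (simp add: x_def)
qed

lemma X_cont: "continuous_on ({T<..} \<times> {0<..<a}) (\<lambda>(t, y). X t y)"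
proof -
  have "continuous_on ({0<..<a} \<times> {T<..}) (\<lambda>(y, t). X t y)"
    by (rule continuous_at_imp_continuous_on)
       (use has_derivative_continuous[OF X_has_derivative] in auto)
  then have "continuous_on ({T<..} \<times> {0<..<a}) (\<lambda>z. case prod.swap z of (y, t) \<Rightarrow> X t y)"
    by (rule continuous_on_compose2[OF _ continuous_on_swap]) auto
  then show ?thesis by (simp add: case_prod_unfold)
qed

lemma along_X_cont:
  assumes "continuous_on \<Omega> k"
  shows "continuous_on ({T<..} \<times> {0<..<a}) (\<lambda>(t, y). k (X t y, t))"
proof -
  have "continuous_on ({T<..} \<times> {0<..<a}) (\<lambda>z. k (X (fst z) (snd z), fst z))"
  proof (rule continuous_on_compose2[OF assms])
    show "continuous_on ({T<..} \<times> {0<..<a}) (\<lambda>z. (X (fst z) (snd z), fst z))"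
      by (intro continuous_on_Pair X_cont[unfolded case_prod_unfold] continuous_on_fst[OF continuous_on_id])
    show "(\<lambda>z. (X (fst z) (snd z), fst z)) ` ({T<..} \<times> {0<..<a}) \<subseteq> \<Omega>"
      using X_pos by (auto simp: \<Omega>_def)
  qed
  then show ?thesis by (simp add: case_prod_unfold)
qed

lemma X_deriv:
  assumes t: "t > T" and y: "y \<in> {0<..<a}"
  shows X_deriv_t: "((\<lambda>t. X t y) has_real_derivative - p (X t y, t)) (at t)"
    and X_deriv_y: "(X t has_real_derivative 1 / \<mu> (X t y, t)) (at y)"
proof -
  have 1: "((\<lambda>t. (y, t)) has_derivative (\<lambda>k. (0, k))) (at t)"
    and 2: "((\<lambda>y. (y, t)) has_derivative (\<lambda>k. (k, 0))) (at y)"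
    by (auto intro!: derivative_eq_intros)
  have "((\<lambda>t. X t y) has_derivative (\<lambda>k. - (p (X t y, t) * k))) (at t)"
    using has_derivative_compose[OF 1 X_has_derivative[OF t y]] by simp
  then show "((\<lambda>t. X t y) has_real_derivative - p (X t y, t)) (at t)"
    unfolding has_field_derivative_def by (rule has_derivative_eq_rhs) (simp add: fun_eq_iff)
  have "((\<lambda>y. X t y) has_derivative (\<lambda>k. k / \<mu> (X t y, t))) (at y)"
    using has_derivative_compose[OF 2 X_has_derivative[OF t y]] by simp
  then show "(X t has_real_derivative 1 / \<mu> (X t y, t)) (at y)"
    unfolding has_field_derivative_def by (rule has_derivative_eq_rhs) (simp add: fun_eq_iff)
qed

text \<open>If the density exceeds e at a particle, uniform continuity keeps it above e / 2 over a
  distance d / 2 on either side, with d independent of t. So mass at least e * d / 4 lies on each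
  side, and the label y is that far from 0 and from a.\<close>

lemma tails:
  assumes e: "e > 0"
  shows "\<exists>r>0. \<forall>t>T. \<forall>y\<in>{0<..<a}. y < r \<or> a - r < y \<longrightarrow> \<mu> (X t y, t) \<le> e"
proof -
  obtain d where d: "d > 0" "\<And>z w. z \<in> UNIV \<times> {T<..} \<Longrightarrow> w \<in> UNIV \<times> {T<..} \<Longrightarrow> dist w z < d \<Longrightarrow> dist (\<mu> w) (\<mu> z) < e / 2"
    using mu_uc e unfolding uniformly_continuous_on_def by (meson half_gt_zero)
  have near: "\<mu> (s, t) \<ge> e / 2" if "t > T" "\<mu> (x, t) > e" "\<bar>s - x\<bar> \<le> d / 2" for s x t
  proof -
    have "dist (s, t) (x, t) < d" using that(3) d(1) by (simp add: dist_Pair_Pair dist_real_def)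
    then have "dist (\<mu> (s, t)) (\<mu> (x, t)) < e / 2" using d(2)[of "(x, t)" "(s, t)"] that(1) by auto
    then show ?thesis using that(2) unfolding dist_real_def by arith
  qed
  have "e * d / 4 \<le> y \<and> y \<le> a - e * d / 4" if t: "t > T" and y: "y \<in> {0<..<a}" and big: "\<mu> (X t y, t) > e" for t y
  proof -
    define x where "x = X t y"
    have int: "integral {l..l + d / 2} (\<lambda>s. \<mu> (s, t)) \<ge> e * d / 4" if "l = x \<or> l = x - d / 2" for l
    proof -
      have "integral {l..l + d / 2} (\<lambda>s. e / 2) \<le> integral {l..l + d / 2} (\<lambda>s. \<mu> (s, t))"
        by (intro integral_le mu_integrable[OF t] near[OF t big])
           (use that d(1) in \<open>auto simp: x_def\<close>)
      then show ?thesis using d(1) by (simp add: mult.commute)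
    qed
    have pos: "\<mu> (x - d / 2, t) > 0" "\<mu> (x + d / 2, t) > 0"
      using near[OF t big, of "x - d / 2"] near[OF t big, of "x + d / 2"] d(1) e by (auto simp: x_def)
    have "cdf x t - cdf (x - d / 2) t \<ge> e * d / 4" "cdf (x + d / 2) t - cdf x t \<ge> e * d / 4"
      using int[of x] int[of "x - d / 2"] d(1) cdf_diff[OF t, of "x - d / 2" x] cdf_diff[OF t, of x "x + d / 2"] by auto
    moreover have "cdf x t = y" using cdf_X[OF t y] by (simp add: x_def)
    ultimately show ?thesis using cdf_range[OF t pos(1)] cdf_range[OF t pos(2)] by auto
  qed
  note * = this
  show ?thesis
  proof (intro exI[of _ "e * d / 4"] conjI allI ballI impI)
    show "e * d / 4 > 0" using e d(1) by simp
    fix t y assume "T < t" "y \<in> {0<..<a}" "y < e * d / 4 \<or> a - e * d / 4 < y"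
    then show "\<mu> (X t y, t) \<le> e" using *[of t y] by linarith
  qed
qed

lemma px_pt_cont: "continuous_on \<Omega> px" "continuous_on \<Omega> pt"
  using px_cont pt_cont by (auto simp: \<Omega>_def)

lemma p_cont_\<Omega>: "continuous_on \<Omega> p"
  by (rule continuous_on_subset[OF p_cont]) (auto simp: \<Omega>_def)

lemma F_cont: "continuous_on \<Omega> F"
  unfolding F_def case_prod_unfold using px_pt_cont p_cont_\<Omega>
  by (auto intro!: continuous_intros)

lemma lagrangian:
  "lagrangian_flow \<alpha> \<theta> a R T X (\<lambda>t y. - p (X t y, t)) (\<lambda>t y. \<mu> (X t y, t)) (\<lambda>t y. F (X t y, t))"
  unfolding lagrangian_flow_def
proof (intro conjI allI impI ballI)
  show "continuous_on ({T<..} \<times> {0<..<a}) (\<lambda>(t, y). X t y)" by (rule X_cont)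
  show "continuous_on ({T<..} \<times> {0<..<a}) (\<lambda>(t, y). - p (X t y, t))"
    using along_X_cont[OF continuous_on_minus[OF p_cont_\<Omega>]] .
  show "continuous_on ({T<..} \<times> {0<..<a}) (\<lambda>(t, y). F (X t y, t))"
    by (rule along_X_cont[OF F_cont])
  show "\<exists>r>0. \<forall>t>T. \<forall>y\<in>{0<..<a}. y < r \<or> a - r < y \<longrightarrow> \<mu> (X t y, t) \<le> e" if "e > 0" for e
    by (rule tails[OF that])
  fix t y assume t: "T < t" and y: "y \<in> {0<..<a}"
  define x where "x = X t y"
  have pos: "\<mu> (x, t) > 0" using X_pos[OF t y] by (simp add: x_def)
  show "\<mu> (X t y, t) > 0" by (rule X_pos[OF t y])
  show "\<bar>X t y\<bar> \<le> R" using pos_imp_bounds[OF t X_pos[OF t y]] by auto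
  show "((\<lambda>t. X t y) has_real_derivative - p (X t y, t)) (at t)" by (rule X_deriv_t[OF t y])
  show Xy: "(X t has_real_derivative 1 / \<mu> (X t y, t)) (at y)" by (rule X_deriv_y[OF t y])
  have "((\<lambda>t. (X t y, t)) has_derivative (\<lambda>k. (- p (x, t) * k, k))) (at t)"
    unfolding x_def
    by (rule has_derivative_Pair[OF X_deriv_t[OF t y, unfolded has_field_derivative_def] has_derivative_ident])
  note p_along = has_derivative_compose[OF this p_deriv[OF t pos, unfolded x_def]]
  have "((\<lambda>t. p (X t y, t)) has_real_derivative (- p (x, t) * px (x, t) + pt (x, t))) (at t)"
    unfolding has_field_derivative_def
    by (rule has_derivative_eq_rhs[OF p_along]) (simp add: fun_eq_iff x_def algebra_simps)
  then show "((\<lambda>t. - p (X t y, t)) has_real_derivative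
      (1 - 2 * \<alpha>) * - p (X t y, t) + \<alpha> * (1 - \<alpha>) * X t y + F (X t y, t)) (at t)"
    by (rule DERIV_cong[OF DERIV_minus]) (simp add: F_def x_def algebra_simps)
  \<comment> \<open>\<open>momentum\<close> differentiates \<mu> powr \<theta>, so \<mu> powr
    (\<theta> + 1) is written as a power of that quantity. The chain rule produces a factor \<mu>,
    which cancels against the y-derivative 1 / \<mu> of X; this cancellation fixes the form of
    g.\<close>
  have "((\<lambda>s. (\<mu> (s, t) powr \<theta>) powr ((\<theta> + 1) / \<theta>)) has_real_derivative
      F (x, t) * ((\<theta> + 1) / \<theta> * (\<mu> (x, t) powr \<theta>) powr ((\<theta> + 1) / \<theta> - 1))) (at x)"
  proof -
    have "((\<lambda>s. s powr ((\<theta> + 1) / \<theta>)) has_real_derivative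
        (\<theta> + 1) / \<theta> * (\<mu> (x, t) powr \<theta>) powr ((\<theta> + 1) / \<theta> - 1)) (at (\<mu> (x, t) powr \<theta>))"
      by (rule has_real_derivative_powr) (use pos in simp)
    from DERIV_chain2[where f = "\<lambda>s. s powr ((\<theta> + 1) / \<theta>)" and g = "\<lambda>s. \<mu> (s, t) powr \<theta>",
        OF this momentum[OF t pos]]
    show ?thesis by (rule DERIV_cong) (simp add: F_def)
  qed
  also have "(\<mu> (x, t) powr \<theta>) powr ((\<theta> + 1) / \<theta> - 1) = \<mu> (x, t)"
    using pos theta by (simp add: powr_powr field_simps)
  also have "(\<lambda>s. (\<mu> (s, t) powr \<theta>) powr ((\<theta> + 1) / \<theta>)) = (\<lambda>s. \<mu> (s, t) powr (\<theta> + 1))"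
    using theta by (simp add: powr_powr)
  finally have "((\<lambda>y. \<mu> (X t y, t) powr (\<theta> + 1)) has_real_derivative
      F (x, t) * ((\<theta> + 1) / \<theta> * \<mu> (x, t)) * (1 / \<mu> (X t y, t))) (at y)"
    unfolding x_def by (rule DERIV_chain2[where f = "\<lambda>s. \<mu> (s, t) powr (\<theta> + 1)", OF _ Xy])
  from DERIV_cmult[OF this, of "\<theta> / (\<theta> + 1)"]
  show "((\<lambda>y. \<theta> / (\<theta> + 1) * \<mu> (X t y, t) powr (\<theta> + 1)) has_real_derivative F (X t y, t)) (at y)"
    by (rule DERIV_cong) (use pos theta in \<open>simp add: x_def\<close>)
qed

lemma velocity_decay:
  assumes "0 < \<alpha>" "\<alpha> < 1" "T < t1"
    and B: "\<And>x t. t \<ge> t1 \<Longrightarrow> \<mu> (x, t) > 0 \<Longrightarrow> \<bar>p (x, t)\<bar> \<le> B"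
    and "t \<ge> t1" and pos: "\<mu> (x, t) > 0"
  shows "\<bar>p (x, t)\<bar> \<le> B * exp (- \<alpha> * (t - t1))"
proof -
  have t: "t > T" using assms by simp
  have "\<bar>- p (X t y, t)\<bar> \<le> B" if "t \<ge> t1" "y \<in> {0<..<a}" for t y
    using B[OF that(1) X_pos[of t y]] that assms(3) by auto
  from lagrangian_flow_velocity_decay[OF assms(1,2) theta assms(3) lagrangian this assms(5) cdf_range[OF t pos]]
  show ?thesis using X_eqI[OF t pos] by simp
qed

end

text \<open>Positions within e of each other force the distribution functions to differ by at most C
  * e at points where the first density is positive, C being a Lipschitz constant of the second
  distribution function. Over an interval with density gap d the difference of the distribution
  functions grows by d times the length, and it can change by no more than 2 * C * e.\<close>

lemma density_gap_le:
  assumes A: "rescaled_flow \<alpha> \<theta> a R1 T \<mu>1 p1 px1 pt1" and B: "rescaled_flow \<alpha> \<theta> a R2 T \<mu>2 p2 px2 pt2"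
    and t: "t > T" and C: "\<And>s. \<mu>2 (s, t) \<le> C"
    and X: "\<And>y. y \<in> {0<..<a} \<Longrightarrow>
      \<bar>rescaled_flow.X R1 \<mu>1 t y - rescaled_flow.X R2 \<mu>2 t y\<bar> \<le> e"
    and x: "x1 \<le> x2" and d: "d > 0"
    and gap: "\<And>s. s \<in> {x1..x2} \<Longrightarrow> \<mu>2 (s, t) + d \<le> \<mu>1 (s, t)"
  shows "d * (x2 - x1) \<le> 2 * C * e"
proof -
  interpret A: rescaled_flow \<alpha> \<theta> a R1 T \<mu>1 p1 px1 pt1 by (rule A)
  interpret B: rescaled_flow \<alpha> \<theta> a R2 T \<mu>2 p2 px2 pt2 by (rule B)
  have C0: "C \<ge> 0" using C[of 0] B.mu_nonneg[OF t, of 0] by linarith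
  have cmp: "\<bar>A.cdf x t - B.cdf x t\<bar> \<le> C * e" if "x \<in> {x1..x2}" for x
  proof -
    \<comment> \<open>The gap makes the first density positive, so x is the position of a particle y
      of the first flow, and the position of the same particle in the second flow is within e of
      x.\<close>
    have pos: "\<mu>1 (x, t) > 0" using gap[OF that] B.mu_nonneg[OF t, of x] d by linarith
    define y where "y = A.cdf x t"
    have y: "y \<in> {0<..<a}" using A.cdf_range[OF t pos] by (simp add: y_def)
    have "A.X t y = x" using A.X_eqI[OF t pos] by (simp add: y_def)
    then have "\<bar>B.X t y - x\<bar> \<le> e" using X[OF y] by linarith
    moreover have "\<bar>B.cdf (B.X t y) t - B.cdf x t\<bar> \<le> C * \<bar>B.X t y - x\<bar>"
      by (rule B.cdf_lipschitz[OF t C])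
    ultimately have "\<bar>B.cdf (B.X t y) t - B.cdf x t\<bar> \<le> C * e"
      using C0 by (meson mult_left_mono order_trans)
    then show ?thesis using B.cdf_X[OF t y] by (simp add: y_def)
  qed
  have "d * (x2 - x1) = integral {x1..x2} (\<lambda>s. d)" using x by simp
  also have "\<dots> \<le> integral {x1..x2} (\<lambda>s. \<mu>1 (s, t) - \<mu>2 (s, t))"
    by (intro integral_le integrable_diff A.mu_integrable B.mu_integrable t) (use gap in \<open>auto simp: algebra_simps\<close>)
  also have "\<dots> = (A.cdf x2 t - A.cdf x1 t) - (B.cdf x2 t - B.cdf x1 t)"
    using A.cdf_diff[OF t x] B.cdf_diff[OF t x]
    by (simp add: integral_diff A.mu_integrable B.mu_integrable t)
  also have "\<dots> \<le> 2 * C * e" using cmp[of x1] cmp[of x2] x by auto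
  finally show ?thesis .
qed

section \<open>The self-similar profile and convergence to it\<close>

lemma exp_decay:
  fixes c :: real
  assumes "c > 0"
  shows "((\<lambda>t. exp (- c * (t - s))) \<longlongrightarrow> 0) at_top"
proof -
  have "filterlim (\<lambda>t. - s + t) at_top at_top"
    by (rule filterlim_tendsto_add_at_top[OF tendsto_const filterlim_ident])
  then have "filterlim (\<lambda>t. - c * (t - s)) at_bot at_top"
    using assms by (intro filterlim_tendsto_neg_mult_at_bot[OF tendsto_const]) simp_all
  then show ?thesis by (rule filterlim_compose[OF exp_at_bot])
qed

text \<open>An excess above e at one point spreads, by uniform continuity of both densities, to an
  excess of e - 2 * (e / 4) = e / 2 on an interval of fixed length d. The gap estimate bounds e / 2
  * d by a multiple of the distance of the positions, which starts at no more than R1 + R2 and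
  decays exponentially.\<close>

lemma flow_density_upper_limit:
  assumes A: "rescaled_flow \<alpha> \<theta> a R1 T \<mu>1 p1 px1 pt1" and B: "rescaled_flow \<alpha> \<theta> a R2 T \<mu>2 p2 px2 pt2"
    and \<alpha>: "0 < \<alpha>" "\<alpha> < 1" and C: "\<And>s t. t > T \<Longrightarrow> \<mu>2 (s, t) \<le> C" and e: "e > 0"
  shows "\<forall>\<^sub>F t in at_top. \<forall>x. \<mu>1 (x, t) \<le> \<mu>2 (x, t) + e"
proof -
  interpret A: rescaled_flow \<alpha> \<theta> a R1 T \<mu>1 p1 px1 pt1 by (rule A)
  interpret B: rescaled_flow \<alpha> \<theta> a R2 T \<mu>2 p2 px2 pt2 by (rule B)
  have e4: "e / 4 > 0" using e by simp
  obtain d1 where d1: "d1 > 0" "\<And>z w. z \<in> UNIV \<times> {T<..} \<Longrightarrow> w \<in> UNIV \<times> {T<..} \<Longrightarrow> dist w z < d1 \<Longrightarrow> dist (\<mu>1 w) (\<mu>1 z) < e / 4"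
    using A.mu_uc e4 unfolding uniformly_continuous_on_def by meson
  obtain d2 where d2: "d2 > 0" "\<And>z w. z \<in> UNIV \<times> {T<..} \<Longrightarrow> w \<in> UNIV \<times> {T<..} \<Longrightarrow> dist w z < d2 \<Longrightarrow> dist (\<mu>2 w) (\<mu>2 z) < e / 4"
    using B.mu_uc e4 unfolding uniformly_continuous_on_def by meson
  define d where "d = min d1 d2 / 2"
  have d: "d > 0" "d < d1" "d < d2" using d1 d2 by (auto simp: d_def)
  define t1 where "t1 = T + 1"
  have t1: "T < t1" by (simp add: t1_def)
  have close: "\<bar>A.X t y - B.X t y\<bar> \<le> (R1 + R2) * exp (- \<alpha> * (t - t1))"
    if "t \<ge> t1" "y \<in> {0<..<a}" for t y
  proof (rule lagrangian_flow_contraction_abs[OF \<alpha> A.theta t1 A.lagrangian B.lagrangian _ that])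
    fix y assume y: "y \<in> {0<..<a}"
    show "\<bar>A.X t1 y - B.X t1 y\<bar> \<le> R1 + R2"
      using A.pos_imp_bounds[OF t1 A.X_pos[OF t1 y]] B.pos_imp_bounds[OF t1 B.X_pos[OF t1 y]] by auto
  qed
  have "((\<lambda>t. 2 * C * ((R1 + R2) * exp (- \<alpha> * (t - t1)))) \<longlongrightarrow> 2 * C * ((R1 + R2) * 0)) at_top"
  proof (intro tendsto_intros)
    show "((\<lambda>t. exp (- \<alpha> * (t - t1))) \<longlongrightarrow> 0) at_top" by (rule exp_decay[OF \<alpha>(1)])
  qed
  then have small: "\<forall>\<^sub>F t in at_top. 2 * C * ((R1 + R2) * exp (- \<alpha> * (t - t1))) < e / 2 * d"
    by (rule order_tendstoD) (use e d in simp)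
  show ?thesis
    using small eventually_ge_at_top[of t1]
  proof eventually_elim
    fix t assume s: "2 * C * ((R1 + R2) * exp (- \<alpha> * (t - t1))) < e / 2 * d" and t: "t1 \<le> t"
    have tT: "T < t" using t t1 by simp
    show "\<forall>x. \<mu>1 (x, t) \<le> \<mu>2 (x, t) + e"
    proof (rule ccontr)
      assume "\<not> ?thesis"
      then obtain x where x: "\<mu>1 (x, t) > \<mu>2 (x, t) + e" by (auto simp: not_le)
      have "e / 2 * (x + d - x) \<le> 2 * C * ((R1 + R2) * exp (- \<alpha> * (t - t1)))"
      proof (rule density_gap_le[OF A B tT C[OF tT] close[OF t]])
        fix s assume s: "s \<in> {x..x + d}"
        then have "dist (s, t) (x, t) < d1" "dist (s, t) (x, t) < d2"
          using d by (auto simp: dist_Pair_Pair dist_real_def)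
        then have "dist (\<mu>1 (s, t)) (\<mu>1 (x, t)) < e / 4" "dist (\<mu>2 (s, t)) (\<mu>2 (x, t)) < e / 4"
          using d1(2)[of "(x, t)" "(s, t)"] d2(2)[of "(x, t)" "(s, t)"] tT by auto
        then show "\<mu>2 (s, t) + e / 2 \<le> \<mu>1 (s, t)"
          using x unfolding dist_real_def by arith
      qed (use d e in auto)
      then show False using s by simp
    qed
  qed
qed

lemma flow_density_convergence:
  assumes A: "rescaled_flow \<alpha> \<theta> a R1 T \<mu>1 p1 px1 pt1" and B: "rescaled_flow \<alpha> \<theta> a R2 T \<mu>2 p2 px2 pt2"
    and \<alpha>: "0 < \<alpha>" "\<alpha> < 1" and C1: "\<And>s t. t > T \<Longrightarrow> \<mu>1 (s, t) \<le> C1"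
    and C2: "\<And>s t. t > T \<Longrightarrow> \<mu>2 (s, t) \<le> C2" and e: "e > 0"
  shows "\<forall>\<^sub>F t in at_top. \<forall>x. \<bar>\<mu>1 (x, t) - \<mu>2 (x, t)\<bar> \<le> e"
proof -
  have "\<forall>\<^sub>F t in at_top. \<forall>x. \<mu>1 (x, t) \<le> \<mu>2 (x, t) + e"
    by (rule flow_density_upper_limit[OF A B \<alpha> _ e]) (rule C2)
  moreover have "\<forall>\<^sub>F t in at_top. \<forall>x. \<mu>2 (x, t) \<le> \<mu>1 (x, t) + e"
    by (rule flow_density_upper_limit[OF B A \<alpha> _ e]) (rule C1)
  ultimately show ?thesis
  proof eventually_elim
    case (elim t)
    show ?case
    proof
      fix x show "\<bar>\<mu>1 (x, t) - \<mu>2 (x, t)\<bar> \<le> e"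
        using elim(1)[rule_format, of x] elim(2)[rule_format, of x] by linarith
    qed
  qed
qed

lemma lebesgue_integral_compact_support:
  fixes f :: "real \<Rightarrow> real"
  assumes f: "continuous_on UNIV f" and z: "\<And>x. \<bar>x\<bar> > L \<Longrightarrow> f x = 0"
  shows "(LINT x|lebesgue. f x) = integral {- L..L} f"
proof -
  have "f = (\<lambda>x. indicator {- L..L} x *\<^sub>R f x)"
  proof
    fix x show "f x = indicator {- L..L} x *\<^sub>R f x"
      using z[of x] by (cases "\<bar>x\<bar> \<le> L") (auto simp: indicator_def)
  qed
  moreover have "set_integrable lborel {- L..L} f"
    unfolding set_integrable_def
    by (rule borel_integrable_compact) (auto intro: continuous_on_subset[OF f])
  ultimately have "integral\<^sup>L lborel f = integral {- L..L} f"
    using set_borel_integral_eq_integral(2)[of "{- L..L}" f] by (simp add: set_lebesgue_integral_def)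
  moreover have "f \<in> borel_measurable lborel"
    using borel_measurable_continuous_onI[OF f] by simp
  ultimately show ?thesis by (simp add: integral_completion)
qed

section \<open>The stationary profile: support, mass and its constant\<close>

context
  fixes \<theta> \<alpha> :: real
  assumes \<theta>: "\<theta> > 0" and \<alpha>: "0 < \<alpha>" "\<alpha> < 1"
begin

lemma profile_cont: "continuous_on A (profile \<theta> \<alpha> r)"
  unfolding profile_def using \<theta> by (intro continuous_on_powr' continuous_intros) auto

lemma profile_nonneg: "profile \<theta> \<alpha> r x \<ge> 0"
  by (simp add: profile_def)

lemma profile_pos_iff:
  assumes r: "r > 0"
  shows "profile \<theta> \<alpha> r x > 0 \<longleftrightarrow> \<bar>x\<bar> < sqrt (2 * r / (\<alpha> * (1 - \<alpha>)))"
proof -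
  define k where "k = \<alpha> * (1 - \<alpha>)"
  have k: "k > 0" using \<alpha> by (simp add: k_def)
  have "profile \<theta> \<alpha> r x > 0 \<longleftrightarrow> k / 2 * x\<^sup>2 < r"
    unfolding profile_def k_def[symmetric] by (auto simp: max_def)
  also have "\<dots> \<longleftrightarrow> x\<^sup>2 < 2 * r / k" using k by (simp add: field_simps)
  also have "\<dots> \<longleftrightarrow> sqrt (x\<^sup>2) < sqrt (2 * r / k)" by (rule real_sqrt_less_iff[symmetric])
  finally show ?thesis by (simp add: k_def)
qed

lemma profile_zero:
  assumes "r > 0" "\<bar>x\<bar> \<ge> sqrt (2 * r / (\<alpha> * (1 - \<alpha>)))"
  shows "profile \<theta> \<alpha> r x = 0"
  using profile_pos_iff[OF assms(1), of x] assms(2) profile_nonneg[of r x] by linarith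

text \<open>Substitution x = sqrt r * y: the height of the profile scales like r powr (1 / \<theta>)
  and its width like r powr (1 / 2).\<close>

lemma profile_mass_scaling:
  assumes r: "r > 0"
  shows "(LINT x|lebesgue. profile \<theta> \<alpha> r x) = r powr (1 / \<theta> + 1 / 2) * (LINT x|lebesgue. profile \<theta> \<alpha> 1 x)"
proof -
  have sc: "profile \<theta> \<alpha> r (sqrt r * y) = r powr (1 / \<theta>) * profile \<theta> \<alpha> 1 y" for y
  proof -
    have "max 0 (r - \<alpha> * (1 - \<alpha>) / 2 * (sqrt r * y)\<^sup>2) = r * max 0 (1 - \<alpha> * (1 - \<alpha>) / 2 * y\<^sup>2)"
      using r by (subst max_mult_distrib_left) (simp add: algebra_simps power_mult_distrib)
    then show ?thesis using r by (simp add: profile_def powr_mult)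
  qed
  have meas: "profile \<theta> \<alpha> s \<in> borel_measurable lborel" for s
    using borel_measurable_continuous_onI[OF profile_cont] by simp
  have "integral\<^sup>L lborel (profile \<theta> \<alpha> r) = \<bar>sqrt r\<bar> *\<^sub>R (\<integral>y. profile \<theta> \<alpha> r (0 + sqrt r * y) \<partial>lborel)"
    by (rule lborel_integral_real_affine) (use r in simp)
  also have "\<dots> = sqrt r * r powr (1 / \<theta>) * integral\<^sup>L lborel (profile \<theta> \<alpha> 1)"
    using r by (simp add: sc)
  also have "sqrt r * r powr (1 / \<theta>) = r powr (1 / \<theta> + 1 / 2)"
    using r by (simp add: powr_add powr_half_sqrt)
  finally show ?thesis using meas by (simp add: integral_completion)
qed

lemma profile_mass_pos: "(LINT x|lebesgue. profile \<theta> \<alpha> 1 x) > 0"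
proof -
  define L where "L = sqrt (2 * 1 / (\<alpha> * (1 - \<alpha>)))"
  have L: "L > 0" using \<alpha> by (simp add: L_def)
  have eq: "(LINT x|lebesgue. profile \<theta> \<alpha> 1 x) = integral {- L..L} (profile \<theta> \<alpha> 1)"
    by (rule lebesgue_integral_compact_support[OF profile_cont]) (simp add: profile_zero L_def)
  have "integral {- L..L} (profile \<theta> \<alpha> 1) \<noteq> 0"
    using integral_eq_0_iff[OF profile_cont, of "- L" L 1] profile_pos_iff[of 1 0] L profile_nonneg
    by (auto simp: L_def)
  moreover have "integral {- L..L} (profile \<theta> \<alpha> 1) \<ge> 0"
    by (intro integral_nonneg integrable_continuous_real profile_cont profile_nonneg)
  ultimately show ?thesis using eq by simp
qed

text \<open>\<open>R_const\<close> is a definite description, so it needs existence and uniqueness.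
  By scaling, the mass is a positive multiple of a positive power of r, hence the equation for r can
  be solved explicitly.\<close>

lemma R_const_props:
  assumes a: "a > 0"
  shows R_const_pos: "R_const \<theta> \<alpha> a > 0"
    and R_const_mass: "(LINT x|lebesgue. profile \<theta> \<alpha> (R_const \<theta> \<alpha> a) x) = a"
proof -
  define C where "C = (LINT x|lebesgue. profile \<theta> \<alpha> 1 x)"
  define q where "q = 1 / \<theta> + 1 / 2"
  have C: "C > 0" using profile_mass_pos by (simp add: C_def)
  have q: "q > 0" using \<theta> by (simp add: q_def add_pos_pos)
  have m: "(LINT x|lebesgue. profile \<theta> \<alpha> r x) = r powr q * C" if "r > 0" for r
    using profile_mass_scaling[OF that] by (simp add: C_def q_def)
  have "\<exists>!r. r > 0 \<and> (LINT x|lebesgue. profile \<theta> \<alpha> r x) = a"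
  proof (rule ex1I[of _ "(a / C) powr (1 / q)"])
    show "(a / C) powr (1 / q) > 0 \<and> (LINT x|lebesgue. profile \<theta> \<alpha> ((a / C) powr (1 / q)) x) = a"
      using a C q m by (simp add: powr_powr)
    fix r assume r: "r > 0 \<and> (LINT x|lebesgue. profile \<theta> \<alpha> r x) = a"
    then have "r powr q = a / C" using m C by (auto simp: field_simps)
    then have "(a / C) powr (1 / q) = (r powr q) powr (1 / q)" by simp
    then show "r = (a / C) powr (1 / q)" using r q by (simp add: powr_powr)
  qed
  from theI'[OF this, folded R_const_def]
  show "R_const \<theta> \<alpha> a > 0" "(LINT x|lebesgue. profile \<theta> \<alpha> (R_const \<theta> \<alpha> a) x) = a" by auto
qed

lemma M_profile_le:
  assumes "a > 0"
  shows "M_profile \<theta> \<alpha> a x \<le> R_const \<theta> \<alpha> a powr (1 / \<theta>)"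
  unfolding M_profile_def profile_def
  using R_const_pos[OF assms] \<alpha> \<theta> by (intro powr_mono2) auto

lemma profile_flow:
  assumes a: "a > 0"
  shows "rescaled_flow \<alpha> \<theta> a (sqrt (2 * R_const \<theta> \<alpha> a / (\<alpha> * (1 - \<alpha>)))) T
    (\<lambda>(x, t). M_profile \<theta> \<alpha> a x) (\<lambda>_. 0) (\<lambda>_. 0) (\<lambda>_. 0)"
proof -
  define r where "r = R_const \<theta> \<alpha> a"
  define L where "L = sqrt (2 * r / (\<alpha> * (1 - \<alpha>)))"
  have r: "r > 0" using R_const_pos[OF a] by (simp add: r_def)
  have L: "L > 0" using \<alpha> r by (simp add: L_def)
  have pos: "profile \<theta> \<alpha> r x > 0 \<longleftrightarrow> \<bar>x\<bar> < L" for x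
    using profile_pos_iff[OF r] by (simp add: L_def)
  have zero: "profile \<theta> \<alpha> r x = 0" if "\<bar>x\<bar> \<ge> L" for x
    using profile_zero[OF r] that by (simp add: L_def)
  show ?thesis
    unfolding M_profile_def r_def[symmetric] L_def[symmetric]
  proof (rule rescaled_flow.intro, goal_cases)
    case 3
    have uc: "uniformly_continuous_on {- L..L} (profile \<theta> \<alpha> r)"
      by (intro compact_uniformly_continuous profile_cont) auto
    \<comment> \<open>Clamping to [-L, L] is 1-Lipschitz and does not alter the value of the
      profile, which vanishes from L on. It transfers uniform continuity from the compact interval
      to the whole line.\<close>
    define cl where "cl = (\<lambda>x. max (- L) (min L x))"
    have cl: "profile \<theta> \<alpha> r (cl x) = profile \<theta> \<alpha> r x" "cl x \<in> {- L..L}" "\<bar>cl x - cl y\<bar> \<le> \<bar>x - y\<bar>" for x y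
      using zero[of x] zero[of L] zero[of "- L"] L by (auto simp: cl_def max_def min_def)
    show ?case
      unfolding uniformly_continuous_on_def
    proof (intro allI impI)
      fix e :: real assume "e > 0"
      then obtain d where d: "d > 0" "\<And>x y. x \<in> {- L..L} \<Longrightarrow> y \<in> {- L..L} \<Longrightarrow> dist y x < d \<Longrightarrow>
          dist (profile \<theta> \<alpha> r y) (profile \<theta> \<alpha> r x) < e"
        using uc unfolding uniformly_continuous_on_def by meson
      show "\<exists>d>0. \<forall>x\<in>UNIV \<times> {T<..}. \<forall>x'\<in>UNIV \<times> {T<..}. dist x' x < d \<longrightarrow>
          dist (case x' of (x, t) \<Rightarrow> profile \<theta> \<alpha> r x) (case x of (x, t) \<Rightarrow> profile \<theta> \<alpha> r x) < e"
      proof (intro exI[of _ d] conjI d(1) ballI impI)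
        fix x x' :: "real \<times> real" assume "dist x' x < d"
        then have "dist (fst x') (fst x) < d" using dist_fst_le[of x' x] by linarith
        then have "dist (cl (fst x')) (cl (fst x)) < d"
          using cl(3)[of "fst x'" "fst x"] by (simp add: dist_real_def)
        from d(2)[OF cl(2) cl(2) this]
        show "dist (case x' of (x, t) \<Rightarrow> profile \<theta> \<alpha> r x) (case x of (x, t) \<Rightarrow> profile \<theta> \<alpha> r x) < e"
          by (simp add: cl(1) case_prod_unfold)
      qed
    qed
  next
    case (6 t)
    show ?case by (rule exI[of _ "- L"], rule exI[of _ L]) (auto simp: pos)
  next
    case (7 t)
    have "integral {- L..L} (profile \<theta> \<alpha> r) = (LINT x|lebesgue. profile \<theta> \<alpha> r x)"
      by (rule lebesgue_integral_compact_support[OF profile_cont, symmetric]) (simp add: zero)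
    then show ?case using R_const_mass[OF a] by (simp add: r_def)
  next
    case (13 x t)
    have "((\<lambda>s. r - \<alpha> * (1 - \<alpha>) / 2 * s\<^sup>2) has_real_derivative - \<alpha> * (1 - \<alpha>) * x) (at x)"
      by (auto intro!: derivative_eq_intros)
    then have "((\<lambda>s. profile \<theta> \<alpha> r s powr \<theta>) has_real_derivative - \<alpha> * (1 - \<alpha>) * x) (at x)"
    proof (rule has_field_derivative_transform_within_open[where S = "{- L<..<L}"])
      show "x \<in> {- L<..<L}" using 13 pos by auto
      fix s assume "s \<in> {- L<..<L}"
      then have "profile \<theta> \<alpha> r s \<noteq> 0" using pos[of s] by auto
      then have "\<not> r - \<alpha> * (1 - \<alpha>) / 2 * s\<^sup>2 \<le> 0"
        unfolding profile_def by (metis max_absorb1 powr_0)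
      then have w: "r - \<alpha> * (1 - \<alpha>) / 2 * s\<^sup>2 > 0" by linarith
      then have "max 0 (r - \<alpha> * (1 - \<alpha>) / 2 * s\<^sup>2) = r - \<alpha> * (1 - \<alpha>) / 2 * s\<^sup>2"
        by (intro max_absorb2 less_imp_le)
      then have "profile \<theta> \<alpha> r s powr \<theta> = (r - \<alpha> * (1 - \<alpha>) / 2 * s\<^sup>2) powr (1 / \<theta> * \<theta>)"
        by (simp only: profile_def powr_powr)
      also have "1 / \<theta> * \<theta> = 1" using \<theta> by simp
      finally show "r - \<alpha> * (1 - \<alpha>) / 2 * s\<^sup>2 = profile \<theta> \<alpha> r s powr \<theta>"
        using w by (simp only: powr_one less_imp_le)
    qed auto
    then show ?case by simp
  qed (use \<theta> a profile_nonneg zero in \<open>auto intro!: derivative_eq_intros continuous_intros\<close>)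
qed

end

section \<open>Smooth test functions\<close>

text \<open>The derivative is an existential witness instead of the value of a derivative operator,
  so closure under sums, products and affine substitution follows by induction from the usual
  differentiation rules.\<close>

primrec C_real :: "nat \<Rightarrow> (real \<Rightarrow> real) \<Rightarrow> bool" where
  "C_real 0 f \<longleftrightarrow> continuous_on UNIV f"
| "C_real (Suc n) f \<longleftrightarrow> (\<exists>f'. (\<forall>x. (f has_real_derivative f' x) (at x)) \<and> C_real n f')"

lemma C_real_SucI: "(\<And>x. (f has_real_derivative f' x) (at x)) \<Longrightarrow> C_real n f' \<Longrightarrow> C_real (Suc n) f"
  by auto

lemma C_real_SucD: "C_real (Suc n) f \<Longrightarrow> C_real n f"
proof (induction n arbitrary: f)
  case 0
  then show ?case
    by (auto intro!: continuous_at_imp_continuous_on dest: DERIV_isCont)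
next
  case (Suc n)
  then obtain f' where "\<forall>x. (f has_real_derivative f' x) (at x)" "C_real (Suc n) f'"
    by (subst (asm) C_real.simps(2)) blast
  then show ?case using Suc.IH by auto
qed

lemma C_real_imp_cont: "C_real n f \<Longrightarrow> continuous_on UNIV f"
  by (induction n) (auto dest: C_real_SucD simp del: C_real.simps(2))

lemma C_real_const: "C_real n (\<lambda>_. c)"
proof (induction n arbitrary: c)
  case (Suc n)
  then show ?case by (auto intro!: exI[of _ "\<lambda>_. 0"])
qed simp

lemma C_real_add: "C_real n f \<Longrightarrow> C_real n g \<Longrightarrow> C_real n (\<lambda>x. f x + g x)"
proof (induction n arbitrary: f g)
  case 0
  then show ?case by (simp add: continuous_on_add)
next
  case (Suc n)
  then obtain f' g' where "\<forall>x. (f has_real_derivative f' x) (at x)" "C_real n f'"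
    "\<forall>x. (g has_real_derivative g' x) (at x)" "C_real n g'" by auto
  then show ?case using Suc.IH[of f' g'] by (auto intro!: exI[of _ "\<lambda>x. f' x + g' x"] DERIV_add)
qed

lemma C_real_mult: "C_real n f \<Longrightarrow> C_real n g \<Longrightarrow> C_real n (\<lambda>x. f x * g x)"
proof (induction n arbitrary: f g)
  case 0
  then show ?case by (simp add: continuous_on_mult)
next
  case (Suc n)
  then obtain f' g' where f': "\<And>x. (f has_real_derivative f' x) (at x)" "C_real n f'"
    and g': "\<And>x. (g has_real_derivative g' x) (at x)" "C_real n g'" by auto
  have "C_real n (\<lambda>x. f' x * g x + g' x * f x)"
    using f' g' Suc by (intro C_real_add Suc.IH) (auto intro: C_real_SucD simp del: C_real.simps(2))
  then show ?case by (rule C_real_SucI[OF DERIV_mult[OF f'(1) g'(1)]])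
qed

lemma C_real_affine: "C_real n f \<Longrightarrow> C_real n (\<lambda>x. f (c * x + d))"
proof (induction n arbitrary: f)
  case 0
  then show ?case by (auto intro!: continuous_on_compose2[of UNIV f] continuous_intros)
next
  case (Suc n)
  then obtain f' where f': "\<And>x. (f has_real_derivative f' x) (at x)" "C_real n f'" by auto
  have "((\<lambda>x. f (c * x + d)) has_real_derivative f' (c * x + d) * c) (at x)" for x
    by (rule DERIV_chain2[OF f'(1)]) (auto intro!: derivative_eq_intros)
  moreover have "C_real n (\<lambda>x. f' (c * x + d) * c)"
    by (rule C_real_mult[OF Suc.IH[OF f'(2)] C_real_const])
  ultimately show ?case by (rule C_real_SucI)
qed

text \<open>The classical flat function exp (-1 / x), extended by zero. Polynomial factors in 1 / x
  are included so that the family is closed under differentiation, which makes smoothness an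
  induction over all q at once.\<close>

definition flat_exp :: "real poly \<Rightarrow> real \<Rightarrow> real" where
  "flat_exp q x = (if x > 0 then poly q (1 / x) * exp (- (1 / x)) else 0)"

lemma flat_exp_nonpos: "x \<le> 0 \<Longrightarrow> flat_exp q x = 0"
  by (simp add: flat_exp_def)

lemma flat_exp_tendsto: "((\<lambda>x. poly q (1 / x) * exp (- (1 / x))) \<longlongrightarrow> 0) (at_right (0::real))"
proof -
  have "((\<lambda>y. \<Sum>i\<le>degree q. coeff q i * (y ^ i / exp y)) \<longlongrightarrow> (\<Sum>i\<le>degree q. coeff q i * 0)) at_top"
    by (intro tendsto_sum tendsto_mult tendsto_const tendsto_power_div_exp_0)
  moreover have "(\<Sum>i\<le>degree q. coeff q i * (y ^ i / exp y)) = poly q y * exp (- y)" for y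
    by (simp add: poly_altdef sum_distrib_right exp_minus divide_inverse mult.assoc)
  ultimately have "((\<lambda>y. poly q y * exp (- y)) \<longlongrightarrow> 0) at_top" by simp
  from filterlim_compose[OF this filterlim_inverse_at_top_right]
  show ?thesis by (simp add: inverse_eq_divide)
qed

text \<open>With s = 1 / x one has ds/dx = -s^2, so q(s) * exp (-s) becomes s^2 * (q - q')(s) * exp
  (-s). At 0 the difference quotient from the right is again of this kind, with s * q(s) in place of
  q(s), and tends to 0.\<close>

lemma flat_exp_deriv:
  "(flat_exp q has_real_derivative flat_exp ([:0, 0, 1:] * (q - pderiv q)) x) (at x)"
proof (cases x "0::real" rule: linorder_cases)
  case less
  have "((\<lambda>_. 0) has_real_derivative 0) (at x)" by simp
  then have "(flat_exp q has_real_derivative 0) (at x)"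
    by (rule has_field_derivative_transform_within_open[where S = "{..<0}"])
       (use less in \<open>auto simp: flat_exp_def\<close>)
  then show ?thesis using less by (simp add: flat_exp_def)
next
  case greater
  have "((\<lambda>x. poly q (1 / x) * exp (- (1 / x))) has_real_derivative
      flat_exp ([:0, 0, 1:] * (q - pderiv q)) x) (at x)"
  proof -
    have 1: "((\<lambda>x. 1 / x) has_real_derivative - (1 / x * (1 / x))) (at x)"
      using greater by (auto intro!: derivative_eq_intros simp: power2_eq_square)
    have 2: "((\<lambda>x. poly q (1 / x)) has_real_derivative poly (pderiv q) (1 / x) * (- (1 / x * (1 / x)))) (at x)"
      by (rule DERIV_chain2[OF poly_DERIV 1])
    have 3: "((\<lambda>x. exp (- (1 / x))) has_real_derivative exp (- (1 / x)) * (- (- (1 / x * (1 / x))))) (at x)"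
      by (rule DERIV_chain2[OF DERIV_exp DERIV_minus[OF 1]])
    show ?thesis
      by (rule DERIV_cong[OF DERIV_mult[OF 2 3]]) (use greater in \<open>simp add: flat_exp_def algebra_simps\<close>)
  qed
  then show ?thesis
    by (rule has_field_derivative_transform_within_open[where S = "{0<..}"])
       (use greater in \<open>auto simp: flat_exp_def\<close>)
next
  case equal
  have "((\<lambda>h. flat_exp q h / h) \<longlongrightarrow> 0) (at_left 0)"
    by (rule tendsto_eventually) (auto simp: flat_exp_def eventually_at_left_field intro!: exI[of _ "-1"])
  moreover have "((\<lambda>h. flat_exp q h / h) \<longlongrightarrow> 0) (at_right 0)"
  proof (rule Lim_transform_eventually[OF flat_exp_tendsto[of "[:0, 1:] * q"]])
    show "\<forall>\<^sub>F x in at_right 0. poly ([:0, 1:] * q) (1 / x) * exp (- (1 / x)) = flat_exp q x / x"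
      by (auto simp: eventually_at_right_field flat_exp_def intro!: exI[of _ 1])
  qed
  ultimately have "((\<lambda>h. flat_exp q h / h) \<longlongrightarrow> 0) (at 0)"
    by (simp add: filterlim_split_at)
  then show ?thesis using equal by (simp add: DERIV_def) (simp add: flat_exp_def)
qed

lemma C_real_flat_exp: "C_real n (flat_exp q)"
proof (induction n arbitrary: q)
  case 0
  show ?case using flat_exp_deriv[of q]
    by (auto intro!: continuous_at_imp_continuous_on dest: DERIV_isCont)
next
  case (Suc n)
  then show ?case by (rule C_real_SucI[OF flat_exp_deriv])
qed

text \<open>\<beta> is a normalised bump on (0, 1), the product of a flat function at 0 and a
  reflected one at 1; \<sigma> is its primitive.\<close>

lemma smooth_step_exists:
  obtains \<sigma> \<beta> :: "real \<Rightarrow> real" where "\<And>n. C_real n \<sigma>" "\<And>x. (\<sigma> has_real_derivative \<beta> x) (at x)"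
    "\<And>n. C_real n \<beta>" "\<And>x. \<beta> x \<ge> 0" "\<And>x. x \<notin> {0<..<1} \<Longrightarrow> \<beta> x = 0"
    "\<And>x. x \<le> 0 \<Longrightarrow> \<sigma> x = 0" "\<And>x. x \<ge> 1 \<Longrightarrow> \<sigma> x = 1"
proof -
  define b where "b = (\<lambda>x. flat_exp 1 x * flat_exp 1 (- 1 * x + 1))"
  have Cb: "C_real n b" for n
    unfolding b_def by (rule C_real_mult[OF C_real_flat_exp C_real_affine[OF C_real_flat_exp]])
  have cb: "continuous_on A b" for A
    using C_real_imp_cont[OF Cb[of 0]] by (rule continuous_on_subset) simp
  have b0: "b x \<ge> 0" for x by (simp add: b_def flat_exp_def)
  have bz: "b x = 0" if "x \<notin> {0<..<1}" for x
  proof -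
    have "x \<le> 0 \<or> - 1 * x + 1 \<le> 0" using that by auto
    then show ?thesis
      unfolding b_def by (elim disjE) (simp_all only: flat_exp_nonpos mult_zero_left mult_zero_right)
  qed
  have ib: "b integrable_on {l..r}" for l r by (intro integrable_continuous_real cb)
  define c where "c = integral {0..1} b"
  have "b (1 / 2) \<noteq> 0" by (simp add: b_def flat_exp_def)
  then have "c \<noteq> 0"
    using integral_eq_0_iff[OF cb, of 0 1] b0 unfolding c_def by (auto dest: bspec[of _ _ "1 / 2"])
  moreover have "c \<ge> 0" unfolding c_def by (intro integral_nonneg ib b0)
  ultimately have c: "c > 0" by simp
  define s where "s = (\<lambda>x. integral {0..x} b / c)"
  have neg: "s x = 0" if "x \<le> 0" for x
    using that by (cases "x = 0") (auto simp: s_def)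
  \<comment> \<open>The lower limit 0 may be replaced by any l \<le> 0 because the bump vanishes
    there. Every x then becomes an interior point of an interval [l, r], and the derivative is
    two-sided.\<close>
  have from_l: "s x = integral {l..x} b / c" if "l \<le> 0" for l x
  proof (cases "x < 0")
    case True
    have "integral {l..x} b = integral {l..x} (\<lambda>_. 0)"
      by (rule integral_cong) (use True in \<open>auto intro!: bz\<close>)
    then show ?thesis using neg True by simp
  next
    case False
    have "integral {l..0} b = integral {l..0} (\<lambda>_. 0)" by (rule integral_cong) (auto intro!: bz)
    moreover have "integral {l..0} b + integral {0..x} b = integral {l..x} b"
      by (rule Henstock_Kurzweil_Integration.integral_combine) (use False that ib in auto)
    ultimately show ?thesis by (simp add: s_def)
  qed
  have der: "(s has_real_derivative b x / c) (at x)" for x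
  proof -
    define l r where "l = - \<bar>x\<bar> - 1" and "r = \<bar>x\<bar> + 1"
    have lr: "l < x" "x < r" "l \<le> 0" by (auto simp: l_def r_def)
    have "((\<lambda>x. integral {l..x} b) has_real_derivative b x) (at x within {l..r})"
      by (rule integral_has_real_derivative[OF cb]) (use lr in auto)
    then have "((\<lambda>x. integral {l..x} b) has_real_derivative b x) (at x)"
      using at_within_Icc_at[OF lr(1,2)] by simp
    moreover have "s = (\<lambda>x. integral {l..x} b / c)"
      using from_l[OF lr(3)] by (simp add: fun_eq_iff)
    ultimately show ?thesis using DERIV_cdivide by blast
  qed
  have one: "s x = 1" if "x \<ge> 1" for x
  proof -
    have "integral {1..x} b = integral {1..x} (\<lambda>_. 0)" by (rule integral_cong) (auto intro!: bz)
    moreover have "integral {0..1} b + integral {1..x} b = integral {0..x} b"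
      by (rule Henstock_Kurzweil_Integration.integral_combine) (use that ib in auto)
    ultimately show ?thesis using c by (simp add: s_def c_def)
  qed
  have Cbc: "C_real n (\<lambda>x. b x / c)" for n
    using C_real_mult[OF Cb C_real_const[of n "1 / c"]] by simp
  have Cs: "C_real n s" for n
    by (rule C_real_SucD[OF C_real_SucI[OF der Cbc]])
  show ?thesis
    by (rule that[of s "\<lambda>x. b x / c"]) (use Cs der Cbc b0 bz neg one c in auto)
qed

section \<open>Test functions in the plane as tensor products\<close>

lemma Basis_real_prod: "(Basis :: (real \<times> real) set) = {(1, 0), (0, 1)}"
  by (auto simp: Basis_prod_def)

lemma has_derivative_tensor:
  assumes "(A has_real_derivative A') (at (fst z))" "(B has_real_derivative B') (at (snd z))"
  shows "((\<lambda>z. A (fst z) * B (snd z)) has_derivative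
    (\<lambda>h. fst h * (A' * B (snd z)) + snd h * (A (fst z) * B'))) (at z)"
proof -
  have "((\<lambda>z. A (fst z)) has_derivative (\<lambda>h. A' * fst h)) (at z)"
    using has_derivative_compose[OF has_derivative_fst[OF has_derivative_ident] assms(1)[unfolded has_field_derivative_def]] by simp
  moreover have "((\<lambda>z. B (snd z)) has_derivative (\<lambda>h. B' * snd h)) (at z)"
    using has_derivative_compose[OF has_derivative_snd[OF has_derivative_ident] assms(2)[unfolded has_field_derivative_def]] by simp
  ultimately show ?thesis
    by (rule has_derivative_eq_rhs[OF has_derivative_mult]) (simp add: fun_eq_iff algebra_simps)
qed

lemma partial_deriv_tensor:
  assumes "\<And>x. (A has_real_derivative A' x) (at x)" "\<And>x. (B has_real_derivative B' x) (at x)"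
  shows "Dx (\<lambda>z. A (fst z) * B (snd z)) = (\<lambda>z. A' (fst z) * B (snd z))"
    and "Dt (\<lambda>z. A (fst z) * B (snd z)) = (\<lambda>z. A (fst z) * B' (snd z))"
  using frechet_derivative_at[OF has_derivative_tensor[OF assms], symmetric]
  by (auto simp: partial_deriv_def fun_eq_iff)

lemma Ck_on_tensor:
  "C_real k A \<Longrightarrow> C_real k B \<Longrightarrow> Ck_on k UNIV (\<lambda>z. A (fst z) * B (snd z))"
proof (induction k arbitrary: A B)
  case 0
  then show ?case
    by (auto intro!: continuous_on_mult continuous_on_compose2[of UNIV A] continuous_on_compose2[of UNIV B] continuous_intros)
next
  case (Suc k)
  then obtain A' B' where A': "\<And>x. (A has_real_derivative A' x) (at x)" "C_real k A'"
    and B': "\<And>x. (B has_real_derivative B' x) (at x)" "C_real k B'" by auto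
  have "C_real k A" "C_real k B" using Suc.prems by (auto dest!: C_real_SucD simp del: C_real.simps(2))
  then have "Ck_on k UNIV (\<lambda>z. A' (fst z) * B (snd z))" "Ck_on k UNIV (\<lambda>z. A (fst z) * B' (snd z))"
    using Suc.IH A' B' by auto
  then show ?case
    using has_derivative_tensor[OF A'(1) B'(1)]
    by (auto simp: Basis_real_prod partial_deriv_tensor[OF A'(1) B'(1)] differentiable_def)
qed

text \<open>The factor multiplying \<open>a t\<close> in the last assumption tends to \<open>\<delta>\<^sub>s - \<delta>\<^sub>r\<close> as \<open>e \<rightarrow> 0\<close>.\<close>

lemma step_pairing_limit:
  fixes a :: "real \<Rightarrow> real"
  assumes a: "continuous_on {l..u} a" and sl: "l \<le> s" "s < u" "l \<le> r" "r < u"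
    and \<sigma>: "\<And>x. (\<sigma> has_real_derivative \<beta> x) (at x)" "continuous_on UNIV \<beta>" "\<And>x. \<beta> x \<ge> 0"
      "\<And>x. x \<notin> {0<..<1} \<Longrightarrow> \<beta> x = 0" "\<And>x. x \<le> 0 \<Longrightarrow> \<sigma> x = 0" "\<And>x. x \<ge> 1 \<Longrightarrow> \<sigma> x = 1"
    and orth: "\<And>e. 0 < e \<Longrightarrow> s + e < u \<Longrightarrow> r + e < u \<Longrightarrow>
       integral {l..u} (\<lambda>t. a t * (\<beta> ((t - s) / e) / e - \<beta> ((t - r) / e) / e)) = 0"
  shows "a s = a r"
proof -
  have c\<beta>: "continuous_on A (\<lambda>t. \<beta> ((t - q) / e) / e)" if "e > 0" for A q e
    using that by (intro continuous_on_divide continuous_on_compose2[OF \<sigma>(2)] continuous_intros) auto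
  \<comment> \<open>The kernel has integral 1 and lives on (q, q + e), to the right of q. Hence q
    may be the left end l, but must stay below u.\<close>
  have near: "\<exists>d>0. \<forall>e. 0 < e \<and> e < d \<longrightarrow> \<bar>integral {l..u} (\<lambda>t. a t * (\<beta> ((t - q) / e) / e)) - a q\<bar> \<le> k"
    if q: "l \<le> q" "q < u" and k: "k > 0" for q k
  proof -
    obtain d where d: "d > 0" "\<And>t. t \<in> {l..u} \<Longrightarrow> dist t q < d \<Longrightarrow> dist (a t) (a q) < k"
      using a q k unfolding continuous_on_iff by (metis atLeastAtMost_iff less_eq_real_def)
    have "\<bar>integral {l..u} (\<lambda>t. a t * (\<beta> ((t - q) / e) / e)) - a q\<bar> \<le> k" if e: "0 < e" "e < min d (u - q)" for e
    proof -
      define w where "w = (\<lambda>t. \<beta> ((t - q) / e) / e)"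
      have cw: "continuous_on {l..u} w" unfolding w_def by (rule c\<beta>[OF e(1)])
      have w0: "w t \<ge> 0" for t using \<sigma>(3) e by (simp add: w_def)
      have "(w has_integral (\<sigma> ((u - q) / e) - \<sigma> ((l - q) / e))) {l..u}"
      proof (rule fundamental_theorem_of_calculus)
        fix t
        have "((\<lambda>t. \<sigma> ((t - q) / e)) has_real_derivative \<beta> ((t - q) / e) * (1 / e)) (at t)"
          by (rule DERIV_chain2[OF \<sigma>(1)]) (use e in \<open>auto intro!: derivative_eq_intros\<close>)
        then show "((\<lambda>t. \<sigma> ((t - q) / e)) has_vector_derivative w t) (at t within {l..u})"
          by (simp add: w_def has_field_derivative_at_within flip: has_real_derivative_iff_has_vector_derivative)
      qed (use q in auto)
      moreover have "\<sigma> ((u - q) / e) = 1" "\<sigma> ((l - q) / e) = 0"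
        using e q by (auto intro!: \<sigma>(5,6) simp: field_simps divide_nonpos_pos)
      ultimately have w1: "(w has_integral 1) {l..u}" by simp
      have ptw: "\<bar>(a t - a q) * w t\<bar> \<le> k * w t" if t: "t \<in> {l..u}" for t
      proof (cases "w t = 0")
        case False
        then have "(t - q) / e \<in> {0<..<1}" using \<sigma>(4)[of "(t - q) / e"] unfolding w_def by fastforce
        then have "0 < (t - q) / e" "(t - q) / e < 1" by auto
        then have "0 < t - q" "t - q < e" using e(1) by (auto simp: zero_less_divide_iff pos_divide_less_eq)
        then have "dist t q < d" using e(2) by (simp add: dist_real_def)
        from d(2)[OF t this] show ?thesis
          using w0[of t] by (simp add: abs_mult dist_real_def mult_right_mono)
      qed simp
      have i1: "(\<lambda>t. (a t - a q) * w t) integrable_on {l..u}"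
        by (intro integrable_continuous_real continuous_intros a cw)
      have i2: "(\<lambda>t. k * w t) integrable_on {l..u}"
        by (intro integrable_continuous_real continuous_intros cw)
      have "norm (integral {l..u} (\<lambda>t. (a t - a q) * w t)) \<le> integral {l..u} (\<lambda>t. k * w t)"
        by (rule integral_norm_bound_integral[OF i1 i2]) (use ptw in auto)
      also have "\<dots> = k" using w1 by (simp add: integral_unique)
      finally have "\<bar>integral {l..u} (\<lambda>t. (a t - a q) * w t)\<bar> \<le> k" by simp
      moreover have "integral {l..u} (\<lambda>t. (a t - a q) * w t) = integral {l..u} (\<lambda>t. a t * w t) - a q"
      proof -
        have i3: "(\<lambda>t. a t * w t) integrable_on {l..u}"
          by (intro integrable_continuous_real continuous_intros a cw)
        have i4: "((\<lambda>t. a q * w t) has_integral a q) {l..u}"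
          using has_integral_mult_right[OF w1, of "a q"] by simp
        show ?thesis
          using integral_diff[OF i3 has_integral_integrable[OF i4]] integral_unique[OF i4]
          by (simp only: left_diff_distrib)
      qed
      ultimately show ?thesis unfolding w_def by linarith
    qed
    then show ?thesis using d(1) q by (intro exI[of _ "min d (u - q)"]) auto
  qed
  have "\<bar>a s - a r\<bar> \<le> 0 + k" if k: "k > 0" for k
  proof -
    have k2: "k / 2 > 0" using k by simp
    obtain d1 where d1: "d1 > 0" "\<And>e. 0 < e \<Longrightarrow> e < d1 \<Longrightarrow> \<bar>integral {l..u} (\<lambda>t. a t * (\<beta> ((t - s) / e) / e)) - a s\<bar> \<le> k / 2"
      using near[OF sl(1,2) k2] by blast
    obtain d2 where d2: "d2 > 0" "\<And>e. 0 < e \<Longrightarrow> e < d2 \<Longrightarrow> \<bar>integral {l..u} (\<lambda>t. a t * (\<beta> ((t - r) / e) / e)) - a r\<bar> \<le> k / 2"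
      using near[OF sl(3,4) k2] by blast
    define e where "e = min (min d1 d2) (min (u - s) (u - r)) / 2"
    have e: "0 < e" "e < d1" "e < d2" "s + e < u" "r + e < u"
      using d1(1) d2(1) sl by (auto simp: e_def min_def field_simps)
    have i: "(\<lambda>t. a t * (\<beta> ((t - q) / e) / e)) integrable_on {l..u}" for q
      by (intro integrable_continuous_real continuous_on_mult a c\<beta>[OF e(1)])
    have "integral {l..u} (\<lambda>t. a t * (\<beta> ((t - s) / e) / e)) - integral {l..u} (\<lambda>t. a t * (\<beta> ((t - r) / e) / e)) = 0"
      using orth[OF e(1,4,5)] integral_diff[OF i[of s] i[of r]] by (simp add: right_diff_distrib)
    then show ?thesis using d1(2)[OF e(1,2)] d2(2)[OF e(1,3)] by linarith
  qed
  then have "\<bar>a s - a r\<bar> \<le> 0" by (rule field_le_epsilon)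
  then show ?thesis by simp
qed

section \<open>The continuity equation on rectangles\<close>

lemma integral_lebesgue_on_cbox_support:
  fixes f :: "'a::euclidean_space \<Rightarrow> real"
  assumes f: "continuous_on (cbox l u) f" and sub: "cbox l u \<subseteq> \<Omega>" and \<Omega>: "\<Omega> \<in> sets lebesgue"
    and z: "\<And>x. x \<in> \<Omega> - cbox l u \<Longrightarrow> f x = 0"
  shows "(LINT x|lebesgue_on \<Omega>. f x) = integral (cbox l u) f"
proof -
  have "(LINT x|lebesgue_on \<Omega>. f x) = (LINT x|lebesgue. indicator \<Omega> x *\<^sub>R f x)"
    using \<Omega> by (subst integral_restrict_space) auto
  also have "\<dots> = (LINT x|lebesgue. indicator (cbox l u) x *\<^sub>R f x)"
    by (rule Bochner_Integration.integral_cong) (use sub z in \<open>auto simp: indicator_def\<close>)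
  also have "\<dots> = integral (cbox l u) f"
    using set_lebesgue_integral_eq_integral(2)[OF absolutely_integrable_continuous[OF f]]
    by (simp add: set_lebesgue_integral_def)
  finally show ?thesis .
qed

lemma tensor_test_function:
  assumes A: "\<And>n. C_real n A" "\<And>x. x \<notin> {x1..x2} \<Longrightarrow> A x = 0"
    and B: "\<And>n. C_real n B" "\<And>t. t \<notin> {s1..s2} \<Longrightarrow> B t = 0"
    and sub: "cbox (x1, s1) (x2, s2) \<subseteq> \<Omega>"
  shows "(\<lambda>z. A (fst z) * B (snd z)) \<in> test_functions \<Omega>"
proof -
  have "support_on UNIV (\<lambda>z. A (fst z) * B (snd z)) \<subseteq> cbox (x1, s1) (x2, s2)"
    using A(2) B(2) by (auto simp: support_on_def cbox_Pair_eq) fastforce+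
  then have cl: "closure (support_on UNIV (\<lambda>z. A (fst z) * B (snd z))) \<subseteq> cbox (x1, s1) (x2, s2)"
    by (rule closure_minimal) (rule closed_cbox)
  then have "compact (closure (support_on UNIV (\<lambda>z. A (fst z) * B (snd z))))"
    by (simp add: compact_eq_bounded_closed bounded_subset[OF bounded_cbox])
  then show ?thesis
    using cl sub Ck_on_tensor[OF A(1) B(1)] by (auto simp: test_functions_def)
qed

text \<open>Testing with smooth approximations of the indicator of the rectangle turns the
  distributional equation into a balance of mass and boundary flux, which makes sense for merely
  continuous m and w. Every differentiability statement about the mass is derived from this
  balance.\<close>

lemma weak_continuity_rectangle:
  fixes m w :: "real \<times> real \<Rightarrow> real"
  assumes cm: "continuous_on (UNIV \<times> {t0<..}) m" and cw: "continuous_on (UNIV \<times> {t0<..}) w"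
    and weak: "\<forall>\<phi>\<in>test_functions (UNIV \<times> {t0<..}).
      (LINT y|lebesgue_on (UNIV \<times> {t0<..}). - (m y * Dt \<phi> y) + m y * w y * Dx \<phi> y) = 0"
    and s: "t0 < s1" "s1 \<le> s2" and x: "x1 \<le> x2"
  shows "integral {x1..x2} (\<lambda>x. m (x, s2)) - integral {x1..x2} (\<lambda>x. m (x, s1)) =
    integral {s1..s2} (\<lambda>t. m (x2, t) * w (x2, t)) - integral {s1..s2} (\<lambda>t. m (x1, t) * w (x1, t))"
proof -
  obtain \<sigma> \<beta> :: "real \<Rightarrow> real" where \<sigma>: "\<And>n. C_real n \<sigma>" "\<And>x. (\<sigma> has_real_derivative \<beta> x) (at x)"
    "\<And>n. C_real n \<beta>" "\<And>x. \<beta> x \<ge> 0" "\<And>x. x \<notin> {0<..<1} \<Longrightarrow> \<beta> x = 0"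
    "\<And>x. x \<le> 0 \<Longrightarrow> \<sigma> x = 0" "\<And>x. x \<ge> 1 \<Longrightarrow> \<sigma> x = 1"
    by (rule smooth_step_exists) blast
  \<comment> \<open>A smooth indicator of [a, b] that rises on [a, a + e] and falls on [b, b + e].
    Its derivative \<open>S'\<close> is the difference of the two kernels in
    \<open>step_pairing_limit\<close>.\<close>
  define S where "S = (\<lambda>a b e t. \<sigma> ((t - a) / e) - \<sigma> ((t - b) / e))"
  define S' where "S' = (\<lambda>a b e t. \<beta> ((t - a) / e) / e - \<beta> ((t - b) / e) / e)"
  have aff: "C_real n (\<lambda>t. f ((t - a) / e))" if "C_real n f" for n f a e
    using C_real_affine[OF that, of "1 / e" "- a / e"] by (simp add: diff_divide_distrib)
  have CS: "C_real n (S a b e)" for n a b e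
    using C_real_add[OF aff[OF \<sigma>(1), of n a e] C_real_mult[OF C_real_const[of n "-1"] aff[OF \<sigma>(1), of n b e]]]
    by (simp add: S_def)
  have CS': "C_real n (S' a b e)" for n a b e
    using C_real_add[OF C_real_mult[OF C_real_const[of n "1 / e"] aff[OF \<sigma>(3), of n a e]]
        C_real_mult[OF C_real_const[of n "- 1 / e"] aff[OF \<sigma>(3), of n b e]]]
    by (simp add: S'_def)
  have cS: "continuous_on X (S a b e)" "continuous_on X (S' a b e)" for X a b e
    by (rule continuous_on_subset[OF C_real_imp_cont[OF CS] subset_UNIV]
        continuous_on_subset[OF C_real_imp_cont[OF CS'] subset_UNIV])+
  have dS: "(S a b e has_real_derivative S' a b e t) (at t)" if "e > 0" for a b e t
  proof -
    have "((\<lambda>t. \<sigma> ((t - q) / e)) has_real_derivative \<beta> ((t - q) / e) * (1 / e)) (at t)" for q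
      by (rule DERIV_chain2[OF \<sigma>(2)]) (use that in \<open>auto intro!: derivative_eq_intros\<close>)
    from DERIV_diff[OF this[of a] this[of b]] show ?thesis by (simp add: S_def S'_def)
  qed
  have S0: "S a b e t = 0" "S' a b e t = 0" if "e > 0" "a \<le> b" "t \<notin> {a..b + e}" for a b e t
  proof -
    have "t < a \<or> t > b + e" using that by auto
    then have "S a b e t = 0 \<and> S' a b e t = 0"
    proof (elim disjE)
      assume "t < a"
      then have "(t - a) / e \<le> 0" "(t - b) / e \<le> 0" using that by (auto simp: divide_nonpos_pos)
      then show ?thesis using \<sigma>(5,6) by (simp_all add: S_def S'_def)
    next
      assume "t > b + e"
      then have "(t - a) / e \<ge> 1" "(t - b) / e \<ge> 1" using that by (auto simp: pos_le_divide_eq)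
      then show ?thesis using \<sigma>(5,7) by (simp_all add: S_def S'_def)
    qed
    then show "S a b e t = 0" "S' a b e t = 0" by auto
  qed
  \<comment> \<open>The mollified indicators overshoot to the right by less than 1, so enlarging the
    rectangle by 1 at its upper ends contains all the supports. Nothing is added below s1, which
    keeps K inside the domain t > t0.\<close>
  define x3 s3 where "x3 = x2 + 1" and "s3 = s2 + 1"
  define K where "K = cbox (x1, s1) (x3, s3)"
  have K_eq: "K = {x1..x3} \<times> {s1..s3}" by (simp add: K_def cbox_Pair_eq)
  have Ksub: "K \<subseteq> UNIV \<times> {t0<..}" using s by (auto simp: K_eq)
  have cmK: "continuous_on K m" and cwK: "continuous_on K w"
    using cm cw Ksub by (auto intro: continuous_on_subset)
  have tensor_c: "continuous_on K (\<lambda>z. A (fst z))" "continuous_on K (\<lambda>z. A (snd z))"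
    if "continuous_on UNIV A" for A :: "real \<Rightarrow> real"
    by (auto intro!: continuous_on_compose2[OF that] continuous_intros)
  have id: "integral K (\<lambda>z. m z * w z * (S' x1 x2 e (fst z) * S s1 s2 d (snd z))) =
      integral K (\<lambda>z. m z * (S x1 x2 e (fst z) * S' s1 s2 d (snd z)))"
    if e: "0 < e" "e < 1" and d: "0 < d" "d < 1" for e d
  proof -
    define \<phi> where "\<phi> = (\<lambda>z. S x1 x2 e (fst z) * S s1 s2 d (snd z))"
    have \<phi>: "\<phi> \<in> test_functions (UNIV \<times> {t0<..})"
      unfolding \<phi>_def
      by (rule tensor_test_function[where ?x1.0 = x1 and ?x2.0 = x3 and ?s1.0 = s1 and ?s2.0 = s3])
         (use CS S0 e d x s Ksub in \<open>auto simp: K_def x3_def s3_def\<close>)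
    have D: "Dx \<phi> = (\<lambda>z. S' x1 x2 e (fst z) * S s1 s2 d (snd z))"
      "Dt \<phi> = (\<lambda>z. S x1 x2 e (fst z) * S' s1 s2 d (snd z))"
      unfolding \<phi>_def by (rule partial_deriv_tensor; rule dS; fact)+
    have i1: "(\<lambda>z. m z * w z * (S' x1 x2 e (fst z) * S s1 s2 d (snd z))) integrable_on K"
      and i2: "(\<lambda>z. m z * (S x1 x2 e (fst z) * S' s1 s2 d (snd z))) integrable_on K"
      and c3: "continuous_on K (\<lambda>z. - (m z * (S x1 x2 e (fst z) * S' s1 s2 d (snd z))) +
        m z * w z * (S' x1 x2 e (fst z) * S s1 s2 d (snd z)))"
      unfolding K_def
      by (intro integrable_continuous continuous_intros cmK[unfolded K_def] cwK[unfolded K_def]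
          tensor_c[unfolded K_def] cS)+
    have "0 = (LINT y|lebesgue_on (UNIV \<times> {t0<..}). - (m y * Dt \<phi> y) + m y * w y * Dx \<phi> y)"
      using weak \<phi> by simp
    also have "\<dots> = integral K (\<lambda>y. - (m y * Dt \<phi> y) + m y * w y * Dx \<phi> y)"
      unfolding K_def
    proof (rule integral_lebesgue_on_cbox_support)
      show "UNIV \<times> {t0<..} \<in> sets lebesgue"
        by (rule sets_completionI_sets) (auto intro!: borel_open open_Times)
      show "continuous_on (cbox (x1, s1) (x3, s3)) (\<lambda>y. - (m y * Dt \<phi> y) + m y * w y * Dx \<phi> y)"
        using c3 by (simp add: K_def D)
      show "cbox (x1, s1) (x3, s3) \<subseteq> UNIV \<times> {t0<..}" using Ksub by (simp add: K_def)
      fix z assume "z \<in> UNIV \<times> {t0<..} - cbox (x1, s1) (x3, s3)"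
      then have "fst z \<notin> {x1..x2 + e} \<or> snd z \<notin> {s1..s2 + d}"
        using e d by (auto simp: cbox_Pair_eq x3_def s3_def)
      then show "- (m z * Dt \<phi> z) + m z * w z * Dx \<phi> z = 0"
        using S0[OF e(1) x] S0[OF d(1) s(2)] by (auto simp: D)
    qed
    also have "\<dots> = integral K (\<lambda>z. m z * w z * (S' x1 x2 e (fst z) * S s1 s2 d (snd z))) -
      integral K (\<lambda>z. m z * (S x1 x2 e (fst z) * S' s1 s2 d (snd z)))"
      unfolding D using integral_diff[OF i1 i2] by (simp add: algebra_simps)
    finally show ?thesis by simp
  qed
  text \<open>The two mollifications are removed one after the other, each by a one-dimensional limit.\<close>
  have time: "integral {x1..x3} (\<lambda>x. S x1 x2 e x * m (x, s1)) =
      integral {x1..x3} (\<lambda>x. S x1 x2 e x * m (x, s2)) +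
      integral {s1..s2} (\<lambda>t. integral {x1..x3} (\<lambda>x. m (x, t) * w (x, t) * S' x1 x2 e x))"
    if e: "0 < e" "e < 1" for e
  proof -
    define b where "b = (\<lambda>t. integral {x1..x3} (\<lambda>x. m (x, t) * w (x, t) * S' x1 x2 e x))"
    define a where "a = (\<lambda>t. integral {x1..x3} (\<lambda>x. m (x, t) * S x1 x2 e x))"
    have swap: "continuous_on ({s1..s3} \<times> {x1..x3}) (\<lambda>(t, x). k (x, t))" if "continuous_on K k" for k :: "real \<times> real \<Rightarrow> real"
    proof -
      have "continuous_on ({s1..s3} \<times> {x1..x3}) (\<lambda>z. k (snd z, fst z))"
        by (rule continuous_on_compose2[OF that]) (auto simp: K_eq intro!: continuous_intros)
      then show ?thesis by (simp add: case_prod_unfold)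
    qed
    have ckb: "continuous_on K (\<lambda>z. m z * w z * S' x1 x2 e (fst z))"
      and cka: "continuous_on K (\<lambda>z. m z * S x1 x2 e (fst z))"
      by (intro continuous_intros cmK cwK tensor_c cS)+
    have cb: "continuous_on {s1..s3} b" and ca: "continuous_on {s1..s3} a"
      using integral_continuous_on_param[of "{s1..s3}" x1 x3 "\<lambda>t x. m (x, t) * w (x, t) * S' x1 x2 e x"]
        integral_continuous_on_param[of "{s1..s3}" x1 x3 "\<lambda>t x. m (x, t) * S x1 x2 e x"]
        swap[OF ckb] swap[OF cka] by (auto simp: a_def b_def)
    \<comment> \<open>A primitive of the flux b. Integration by parts turns the pairing of b with
      \<open>S\<close> into minus that of \<open>bi\<close> with \<open>S'\<close>, so a + bi is
      orthogonal to \<open>S'\<close> and takes equal values at s1 and s2.\<close>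
    define bi where "bi = (\<lambda>t. integral {s1..t} b)"
    have cbi: "continuous_on {s1..s3} bi"
      unfolding bi_def by (rule indefinite_integral_continuous_1) (intro integrable_continuous_real cb)
    have "a s1 + bi s1 = a s2 + bi s2"
    proof (rule step_pairing_limit[where \<sigma> = \<sigma> and \<beta> = \<beta> and l = s1 and u = s3
          and a = "\<lambda>t. a t + bi t" and s = s1 and r = s2])
      fix d assume "0 < d" "s1 + d < s3" "s2 + d < s3"
      then have d: "0 < d" "d < 1" by (auto simp: s3_def)
      have fub: "integral K (\<lambda>z. k z * h (snd z)) = integral {s1..s3} (\<lambda>t. integral {x1..x3} (\<lambda>x. k (x, t)) * h t)"
        if "continuous_on K k" "continuous_on UNIV h" for k :: "real \<times> real \<Rightarrow> real" and h
      proof -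
        have c: "continuous_on K (\<lambda>z. k z * h (snd z))"
          by (intro continuous_intros that tensor_c)
        have "integral K (\<lambda>z. k z * h (snd z)) = integral {x1..x3} (\<lambda>x. integral {s1..s3} (\<lambda>t. k (x, t) * h t))"
          using integral_prod_continuous[OF c[unfolded K_def]] by (simp add: K_def)
        also have "\<dots> = integral {s1..s3} (\<lambda>t. integral {x1..x3} (\<lambda>x. k (x, t) * h t))"
          using integral_swap_continuous[of x1 s1 x3 s3 "\<lambda>x t. k (x, t) * h t"] c
          by (simp add: K_def case_prod_unfold)
        finally show ?thesis by simp
      qed
      have ab: "integral {s1..s3} (\<lambda>t. b t * S s1 s2 d t) = integral {s1..s3} (\<lambda>t. a t * S' s1 s2 d t)"
        using id[OF e d] fub[OF ckb cS(1), of s1 s2 d] fub[OF cka cS(2), of s1 s2 d]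
        by (simp add: a_def b_def mult.assoc)
      have byparts: "((\<lambda>t. b t * S s1 s2 d t) has_integral (0 - integral {s1..s3} (\<lambda>t. bi t * S' s1 s2 d t))) {s1..s3}"
      proof -
        have "((\<lambda>t. b t * S s1 s2 d t + bi t * S' s1 s2 d t) has_integral
            (bi s3 * S s1 s2 d s3 - bi s1 * S s1 s2 d s1)) {s1..s3}"
        proof (rule fundamental_theorem_of_calculus)
          fix t assume t: "t \<in> {s1..s3}"
          have "(bi has_real_derivative b t) (at t within {s1..s3})"
            unfolding bi_def by (rule integral_has_real_derivative[OF cb t])
          from DERIV_mult[OF this has_field_derivative_at_within[OF dS[OF d(1)]]]
          have "((\<lambda>t. bi t * S s1 s2 d t) has_real_derivative b t * S s1 s2 d t + S' s1 s2 d t * bi t) (at t within {s1..s3})" .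
          then show "((\<lambda>t. bi t * S s1 s2 d t) has_vector_derivative b t * S s1 s2 d t + bi t * S' s1 s2 d t) (at t within {s1..s3})"
            by (simp add: mult.commute flip: has_real_derivative_iff_has_vector_derivative)
        qed (use s in \<open>auto simp: s3_def\<close>)
        moreover have "S s1 s2 d s3 = 0" using S0[OF d(1) s(2), of s3] d by (simp add: s3_def)
        moreover have "bi s1 = 0" by (simp add: bi_def)
        ultimately have tot: "((\<lambda>t. b t * S s1 s2 d t + bi t * S' s1 s2 d t) has_integral 0) {s1..s3}"
          by simp
        have "(\<lambda>t. bi t * S' s1 s2 d t) integrable_on {s1..s3}"
          by (intro integrable_continuous_real continuous_intros cbi cS)
        from has_integral_diff[OF tot integrable_integral[OF this]]
        show ?thesis by (simp only: add_diff_cancel_right')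
      qed
      have "(\<lambda>t. a t * S' s1 s2 d t) integrable_on {s1..s3}" "(\<lambda>t. bi t * S' s1 s2 d t) integrable_on {s1..s3}"
        by (intro integrable_continuous_real continuous_intros ca cbi cS)+
      then have "integral {s1..s3} (\<lambda>t. (a t + bi t) * S' s1 s2 d t) =
          integral {s1..s3} (\<lambda>t. a t * S' s1 s2 d t) + integral {s1..s3} (\<lambda>t. bi t * S' s1 s2 d t)"
        by (simp add: distrib_right integral_add)
      also have "\<dots> = 0" using ab integral_unique[OF byparts] by simp
      finally show "integral {s1..s3} (\<lambda>t. (a t + bi t) * (\<beta> ((t - s1) / d) / d - \<beta> ((t - s2) / d) / d)) = 0"
        by (simp add: S'_def)
    qed (use \<sigma> C_real_imp_cont[OF \<sigma>(3)] ca cbi s in \<open>auto intro!: continuous_intros simp: s3_def\<close>)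
    then show ?thesis
      by (simp add: a_def bi_def b_def mult.commute)
  qed
  \<comment> \<open>The same device in space: a primitive of the difference of the two time slices,
    compared with the time-integrated flux k. Their difference takes equal values at x1 and
    x2.\<close>
  define ai where "ai = (\<lambda>x. integral {x1..x} (\<lambda>x. m (x, s2)) - integral {x1..x} (\<lambda>x. m (x, s1)))"
  define k where "k = (\<lambda>x. integral {s1..s2} (\<lambda>t. m (x, t) * w (x, t)))"
  have cms: "continuous_on {x1..x3} (\<lambda>x. m (x, q))" if "q > t0" for q
    by (rule continuous_on_compose2[OF cm]) (use that in \<open>auto intro!: continuous_intros\<close>)
  have K2: "{x1..x3} \<times> {s1..s2} \<subseteq> K" by (auto simp: K_eq s3_def)
  have ck: "continuous_on {x1..x3} k"
    unfolding k_def
    using integral_continuous_on_param[of "{x1..x3}" s1 s2 "\<lambda>x t. m (x, t) * w (x, t)"]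
      continuous_on_subset[OF continuous_on_mult[OF cmK cwK] K2] by (simp add: case_prod_unfold)
  have s2: "t0 < s2" using s by simp
  have cai: "continuous_on {x1..x3} ai"
    unfolding ai_def
    by (intro continuous_on_diff indefinite_integral_continuous_1 integrable_continuous_real cms s s2)
  have "ai x1 - k x1 = ai x2 - k x2"
  proof (rule step_pairing_limit[where \<sigma> = \<sigma> and \<beta> = \<beta> and l = x1 and u = x3
        and a = "\<lambda>x. ai x - k x" and s = x1 and r = x2])
    fix e assume "0 < e" "x1 + e < x3" "x2 + e < x3"
    then have e: "0 < e" "e < 1" by (auto simp: x3_def)
    have cz: "continuous_on ({x1..x3} \<times> {s1..s2}) (\<lambda>z. m z * w z * S' x1 x2 e (fst z))"
      by (rule continuous_on_subset[OF _ K2]) (intro continuous_intros cmK cwK tensor_c cS)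
    have "integral {s1..s2} (\<lambda>t. integral {x1..x3} (\<lambda>x. m (x, t) * w (x, t) * S' x1 x2 e x)) =
        integral {x1..x3} (\<lambda>x. integral {s1..s2} (\<lambda>t. m (x, t) * w (x, t) * S' x1 x2 e x))"
      using integral_swap_continuous[of x1 s1 x3 s2 "\<lambda>x t. m (x, t) * w (x, t) * S' x1 x2 e x"] cz
      by (simp add: cbox_Pair_eq case_prod_unfold)
    then have t: "integral {x1..x3} (\<lambda>x. S x1 x2 e x * m (x, s1)) =
      integral {x1..x3} (\<lambda>x. S x1 x2 e x * m (x, s2)) + integral {x1..x3} (\<lambda>x. k x * S' x1 x2 e x)"
      using time[OF e] by (simp add: k_def)
    have im: "(\<lambda>x. S x1 x2 e x * m (x, q)) integrable_on {x1..x3}" if "q > t0" for q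
      by (intro integrable_continuous_real continuous_intros cms cS that)
    define f where "f = (\<lambda>x. m (x, s2) - m (x, s1))"
    have cf: "continuous_on {x1..x3} f" unfolding f_def by (intro continuous_intros cms s s2)
    have "((\<lambda>x. f x * S x1 x2 e x + S' x1 x2 e x * ai x) has_integral (ai x3 * S x1 x2 e x3 - ai x1 * S x1 x2 e x1)) {x1..x3}"
    proof (rule fundamental_theorem_of_calculus)
      fix y assume y: "y \<in> {x1..x3}"
      have "(ai has_real_derivative f y) (at y within {x1..x3})"
        unfolding ai_def f_def
        by (intro DERIV_diff integral_has_real_derivative cms s s2 y)
      from DERIV_mult[OF this has_field_derivative_at_within[OF dS[OF e(1)]]]
      show "((\<lambda>x. ai x * S x1 x2 e x) has_vector_derivative f y * S x1 x2 e y + S' x1 x2 e y * ai y) (at y within {x1..x3})"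
        by (simp flip: has_real_derivative_iff_has_vector_derivative)
    qed (use x in \<open>auto simp: x3_def\<close>)
    moreover have "S x1 x2 e x3 = 0" using S0[OF e(1) x, of x3] e by (simp add: x3_def)
    moreover have "ai x1 = 0" by (simp add: ai_def)
    ultimately have "((\<lambda>x. f x * S x1 x2 e x + S' x1 x2 e x * ai x) has_integral 0) {x1..x3}" by simp
    from integral_unique[OF this]
    have z: "integral {x1..x3} (\<lambda>x. f x * S x1 x2 e x) + integral {x1..x3} (\<lambda>x. S' x1 x2 e x * ai x) = 0"
      by (subst (asm) integral_add) (auto intro!: integrable_continuous_real continuous_intros cf cai cS)
    have "integral {x1..x3} (\<lambda>x. f x * S x1 x2 e x) =
        integral {x1..x3} (\<lambda>x. S x1 x2 e x * m (x, s2)) - integral {x1..x3} (\<lambda>x. S x1 x2 e x * m (x, s1))"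
      using integral_diff[OF im[OF s2] im[OF s(1)]] by (simp add: f_def algebra_simps)
    also have "\<dots> = - integral {x1..x3} (\<lambda>x. k x * S' x1 x2 e x)" using t by simp
    finally have "integral {x1..x3} (\<lambda>x. S' x1 x2 e x * ai x) - integral {x1..x3} (\<lambda>x. k x * S' x1 x2 e x) = 0"
      using z by simp
    also have "integral {x1..x3} (\<lambda>x. S' x1 x2 e x * ai x) - integral {x1..x3} (\<lambda>x. k x * S' x1 x2 e x) =
        integral {x1..x3} (\<lambda>x. (ai x - k x) * S' x1 x2 e x)"
      by (subst integral_diff[symmetric])
         (auto intro!: integrable_continuous_real continuous_intros ck cai cS simp: algebra_simps)
    finally show "integral {x1..x3} (\<lambda>x. (ai x - k x) * (\<beta> ((x - x1) / e) / e - \<beta> ((x - x2) / e) / e)) = 0"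
      by (simp add: S'_def)
  qed (use \<sigma> C_real_imp_cont[OF \<sigma>(3)] ck cai x in \<open>auto intro!: continuous_intros simp: x3_def\<close>)
  then show ?thesis by (simp add: ai_def k_def)
qed

section \<open>Norms and partial derivatives\<close>

text \<open>Height K on a set of length 2 * L. The exponent \<open>enn2real (1 / p)\<close> is 0 for
  p = \<infinity>, so one formula covers every p.\<close>

lemma Lp_norm_le_of_bounded_support:
  fixes f :: "real \<Rightarrow> real" and p :: ennreal
  assumes f: "f \<in> borel_measurable lebesgue" and K: "\<And>x. \<bar>f x\<bar> \<le> K" and L: "L > 0"
    and z: "\<And>x. \<bar>x\<bar> > L \<Longrightarrow> f x = 0" and p: "1 \<le> p"
  shows "Lp_norm p lebesgue f \<le> ennreal (K * (2 * L) powr enn2real (1 / p))"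
proof -
  have K0: "K \<ge> 0" using K[of 0] by linarith
  show ?thesis
  proof (cases "p = \<infinity>")
    case True
    have "Lp_norm p lebesgue f = Inf {C. AE x in lebesgue. ennreal \<bar>f x\<bar> \<le> C}"
      using f True by (simp add: Lp_norm_def)
    also have "\<dots> \<le> ennreal K"
      by (rule Inf_lower) (use K in \<open>auto intro!: ennreal_leI\<close>)
    finally show ?thesis using True L by simp
  next
    case False
    define q where "q = enn2real p"
    have pq: "p = ennreal q" using False by (simp add: q_def less_top[symmetric])
    have q: "q \<ge> 1" using p by (simp add: pq)
    have inv: "enn2real (1 / p) = 1 / q"
      using q by (simp add: pq divide_ennreal flip: ennreal_1)
    define I where "I = (\<integral>\<^sup>+ x. ennreal (\<bar>f x\<bar> powr q) \<partial>lebesgue)"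
    have "I \<le> (\<integral>\<^sup>+ x. ennreal (K powr q) * indicator {- L..L} x \<partial>lebesgue)"
      unfolding I_def
    proof (rule nn_integral_mono)
      fix x
      show "ennreal (\<bar>f x\<bar> powr q) \<le> ennreal (K powr q) * indicator {- L..L} x"
      proof (cases "\<bar>x\<bar> \<le> L")
        case True
        then have "x \<in> {- L..L}" by auto
        then show ?thesis using K[of x] q by (auto intro!: ennreal_leI powr_mono2)
      next
        case False
        then show ?thesis using z[of x] by simp
      qed
    qed
    also have "\<dots> = ennreal (K powr q) * ennreal (2 * L)"
      using L by (subst nn_integral_cmult_indicator) auto
    also have "\<dots> = ennreal (K powr q * (2 * L))" using L by (simp add: ennreal_mult)
    finally have I: "I \<le> ennreal (K powr q * (2 * L))" .
    then have "I \<noteq> \<infinity>" by (auto simp: top_unique)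
    then have "Lp_norm p lebesgue f = ennreal (enn2real I powr (1 / q))"
      using f False by (simp add: Lp_norm_def Let_def I_def q_def)
    also have "\<dots> \<le> ennreal ((K powr q * (2 * L)) powr (1 / q))"
    proof (intro ennreal_leI powr_mono2)
      have "enn2real I \<le> enn2real (ennreal (K powr q * (2 * L)))"
        by (rule enn2real_mono[OF I]) simp
      then show "enn2real I \<le> K powr q * (2 * L)" using L by simp
    qed (use q in auto)
    also have "(K powr q * (2 * L)) powr (1 / q) = K * (2 * L) powr (1 / q)"
      using L q K0 by (simp add: powr_mult powr_powr)
    finally show ?thesis by (simp add: inv)
  qed
qed

text \<open>Common bookkeeping for the three limits: a sup norm that is o(t powr -\<gamma>), on a
  support whose length grows like t powr \<alpha>, loses the factor t powr (\<alpha> / p). The rate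
  is \<gamma> = \<alpha> for the density and \<gamma> = 2 - \<alpha> for the two weighted
  differences.\<close>

lemma scaled_Lp_norm_tendsto_zero:
  fixes f :: "real \<Rightarrow> real \<Rightarrow> real" and p :: ennreal
  assumes p: "1 \<le> p" and L: "L > 0"
    and cont: "\<And>t. t > t0 \<Longrightarrow> continuous_on UNIV (f t)"
    and supp: "\<And>t x. t > t0 \<Longrightarrow> L * t powr \<alpha> < \<bar>x\<bar> \<Longrightarrow> f t x = 0"
    and small: "\<And>e. e > 0 \<Longrightarrow> \<forall>\<^sub>F t in at_top. \<forall>x. \<bar>f t x\<bar> \<le> t powr (- \<gamma>) * e"
    and k: "k = \<gamma> - \<alpha> * enn2real (1 / p)"
  shows "((\<lambda>t. ennreal (t powr k) * Lp_norm p lebesgue (f t)) \<longlongrightarrow> 0) at_top"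
proof (rule order_tendstoI)
  fix c :: ennreal assume c: "0 < c"
  define r where "r = enn2real (1 / p)"
  define C where "C = (2 * L) powr r"
  have C: "C > 0" using L by (simp add: C_def)
  obtain d :: real where d: "0 < d" "ennreal d < c"
  proof -
    obtain c' where c': "0 < c'" "c' < c" using dense[OF c] by blast
    then have "c' \<noteq> top" by (metis top.extremum_strict)
    then show ?thesis
      using c' by (intro that[of "enn2real c'"]) (auto simp: enn2real_positive_iff less_top)
  qed
  have "d / C > 0" using d C by simp
  from small[OF this] eventually_gt_at_top[of "max 0 t0"]
  show "\<forall>\<^sub>F t in at_top. ennreal (t powr k) * Lp_norm p lebesgue (f t) < c"
  proof eventually_elim
    fix t :: real
    assume f: "\<forall>x. \<bar>f t x\<bar> \<le> t powr (- \<gamma>) * (d / C)" and "max 0 t0 < t"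
    then have t: "t > 0" "t > t0" by auto
    have "f t \<in> borel_measurable lebesgue"
      using borel_measurable_continuous_onI[OF cont[OF t(2)]] by (simp add: measurable_completion)
    then have "Lp_norm p lebesgue (f t) \<le> ennreal (t powr (- \<gamma>) * (d / C) * (2 * (L * t powr \<alpha>)) powr r)"
      unfolding r_def by (rule Lp_norm_le_of_bounded_support) (use f t L p supp[OF t(2)] in auto)
    also have "(2 * (L * t powr \<alpha>)) powr r = C * t powr (\<alpha> * r)"
      using L by (simp add: C_def powr_mult powr_powr flip: mult.assoc)
    also have "t powr (- \<gamma>) * (d / C) * (C * t powr (\<alpha> * r)) = d * t powr (- k)"
      using C by (simp add: k r_def powr_add[symmetric])
    finally have "ennreal (t powr k) * Lp_norm p lebesgue (f t) \<le> ennreal (t powr k) * ennreal (d * t powr (- k))"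
      by (rule mult_left_mono) simp
    also have "\<dots> = ennreal (t powr k * (d * t powr (- k)))"
      using d by (simp add: ennreal_mult)
    also have "t powr k * (d * t powr (- k)) = d"
      using t by (simp add: powr_minus field_simps)
    finally show "ennreal (t powr k) * Lp_norm p lebesgue (f t) < c" using d(2) by simp
  qed
qed simp

text \<open>For continuous f the exceptional set is open as well as null, hence empty. A pointwise
  bound is required because the velocity is evaluated along individual particles.\<close>

lemma bounded_of_Lp_norm_infinity:
  fixes f :: "'a::euclidean_space \<Rightarrow> real"
  assumes fin: "Lp_norm \<infinity> (lebesgue_on S) f < \<infinity>" and S: "open S" and f: "continuous_on S f"
  obtains B where "\<And>x. x \<in> S \<Longrightarrow> \<bar>f x\<bar> \<le> B"
proof -
  have "f \<in> borel_measurable (lebesgue_on S)" using fin by (auto simp: Lp_norm_def split: if_splits)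
  then have "Inf {C. AE x in lebesgue_on S. ennreal \<bar>f x\<bar> \<le> C} < \<infinity>" using fin by (simp add: Lp_norm_def)
  then obtain C where C: "AE x in lebesgue_on S. ennreal \<bar>f x\<bar> \<le> C" "C < \<infinity>"
    by (auto simp: Inf_less_iff)
  define B where "B = enn2real C"
  have CB: "C = ennreal B" using C(2) by (simp add: B_def)
  have B0: "B \<ge> 0" by (simp add: B_def)
  have ae: "AE x in lebesgue. x \<in> S \<longrightarrow> \<bar>f x\<bar> \<le> B"
    using C(1) S B0 by (subst (asm) AE_restrict_space_iff) (auto simp: CB ennreal_le_iff sets_completionI_sets)
  have op: "open (S \<inter> (\<lambda>x. \<bar>f x\<bar>) -` {B<..})"
    by (rule continuous_open_preimage) (auto intro!: continuous_intros f S)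
  have "\<bar>f x\<bar> \<le> B" if x: "x \<in> S" for x
  proof (rule ccontr)
    assume "\<not> \<bar>f x\<bar> \<le> B"
    then have "S \<inter> (\<lambda>x. \<bar>f x\<bar>) -` {B<..} \<noteq> {}" using x by auto
    moreover have "S \<inter> (\<lambda>x. \<bar>f x\<bar>) -` {B<..} \<in> null_sets lebesgue"
    proof -
      have "{x \<in> space lebesgue. \<not> (x \<in> S \<longrightarrow> \<bar>f x\<bar> \<le> B)} = S \<inter> (\<lambda>x. \<bar>f x\<bar>) -` {B<..}" by auto
      then show ?thesis
        using ae op by (subst (asm) AE_iff_null) (auto simp: sets_completionI_sets)
    qed
    then have "negligible (S \<inter> (\<lambda>x. \<bar>f x\<bar>) -` {B<..})" by (simp add: negligible_iff_null_sets)
    ultimately show False using open_not_negligible[OF op] by blast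
  qed
  then show ?thesis by (rule that)
qed

lemma Ck_on_1_has_derivative:
  assumes "Ck_on 1 \<Omega> f" "z \<in> \<Omega>"
  shows "(f has_derivative (\<lambda>(h, k). h * Dx f z + k * Dt f z)) (at z)"
proof -
  have "(f has_derivative frechet_derivative f (at z)) (at z)"
    using assms by (simp add: frechet_derivative_works)
  moreover have "frechet_derivative f (at z) = (\<lambda>(h, k). h * Dx f z + k * Dt f z)"
  proof
    fix y :: "real \<times> real"
    have lin: "linear (frechet_derivative f (at z))"
      using assms by (intro linear_frechet_derivative) auto
    have "y = fst y *\<^sub>R (1, 0) + snd y *\<^sub>R (0, 1)" by (simp add: prod_eq_iff)
    then have "frechet_derivative f (at z) y = frechet_derivative f (at z) (fst y *\<^sub>R (1, 0) + snd y *\<^sub>R (0, 1))" by simp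
    also have "\<dots> = (case y of (h, k) \<Rightarrow> h * Dx f z + k * Dt f z)"
      by (simp only: linear_add[OF lin] linear_scale[OF lin] partial_deriv_def case_prod_unfold real_scaleR_def)
    finally show "frechet_derivative f (at z) y = (case y of (h, k) \<Rightarrow> h * Dx f z + k * Dt f z)" .
  qed
  ultimately show ?thesis by simp
qed

lemma Ck_on_1_partial_cont:
  assumes "Ck_on 1 \<Omega> f"
  shows "continuous_on \<Omega> (Dx f)" "continuous_on \<Omega> (Dt f)"
  using assms by (auto simp: Basis_real_prod)

lemma has_derivative_imp_partial_deriv:
  assumes "(f has_derivative (\<lambda>(h, k). h * c + k * d)) (at z)"
  shows "Dx f z = c" "Dt f z = d"
  using frechet_derivative_at[OF assms, symmetric] by (auto simp: partial_deriv_def)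

lemma has_derivative_imp_real_derivative_slices:
  fixes f :: "real \<times> real \<Rightarrow> real"
  assumes "(f has_derivative (\<lambda>(h, k). h * c + k * d)) (at (x, t))"
  shows "((\<lambda>x. f (x, t)) has_real_derivative c) (at x)"
    and "((\<lambda>t. f (x, t)) has_real_derivative d) (at t)"
proof -
  have "((\<lambda>x. (x, t)) has_derivative (\<lambda>h. (h, 0))) (at x)" "((\<lambda>t. (x, t)) has_derivative (\<lambda>h. (0, h))) (at t)"
    by (auto intro!: derivative_eq_intros)
  from has_derivative_compose[OF this(1) assms] has_derivative_compose[OF this(2) assms]
  show "((\<lambda>x. f (x, t)) has_real_derivative c) (at x)" "((\<lambda>t. f (x, t)) has_real_derivative d) (at t)"
    by (simp_all add: has_field_derivative_def mult.commute[of _ c] mult.commute[of _ d])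
qed

text \<open>The second difference of f over a small square is evaluated by the mean value theorem in
  both orders; the two mixed derivatives then agree at points arbitrarily close to z0.\<close>

lemma mixed_partials_eq:
  fixes f fx ft fxt ftx :: "real \<times> real \<Rightarrow> real"
  assumes S: "open S" "z0 \<in> S"
    and fx: "\<And>x t. (x, t) \<in> S \<Longrightarrow> ((\<lambda>x. f (x, t)) has_real_derivative fx (x, t)) (at x)"
    and ft: "\<And>x t. (x, t) \<in> S \<Longrightarrow> ((\<lambda>t. f (x, t)) has_real_derivative ft (x, t)) (at t)"
    and fxt: "\<And>x t. (x, t) \<in> S \<Longrightarrow> ((\<lambda>t. fx (x, t)) has_real_derivative fxt (x, t)) (at t)"
    and ftx: "\<And>x t. (x, t) \<in> S \<Longrightarrow> ((\<lambda>x. ft (x, t)) has_real_derivative ftx (x, t)) (at x)"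
    and c: "continuous_on S fxt" "continuous_on S ftx"
  shows "fxt z0 = ftx z0"
proof (rule ccontr)
  assume ne: "fxt z0 \<noteq> ftx z0"
  define e where "e = \<bar>fxt z0 - ftx z0\<bar> / 2"
  have e: "e > 0" using ne by (simp add: e_def)
  obtain x0 t0 where z0: "z0 = (x0, t0)" by (cases z0)
  obtain r0 where r0: "r0 > 0" "ball z0 r0 \<subseteq> S" using S by (meson open_contains_ball)
  obtain r1 where r1: "r1 > 0" "\<And>z. z \<in> S \<Longrightarrow> dist z z0 < r1 \<Longrightarrow> dist (fxt z) (fxt z0) < e"
    using c(1) S(2) e unfolding continuous_on_iff by meson
  obtain r2 where r2: "r2 > 0" "\<And>z. z \<in> S \<Longrightarrow> dist z z0 < r2 \<Longrightarrow> dist (ftx z) (ftx z0) < e"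
    using c(2) S(2) e unfolding continuous_on_iff by meson
  define r where "r = min r0 (min r1 r2)"
  \<comment> \<open>Points of the square are at distance at most 2 * h = r / 2 from z0, inside all
    three radii.\<close>
  define h where "h = r / 4"
  have h: "h > 0" using r0 r1 r2 by (simp add: h_def r_def)
  have near: "dist (x, t) z0 < r" if "x0 \<le> x" "x \<le> x0 + h" "t0 \<le> t" "t \<le> t0 + h" for x t
  proof -
    have "dist (x, t) z0 \<le> \<bar>x - x0\<bar> + \<bar>t - t0\<bar>"
      unfolding z0 dist_Pair_Pair dist_real_def by (rule sqrt_sum_squares_le_sum) auto
    then show ?thesis using that h by (auto simp: h_def)
  qed
  then have inS: "(x, t) \<in> S" if "x0 \<le> x" "x \<le> x0 + h" "t0 \<le> t" "t \<le> t0 + h" for x t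
    using near[OF that] r0(2) by (force simp: dist_commute r_def)
  have "\<exists>x>x0. x < x0 + h \<and> (f (x0 + h, t0 + h) - f (x0 + h, t0)) - (f (x0, t0 + h) - f (x0, t0)) =
      (x0 + h - x0) * (fx (x, t0 + h) - fx (x, t0))"
    by (rule MVT2[where f = "\<lambda>x. f (x, t0 + h) - f (x, t0)"]) (use h in \<open>auto intro!: DERIV_diff fx inS\<close>)
  then obtain x where x: "x0 < x" "x < x0 + h"
    "(f (x0 + h, t0 + h) - f (x0 + h, t0)) - (f (x0, t0 + h) - f (x0, t0)) = h * (fx (x, t0 + h) - fx (x, t0))" by auto
  have "\<exists>t>t0. t < t0 + h \<and> fx (x, t0 + h) - fx (x, t0) = (t0 + h - t0) * fxt (x, t)"
    by (rule MVT2[where f = "\<lambda>t. fx (x, t)"]) (use h x in \<open>auto intro!: fxt inS\<close>)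
  then obtain t where t: "t0 < t" "t < t0 + h" "fx (x, t0 + h) - fx (x, t0) = h * fxt (x, t)" by auto
  have "\<exists>t>t0. t < t0 + h \<and> (f (x0 + h, t0 + h) - f (x0, t0 + h)) - (f (x0 + h, t0) - f (x0, t0)) =
      (t0 + h - t0) * (ft (x0 + h, t) - ft (x0, t))"
    by (rule MVT2[where f = "\<lambda>t. f (x0 + h, t) - f (x0, t)"]) (use h in \<open>auto intro!: DERIV_diff ft inS\<close>)
  then obtain t' where t': "t0 < t'" "t' < t0 + h"
    "(f (x0 + h, t0 + h) - f (x0, t0 + h)) - (f (x0 + h, t0) - f (x0, t0)) = h * (ft (x0 + h, t') - ft (x0, t'))" by auto
  have "\<exists>x>x0. x < x0 + h \<and> ft (x0 + h, t') - ft (x0, t') = (x0 + h - x0) * ftx (x, t')"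
    by (rule MVT2[where f = "\<lambda>x. ft (x, t')"]) (use h t' in \<open>auto intro!: ftx inS\<close>)
  then obtain x' where x': "x0 < x'" "x' < x0 + h" "ft (x0 + h, t') - ft (x0, t') = h * ftx (x', t')" by auto
  have "h * (h * fxt (x, t)) = h * (h * ftx (x', t'))"
    using x(3) t(3) t'(3) x'(3) by (simp add: algebra_simps)
  then have eq: "fxt (x, t) = ftx (x', t')" using h by simp
  have "dist (fxt (x, t)) (fxt z0) < e" "dist (ftx (x', t')) (ftx z0) < e"
    using r1(2)[of "(x, t)"] r2(2)[of "(x', t')"] near[of x t] near[of x' t'] inS[of x t] inS[of x' t'] x t x' t'
    by (auto simp: r_def)
  then have "\<bar>fxt z0 - ftx z0\<bar> < 2 * e" using eq unfolding dist_real_def by arith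
  then show False by (simp add: e_def)
qed

section \<open>The rescaled solution\<close>

locale mfg_solution =
  fixes \<theta> \<alpha> t0 a R :: real and u m :: "real \<times> real \<Rightarrow> real"
  assumes theta: "\<theta> > 0" and alpha_def: "\<alpha> = 2 / (2 + \<theta>)" and t0: "t0 > 0"
    and u_C1: "Ck_on 1 (UNIV \<times> {t0<..}) u"
    and m_cont: "continuous_on (UNIV \<times> {t0..}) m"
    and m_nonneg: "\<And>x t. t \<ge> t0 \<Longrightarrow> m (x, t) \<ge> 0"
    and hj: "\<And>x t. t > t0 \<Longrightarrow> - Dt u (x, t) + 1 / 2 * (Dx u (x, t))\<^sup>2 = m (x, t) powr \<theta>"
    and weak: "\<forall>\<phi>\<in>test_functions (UNIV \<times> {t0<..}).
      (LINT y|lebesgue_on (UNIV \<times> {t0<..}). - (m y * Dt \<phi> y) + m y * Dx u y * Dx \<phi> y) = 0"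
    and m_interval: "\<And>t. t > t0 \<Longrightarrow> \<exists>l r. {x. m (x, t) > 0} = {l<..<r}"
    and a_def: "a = (LINT x|lebesgue. m (x, t0))" and a_pos: "a > 0" and R_pos: "R > 0"
    and mu_bounded: "bounded (rescaled_m \<alpha> m ` (UNIV \<times> {ln t0<..}))"
    and mu_uc: "uniformly_continuous_on (UNIV \<times> {ln t0<..}) (rescaled_m \<alpha> m)"
    and supp: "closure (support_on (UNIV \<times> {ln t0..}) (rescaled_m \<alpha> m)) \<subseteq> {- R..R} \<times> {ln t0..}"
    and Dv_C1: "\<forall>b\<in>Basis. Ck_on 1 {y \<in> UNIV \<times> {ln t0<..}. rescaled_m \<alpha> m y > 0} (partial_deriv b (rescaled_u \<alpha> u))"
    and vx_bounded: "Lp_norm \<infinity> (lebesgue_on ({- R<..<R} \<times> {ln t0<..})) (Dx (rescaled_u \<alpha> u)) < \<infinity>"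
begin

abbreviation "\<mu> \<equiv> rescaled_m \<alpha> m"
abbreviation "v \<equiv> rescaled_u \<alpha> u"
abbreviation "\<tau>0 \<equiv> ln t0"

text \<open>The identity \<alpha> * \<theta> = 2 - 2\<alpha> is the reason for the value of
  \<alpha>: with it m powr \<theta>, Dt u and (Dx u)^2 scale by the same power of t, and the
  Hamilton-Jacobi equation is compatible with the rescaling.\<close>

lemma alpha: "0 < \<alpha>" "\<alpha> < 1" "\<alpha> * \<theta> = 2 - 2 * \<alpha>"
  using theta by (auto simp: alpha_def field_simps)

lemma exp_gt_t0: "\<tau> > \<tau>0 \<Longrightarrow> exp \<tau> > t0"
  using t0 by (metis exp_less_cancel_iff exp_ln)

lemma mu_eq: "\<mu> (\<eta>, \<tau>) = exp (\<alpha> * \<tau>) * m (exp (\<alpha> * \<tau>) * \<eta>, exp \<tau>)"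
  by (simp add: rescaled_m_def exp_powr_real mult.commute)

lemma v_eq: "v (\<eta>, \<tau>) = exp ((1 - 2 * \<alpha>) * \<tau>) * u (exp (\<alpha> * \<tau>) * \<eta>, exp \<tau>)"
  by (simp add: rescaled_u_def exp_powr_real mult.commute)

lemma mu_zero: "\<tau> \<ge> \<tau>0 \<Longrightarrow> \<bar>\<eta>\<bar> > R \<Longrightarrow> \<mu> (\<eta>, \<tau>) = 0"
proof (rule ccontr)
  assume \<tau>: "\<tau> \<ge> \<tau>0" and \<eta>: "\<bar>\<eta>\<bar> > R" and "\<mu> (\<eta>, \<tau>) \<noteq> 0"
  then have "(\<eta>, \<tau>) \<in> support_on (UNIV \<times> {\<tau>0..}) \<mu>" by (simp add: support_on_def)
  then have "(\<eta>, \<tau>) \<in> {- R..R} \<times> {\<tau>0..}" using closure_subset supp by blast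
  then show False using \<eta> by auto
qed

lemma m_zero:
  assumes t: "t \<ge> t0" and x: "\<bar>x\<bar> > R * t powr \<alpha>"
  shows "m (x, t) = 0"
proof -
  have t': "t > 0" using t t0 by simp
  have e: "exp (\<alpha> * ln t) = t powr \<alpha>" using t' by (simp add: powr_def)
  have "\<bar>x / t powr \<alpha>\<bar> > R" using x t' by (simp add: abs_divide pos_less_divide_eq)
  then have "\<mu> (x / t powr \<alpha>, ln t) = 0" using t t0 by (intro mu_zero) simp_all
  then show ?thesis using t' by (simp add: mu_eq e)
qed

lemma m_cont_slice: "t \<ge> t0 \<Longrightarrow> continuous_on A (\<lambda>x. m (x, t))"
  by (rule continuous_on_compose2[OF m_cont]) (auto intro!: continuous_intros)

lemma m_integrable: "t \<ge> t0 \<Longrightarrow> (\<lambda>x. m (x, t)) integrable_on {l..r}"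
  by (intro integrable_continuous_real m_cont_slice)

lemma m_cont_open: "continuous_on (UNIV \<times> {t0<..}) m"
  by (rule continuous_on_subset[OF m_cont]) auto

section \<open>Mass balance and conservation in the original variables\<close>

lemma rectangle:
  assumes "t0 < s1" "s1 \<le> s2" "x1 \<le> x2"
  shows "integral {x1..x2} (\<lambda>x. m (x, s2)) - integral {x1..x2} (\<lambda>x. m (x, s1)) =
    integral {s1..s2} (\<lambda>t. m (x2, t) * Dx u (x2, t)) - integral {s1..s2} (\<lambda>t. m (x1, t) * Dx u (x1, t))"
  by (rule weak_continuity_rectangle[OF m_cont_open Ck_on_1_partial_cont(1)[OF u_C1] weak assms])

lemma flux_zero:
  assumes "t0 < s1" "R * s2 powr \<alpha> < \<bar>x\<bar>"
  shows "integral {s1..s2} (\<lambda>t. m (x, t) * Dx u (x, t)) = 0"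
proof -
  have "integral {s1..s2} (\<lambda>t. m (x, t) * Dx u (x, t)) = integral {s1..s2} (\<lambda>t. 0)"
  proof (rule integral_cong)
    fix t assume t: "t \<in> {s1..s2}"
    then have "R * t powr \<alpha> \<le> R * s2 powr \<alpha>"
      using assms(1) t0 alpha R_pos by (intro mult_left_mono powr_mono2) auto
    then have "m (x, t) = 0" using t assms by (intro m_zero) auto
    then show "m (x, t) * Dx u (x, t) = 0" by simp
  qed
  then show ?thesis by simp
qed

text \<open>The balance holds only for times after t0, whereas a is the mass at t0. It gives a
  constant mass on (t0, t], since m vanishes at -L and L up to time t, and continuity of m up to t0
  carries the constant to the initial time.\<close>

lemma mass:
  assumes t: "t0 < t" and L: "L > R * t powr \<alpha>"
  shows "integral {- L..L} (\<lambda>x. m (x, t)) = a"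
proof -
  define I where "I = (\<lambda>t. integral {- L..L} (\<lambda>x. m (x, t)))"
  have L0: "L > 0" using L R_pos t t0 by (smt (verit) mult_pos_pos powr_gt_zero)
  have "continuous_on ({t0..t} \<times> {- L..L}) (\<lambda>z. m (snd z, fst z))"
    by (rule continuous_on_compose2[OF m_cont]) (auto intro!: continuous_intros)
  then have cI: "continuous_on {t0..t} I"
    unfolding I_def using integral_continuous_on_param[of "{t0..t}" "- L" L "\<lambda>t x. m (x, t)"]
    by (simp add: case_prod_unfold)
  have const: "I s = I t" if "s \<in> {t0<..t}" for s
    using rectangle[of s t "- L" L] flux_zero[of s t L] flux_zero[of s t "- L"] that L L0 by (simp add: I_def)
  have "I t0 = I t"
  proof (rule continuous_constant_on_closure[of "{t0<..t}" I])
    show "continuous_on (closure {t0<..t}) I" "t0 \<in> closure {t0<..t}"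
      using t cI by simp_all
  qed (rule const)
  also have "I t0 = (LINT x|lebesgue. m (x, t0))"
    unfolding I_def
  proof (rule lebesgue_integral_compact_support[symmetric])
    show "continuous_on UNIV (\<lambda>x. m (x, t0))" by (rule m_cont_slice) simp
    fix x assume "L < \<bar>x\<bar>"
    moreover have "R * t0 powr \<alpha> \<le> R * t powr \<alpha>"
      using t t0 alpha R_pos by (intro mult_left_mono powr_mono2) auto
    ultimately show "m (x, t0) = 0" using L by (intro m_zero) auto
  qed
  finally show ?thesis by (simp add: I_def a_def)
qed

text \<open>The mass to the left of x, with -L standing in for minus infinity. The support spreads
  with time, so L has to be chosen beyond it for the time range under consideration.\<close>

definition cum where "cum L = (\<lambda>(x, t). integral {- L..x} (\<lambda>s. m (s, t)))"

lemma cum_deriv_x: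
  assumes "t > t0" "x > - L"
  shows "((\<lambda>x. cum L (x, t)) has_real_derivative m (x, t)) (at x)"
proof -
  have "((\<lambda>x. integral {- L..x} (\<lambda>s. m (s, t))) has_real_derivative m (x, t)) (at x within {- L..x + 1})"
    by (rule integral_has_real_derivative[OF m_cont_slice]) (use assms in auto)
  then show ?thesis using at_within_Icc_at[of "- L" x "x + 1"] assms by (simp add: cum_def)
qed

text \<open>The balance on [-L, x] has no flux at -L before time T, so \<open>cum\<close> is a
  constant plus a primitive of the flux at x. The base time s1 lies strictly after t0, where the
  balance is available, and strictly before t, so that the derivative is two-sided.\<close>

lemma cum_deriv_t:
  assumes t: "t0 < t" "t < T" and x: "x \<ge> - L" and L: "L > R * T powr \<alpha>"
  shows "((\<lambda>t. cum L (x, t)) has_real_derivative m (x, t) * Dx u (x, t)) (at t)"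
proof -
  define s1 where "s1 = (t0 + t) / 2"
  have s1: "t0 < s1" "s1 < t" using t by (auto simp: s1_def)
  have L0: "L > 0" using L R_pos t t0 by (smt (verit) mult_nonneg_nonneg powr_ge_zero)
  have c: "continuous_on {s1..T} (\<lambda>t. m (x, t) * Dx u (x, t))"
    by (intro continuous_on_mult continuous_on_compose2[OF m_cont_open]
        continuous_on_compose2[OF Ck_on_1_partial_cont(1)[OF u_C1]]) (use s1 in \<open>auto intro!: continuous_intros\<close>)
  have "((\<lambda>s. integral {s1..s} (\<lambda>t. m (x, t) * Dx u (x, t))) has_real_derivative m (x, t) * Dx u (x, t)) (at t within {s1..T})"
    by (rule integral_has_real_derivative[OF c]) (use s1 t in auto)
  then have "((\<lambda>s. integral {s1..s} (\<lambda>t. m (x, t) * Dx u (x, t))) has_real_derivative m (x, t) * Dx u (x, t)) (at t)"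
    using at_within_Icc_at[OF s1(2) t(2)] by simp
  from DERIV_add[OF DERIV_const[of "cum L (x, s1)"] this]
  have "((\<lambda>s. cum L (x, s1) + integral {s1..s} (\<lambda>t. m (x, t) * Dx u (x, t))) has_real_derivative m (x, t) * Dx u (x, t)) (at t)"
    by simp
  then show ?thesis
  proof (rule has_field_derivative_transform_within_open[where S = "{s1<..<T}"])
    fix s assume s: "s \<in> {s1<..<T}"
    have "R * s powr \<alpha> \<le> R * T powr \<alpha>"
      using s s1 t0 alpha R_pos by (intro mult_left_mono powr_mono2) auto
    then have "integral {s1..s} (\<lambda>t. m (- L, t) * Dx u (- L, t)) = 0"
      using L s1 L0 by (intro flux_zero) auto
    then show "cum L (x, s1) + integral {s1..s} (\<lambda>t. m (x, t) * Dx u (x, t)) = cum L (x, s)"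
      using rectangle[of s1 s "- L" x] s s1 x by (simp add: cum_def)
  qed (use s1 t in auto)
qed

lemma cum_has_derivative:
  assumes t: "t0 < t" "t < T" and x: "x > - L" and L: "L > R * T powr \<alpha>"
  shows "(cum L has_derivative (\<lambda>(h, k). m (x, t) * h + m (x, t) * Dx u (x, t) * k)) (at (x, t))"
proof (rule has_derivative_continuous_partials[where X = "{- L<..}" and Y = "{t0<..<T}" and d = "\<lambda>z. m z * Dx u z"])
  have "continuous_on (UNIV \<times> {t0<..}) (\<lambda>z. m z * Dx u z)"
    by (intro continuous_intros m_cont_open Ck_on_1_partial_cont(1)[OF u_C1])
  then show "continuous_on ({- L<..} \<times> {t0<..<T}) (\<lambda>z. m z * Dx u z)"
    by (rule continuous_on_subset) auto
qed (use t x L cum_deriv_x[OF t(1) x] cum_deriv_t in auto)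

lemma rescaled_cdf_eq:
  assumes \<tau>: "\<tau> > \<tau>0" and \<eta>: "\<eta> \<ge> - R" and L: "L > R * exp (\<alpha> * \<tau>)"
  shows "integral {- R..\<eta>} (\<lambda>s. \<mu> (s, \<tau>)) = cum L (exp (\<alpha> * \<tau>) * \<eta>, exp \<tau>)"
proof -
  define E where "E = exp (\<alpha> * \<tau>)"
  have E: "E > 0" "exp \<tau> powr \<alpha> = E" by (auto simp: E_def exp_powr_real mult.commute)
  have lb: "E * s > - L" if "s \<ge> - R" for s
  proof -
    have "E * s \<ge> E * - R" using that E(1) by (intro mult_left_mono) auto
    then show ?thesis using L by (simp add: E_def mult.commute)
  qed
  have "((\<lambda>s. \<mu> (s, \<tau>)) has_integral (cum L (E * \<eta>, exp \<tau>) - cum L (E * - R, exp \<tau>))) {- R..\<eta>}"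
  proof (rule fundamental_theorem_of_calculus[OF \<eta>])
    fix s assume s: "s \<in> {- R..\<eta>}"
    have 1: "((\<lambda>s. E * s) has_real_derivative E) (at s within {- R..\<eta>})"
      by (auto intro!: derivative_eq_intros)
    have "((\<lambda>s. cum L (E * s, exp \<tau>)) has_real_derivative m (E * s, exp \<tau>) * E) (at s within {- R..\<eta>})"
      by (rule DERIV_chain2[where f = "\<lambda>x. cum L (x, exp \<tau>)", OF cum_deriv_x[OF exp_gt_t0[OF \<tau>] lb] 1]) (use s in auto)
    then show "((\<lambda>s. cum L (E * s, exp \<tau>)) has_vector_derivative \<mu> (s, \<tau>)) (at s within {- R..\<eta>})"
      by (simp add: mu_eq E_def mult.commute flip: has_real_derivative_iff_has_vector_derivative)
  qed
  moreover have "cum L (E * - R, exp \<tau>) = 0"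
  proof -
    have "integral {- L..E * - R} (\<lambda>s. m (s, exp \<tau>)) = integral {- L..E * - R} (\<lambda>s. 0)"
    proof (rule integral_spike[of "{E * - R}"])
      fix s assume "s \<in> {- L..E * - R} - {E * - R}"
      then have "R * E < \<bar>s\<bar>" using R_pos E(1) by (auto simp: mult.commute)
      then show "0 = m (s, exp \<tau>)" using m_zero[of "exp \<tau>" s] exp_gt_t0[OF \<tau>] E(2) by simp
    qed auto
    then show ?thesis by (simp add: cum_def)
  qed
  ultimately show ?thesis by (simp add: integral_unique E_def)
qed

section \<open>The equations in the rescaled variables\<close>

lemma v_has_derivative:
  fixes x t :: real
  assumes t: "t > \<tau>0"
  defines "z \<equiv> (exp (\<alpha> * t) * x, exp t)"
  shows "(v has_derivative (\<lambda>(h, k). h * (exp ((1 - \<alpha>) * t) * Dx u z) +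
    k * ((1 - 2 * \<alpha>) * v (x, t) + \<alpha> * x * (exp ((1 - \<alpha>) * t) * Dx u z) + exp ((2 - 2 * \<alpha>) * t) * Dt u z))) (at (x, t))"
proof -
  define g where "g = (\<lambda>y::real \<times> real. (exp (\<alpha> * snd y) * fst y, exp (snd y)))"
  have "z \<in> UNIV \<times> {t0<..}" using exp_gt_t0[OF t] by (simp add: z_def)
  then have "(u has_derivative (\<lambda>(h, k). h * Dx u z + k * Dt u z)) (at (g (x, t)))"
    using Ck_on_1_has_derivative[OF u_C1] by (simp add: g_def z_def)
  moreover have "(g has_derivative (\<lambda>y. (exp (\<alpha> * t) * fst y + \<alpha> * exp (\<alpha> * t) * x * snd y, exp t * snd y))) (at (x, t))"
    unfolding g_def by (auto intro!: derivative_eq_intros simp: fun_eq_iff algebra_simps)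
  ultimately have "((\<lambda>y. u (g y)) has_derivative
      (\<lambda>y. (exp (\<alpha> * t) * fst y + \<alpha> * exp (\<alpha> * t) * x * snd y) * Dx u z + exp t * snd y * Dt u z)) (at (x, t))"
    using has_derivative_compose by fastforce
  moreover have "((\<lambda>y::real \<times> real. exp ((1 - 2 * \<alpha>) * snd y)) has_derivative
      (\<lambda>y. (1 - 2 * \<alpha>) * exp ((1 - 2 * \<alpha>) * t) * snd y)) (at (x, t))"
    by (auto intro!: derivative_eq_intros simp: fun_eq_iff algebra_simps)
  ultimately have D: "((\<lambda>y. exp ((1 - 2 * \<alpha>) * snd y) * u (g y)) has_derivative
     (\<lambda>y. exp ((1 - 2 * \<alpha>) * t) * ((exp (\<alpha> * t) * fst y + \<alpha> * exp (\<alpha> * t) * x * snd y) * Dx u z + exp t * snd y * Dt u z) +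
       (1 - 2 * \<alpha>) * exp ((1 - 2 * \<alpha>) * t) * snd y * u z)) (at (x, t))"
    using has_derivative_mult by (fastforce simp: g_def z_def)
  have v: "(\<lambda>y. exp ((1 - 2 * \<alpha>) * snd y) * u (g y)) = v"
    by (auto simp: fun_eq_iff v_eq g_def)
  show ?thesis
  proof (rule has_derivative_eq_rhs[OF D[unfolded v]])
    have e1: "exp ((1 - 2 * \<alpha>) * t) * exp (\<alpha> * t) = exp ((1 - \<alpha>) * t)"
      and e2: "exp ((1 - 2 * \<alpha>) * t) * exp t = exp ((2 - 2 * \<alpha>) * t)"
      by (simp_all add: algebra_simps flip: exp_add)
    show "(\<lambda>y. exp ((1 - 2 * \<alpha>) * t) * ((exp (\<alpha> * t) * fst y + \<alpha> * exp (\<alpha> * t) * x * snd y) * Dx u z + exp t * snd y * Dt u z) +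
       (1 - 2 * \<alpha>) * exp ((1 - 2 * \<alpha>) * t) * snd y * u z) = (\<lambda>(h, k). h * (exp ((1 - \<alpha>) * t) * Dx u z) +
    k * ((1 - 2 * \<alpha>) * v (x, t) + \<alpha> * x * (exp ((1 - \<alpha>) * t) * Dx u z) + exp ((2 - 2 * \<alpha>) * t) * Dt u z))"
      unfolding e1[symmetric] e2[symmetric] by (auto simp: fun_eq_iff v_eq z_def algebra_simps)
  qed
qed

lemmas v_partial = has_derivative_imp_partial_deriv[OF v_has_derivative]

lemma vx_cont: "continuous_on (UNIV \<times> {\<tau>0<..}) (Dx v)"
proof -
  have "continuous_on (UNIV \<times> {\<tau>0<..}) (\<lambda>z. exp ((1 - \<alpha>) * snd z) * Dx u (exp (\<alpha> * snd z) * fst z, exp (snd z)))"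
    by (intro continuous_intros continuous_on_compose2[OF Ck_on_1_partial_cont(1)[OF u_C1]])
       (auto simp: exp_gt_t0)
  then show ?thesis
    by (rule continuous_on_cong[THEN iffD1, rotated -1]) (auto simp: v_partial)
qed

lemma rescaled_hj:
  assumes t: "t > \<tau>0"
  shows "\<mu> (x, t) powr \<theta> = - Dt v (x, t) + 1 / 2 * (Dx v (x, t))\<^sup>2 + \<alpha> * x * Dx v (x, t) + (1 - 2 * \<alpha>) * v (x, t)"
proof -
  define z where "z = (exp (\<alpha> * t) * x, exp t)"
  have "\<mu> (x, t) powr \<theta> = exp ((\<alpha> * \<theta>) * t) * m z powr \<theta>"
    using m_nonneg[of "exp t"] exp_gt_t0[OF t] by (simp add: mu_eq z_def powr_mult exp_powr_real mult_ac)
  also have "\<dots> = exp ((2 - 2 * \<alpha>) * t) * (- Dt u z + 1 / 2 * (Dx u z)\<^sup>2)"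
    using hj[OF exp_gt_t0[OF t], of "exp (\<alpha> * t) * x"] by (simp add: alpha(3) z_def)
  also have "exp ((2 - 2 * \<alpha>) * t) * (- Dt u z + 1 / 2 * (Dx u z)\<^sup>2) =
      - (exp ((2 - 2 * \<alpha>) * t) * Dt u z) + 1 / 2 * (exp ((1 - \<alpha>) * t) * Dx u z)\<^sup>2"
    by (simp add: algebra_simps power2_eq_square flip: exp_add)
  finally show ?thesis using v_partial[OF t, of x] by (simp add: z_def algebra_simps)
qed

lemma rescaled_transport:
  assumes \<tau>: "\<tau> > \<tau>0"
  shows "((\<lambda>\<tau>. integral {- R..\<eta>} (\<lambda>s. \<mu> (s, \<tau>))) has_real_derivative
    \<mu> (\<eta>, \<tau>) * (Dx v (\<eta>, \<tau>) + \<alpha> * \<eta>)) (at \<tau>)"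
proof (cases "\<eta> < - R")
  case True
  then have "\<mu> (\<eta>, \<tau>) = 0" using \<tau> R_pos by (intro mu_zero) auto
  then show ?thesis using True by simp
next
  case False
  \<comment> \<open>One unit of rescaled time beyond \<tau>, so that a single L serves a whole
    neighbourhood of \<tau>. The chain rule is then applied to \<open>cum L\<close> along the curve
    (exp (\<alpha> * \<tau>) * \<eta>, exp \<tau>): the moving endpoint contributes \<alpha> *
    \<eta> and the flux contributes Dx v.\<close>
  define T where "T = exp (\<tau> + 1)"
  define L where "L = R * T powr \<alpha> + 1"
  define z where "z = (exp (\<alpha> * \<tau>) * \<eta>, exp \<tau>)"
  have T: "exp \<tau> < T" "T powr \<alpha> = exp (\<alpha> * (\<tau> + 1))" by (auto simp: T_def exp_powr_real mult.commute)
  have mono: "R * exp (\<alpha> * s) < L" if "s < \<tau> + 1" for s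
  proof -
    have "R * exp (\<alpha> * s) \<le> R * exp (\<alpha> * (\<tau> + 1))"
      using that R_pos alpha by (intro mult_left_mono) auto
    then show ?thesis by (simp add: L_def T(2))
  qed
  have "exp (\<alpha> * \<tau>) * - R \<le> exp (\<alpha> * \<tau>) * \<eta>"
    using False by (intro mult_left_mono) auto
  then have x: "exp (\<alpha> * \<tau>) * \<eta> > - L" using mono[of \<tau>] by (simp add: mult.commute)
  have C: "(cum L has_derivative (\<lambda>(h, k). m z * h + m z * Dx u z * k)) (at z)"
    unfolding z_def by (rule cum_has_derivative[OF exp_gt_t0[OF \<tau>] T(1) x]) (simp add: L_def)
  have g: "((\<lambda>\<tau>. (exp (\<alpha> * \<tau>) * \<eta>, exp \<tau>)) has_derivative (\<lambda>k. (\<alpha> * exp (\<alpha> * \<tau>) * \<eta> * k, exp \<tau> * k))) (at \<tau>)"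
    by (auto intro!: derivative_eq_intros simp: fun_eq_iff algebra_simps)
  have "((\<lambda>\<tau>. cum L (exp (\<alpha> * \<tau>) * \<eta>, exp \<tau>)) has_real_derivative \<mu> (\<eta>, \<tau>) * (Dx v (\<eta>, \<tau>) + \<alpha> * \<eta>)) (at \<tau>)"
    unfolding has_field_derivative_def
  proof (rule has_derivative_eq_rhs[OF has_derivative_compose[OF g C[unfolded z_def]]])
    have e: "exp (\<alpha> * \<tau>) * exp ((1 - \<alpha>) * \<tau>) = exp \<tau>" by (simp add: algebra_simps flip: exp_add)
    have "Dx v (\<eta>, \<tau>) = exp ((1 - \<alpha>) * \<tau>) * Dx u z" using v_partial(1)[OF \<tau>] by (simp add: z_def)
    then have "\<mu> (\<eta>, \<tau>) * (Dx v (\<eta>, \<tau>) + \<alpha> * \<eta>) = m z * (\<alpha> * exp (\<alpha> * \<tau>) * \<eta>) + m z * Dx u z * exp \<tau>"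
      unfolding e[symmetric] by (simp add: mu_eq z_def algebra_simps)
    then show "(\<lambda>k. case (\<alpha> * exp (\<alpha> * \<tau>) * \<eta> * k, exp \<tau> * k) of (h, k) \<Rightarrow>
        m (exp (\<alpha> * \<tau>) * \<eta>, exp \<tau>) * h + m (exp (\<alpha> * \<tau>) * \<eta>, exp \<tau>) * Dx u (exp (\<alpha> * \<tau>) * \<eta>, exp \<tau>) * k) =
        (*) (\<mu> (\<eta>, \<tau>) * (Dx v (\<eta>, \<tau>) + \<alpha> * \<eta>))"
      by (simp add: fun_eq_iff z_def algebra_simps)
  qed
  then show ?thesis
  proof (rule has_field_derivative_transform_within_open[where S = "{\<tau>0<..<\<tau> + 1}"])
    fix s assume "s \<in> {\<tau>0<..<\<tau> + 1}"
    then show "cum L (exp (\<alpha> * s) * \<eta>, exp s) = integral {- R..\<eta>} (\<lambda>s'. \<mu> (s', s))"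
      using False mono[of s] by (subst rescaled_cdf_eq[of s \<eta> L]) auto
  qed (use \<tau> in auto)
qed

lemma rescaled_mass:
  assumes \<tau>: "\<tau> > \<tau>0"
  shows "integral {- R..R} (\<lambda>s. \<mu> (s, \<tau>)) = a"
proof -
  define E where "E = exp (\<alpha> * \<tau>)"
  define L where "L = R * E + 1"
  have E: "E > 0" "exp \<tau> powr \<alpha> = E" by (auto simp: E_def exp_powr_real mult.commute)
  have L: "L > R * E" "L > 0" using R_pos E(1) by (auto simp: L_def add_pos_pos)
  note t = exp_gt_t0[OF \<tau>]
  have "integral {- R..R} (\<lambda>s. \<mu> (s, \<tau>)) = integral {- L..E * R} (\<lambda>x. m (x, exp \<tau>))"
    using rescaled_cdf_eq[OF \<tau>, of R L] L R_pos by (simp add: E_def cum_def)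
  moreover have "integral {E * R..L} (\<lambda>x. m (x, exp \<tau>)) = integral {E * R..L} (\<lambda>x. 0)"
  proof (rule integral_spike[of "{E * R}"])
    fix s assume "s \<in> {E * R..L} - {E * R}"
    then have "R * E < \<bar>s\<bar>" by (auto simp: mult.commute)
    then show "0 = m (s, exp \<tau>)" using m_zero[of "exp \<tau>" s] t E(2) by simp
  qed auto
  moreover have "integral {- L..E * R} (\<lambda>x. m (x, exp \<tau>)) + integral {E * R..L} (\<lambda>x. m (x, exp \<tau>)) = integral {- L..L} (\<lambda>x. m (x, exp \<tau>))"
  proof (rule Henstock_Kurzweil_Integration.integral_combine)
    have "0 < E * R" using E(1) R_pos by simp
    then show "- L \<le> E * R" using L(2) by linarith
    show "E * R \<le> L" using L(1) by (simp add: mult.commute)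
  qed (use m_integrable t in simp)
  moreover have "integral {- L..L} (\<lambda>x. m (x, exp \<tau>)) = a"
    by (rule mass[OF t]) (simp add: E(2) L)
  ultimately show ?thesis by simp
qed

lemma rescaled_interval:
  assumes \<tau>: "\<tau> > \<tau>0"
  shows "\<exists>l r. {\<eta>. \<mu> (\<eta>, \<tau>) > 0} = {l<..<r}"
proof -
  define E where "E = exp (\<alpha> * \<tau>)"
  have E: "E > 0" by (simp add: E_def)
  obtain l r where lr: "{x. m (x, exp \<tau>) > 0} = {l<..<r}" using m_interval[OF exp_gt_t0[OF \<tau>]] by blast
  have "\<mu> (\<eta>, \<tau>) > 0 \<longleftrightarrow> E * \<eta> \<in> {x. m (x, exp \<tau>) > 0}" for \<eta>
    by (simp add: mu_eq E_def zero_less_mult_iff)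
  then have "\<mu> (\<eta>, \<tau>) > 0 \<longleftrightarrow> \<eta> \<in> {l / E<..<r / E}" for \<eta>
    unfolding lr using E by (simp add: pos_divide_less_eq pos_less_divide_eq mult.commute[of E])
  then have "{\<eta>. \<mu> (\<eta>, \<tau>) > 0} = {l / E<..<r / E}" by blast
  then show ?thesis by blast
qed

lemma mu_nonneg: "\<tau> > \<tau>0 \<Longrightarrow> \<mu> (\<eta>, \<tau>) \<ge> 0"
  using m_nonneg exp_gt_t0 by (simp add: mu_eq less_imp_le)

abbreviation "pos_set \<equiv> {y \<in> UNIV \<times> {\<tau>0<..}. \<mu> y > 0}"

lemma open_pos_set: "open pos_set"
proof -
  have "open ((UNIV \<times> {\<tau>0<..}) \<inter> \<mu> -` {0<..})"
    by (rule continuous_open_preimage[OF uniformly_continuous_imp_continuous[OF mu_uc]]) (auto intro: open_Times)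
  also have "(UNIV \<times> {\<tau>0<..}) \<inter> \<mu> -` {0<..} = pos_set" by auto
  finally show ?thesis .
qed

lemma vx_C1: "Ck_on 1 pos_set (Dx v)" and vt_C1: "Ck_on 1 pos_set (Dt v)"
  using Dv_C1 by (auto simp: Basis_real_prod simp del: Ck_on.simps)

text \<open>The rescaled Hamilton-Jacobi equation is differentiated in \<eta>, which is legitimate
  on the positivity set because both partial derivatives of v are C^1 there. Mixed partials replace
  Dx (Dt v) by the time derivative of Dx v. Rewriting with p = Dx v + \<alpha> * \<eta> leaves the
  linear term -\<alpha> (1 - \<alpha>) \<eta>, the force that confines the mass and is balanced by
  the pressure in the profile.\<close>

lemma rescaled_momentum:
  assumes \<tau>: "\<tau> > \<tau>0" and pos: "\<mu> (\<eta>, \<tau>) > 0"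
  shows "((\<lambda>s. \<mu> (s, \<tau>) powr \<theta>) has_real_derivative
      (Dx v (\<eta>, \<tau>) + \<alpha> * \<eta>) * (Dx (Dx v) (\<eta>, \<tau>) + \<alpha>) - Dt (Dx v) (\<eta>, \<tau>) +
      (1 - 2 * \<alpha>) * (Dx v (\<eta>, \<tau>) + \<alpha> * \<eta>) - \<alpha> * (1 - \<alpha>) * \<eta>) (at \<eta>)"
proof -
  have inS: "(\<eta>, \<tau>) \<in> pos_set" using \<tau> pos by simp
  have mixed: "Dt (Dx v) (\<eta>, \<tau>) = Dx (Dt v) (\<eta>, \<tau>)"
  proof (rule mixed_partials_eq[OF open_pos_set inS, where f = v and fx = "Dx v" and ft = "Dt v"])
    fix x t assume xt: "(x, t) \<in> pos_set"
    then have t: "t > \<tau>0" by simp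
    have v': "(v has_derivative (\<lambda>(h, k). h * Dx v (x, t) + k * Dt v (x, t))) (at (x, t))"
      using v_has_derivative[OF t, of x] v_partial[OF t, of x] by simp
    show "((\<lambda>x. v (x, t)) has_real_derivative Dx v (x, t)) (at x)"
      "((\<lambda>t. v (x, t)) has_real_derivative Dt v (x, t)) (at t)"
      by (rule has_derivative_imp_real_derivative_slices[OF v'])+
    show "((\<lambda>t. Dx v (x, t)) has_real_derivative Dt (Dx v) (x, t)) (at t)"
      by (rule has_derivative_imp_real_derivative_slices(2)[OF Ck_on_1_has_derivative[OF vx_C1 xt]])
    show "((\<lambda>x. Dt v (x, t)) has_real_derivative Dx (Dt v) (x, t)) (at x)"
      by (rule has_derivative_imp_real_derivative_slices(1)[OF Ck_on_1_has_derivative[OF vt_C1 xt]])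
  qed (rule Ck_on_1_partial_cont[OF vx_C1] Ck_on_1_partial_cont[OF vt_C1])+
  have v': "(v has_derivative (\<lambda>(h, k). h * Dx v (\<eta>, \<tau>) + k * Dt v (\<eta>, \<tau>))) (at (\<eta>, \<tau>))"
    using v_has_derivative[OF \<tau>, of \<eta>] v_partial[OF \<tau>, of \<eta>] by simp
  note d1 = has_derivative_imp_real_derivative_slices(1)[OF v']
  note d2 = has_derivative_imp_real_derivative_slices(1)[OF Ck_on_1_has_derivative[OF vx_C1 inS]]
  note d3 = has_derivative_imp_real_derivative_slices(1)[OF Ck_on_1_has_derivative[OF vt_C1 inS]]
  have "((\<lambda>s. - Dt v (s, \<tau>) + 1 / 2 * (Dx v (s, \<tau>))\<^sup>2 + \<alpha> * s * Dx v (s, \<tau>) + (1 - 2 * \<alpha>) * v (s, \<tau>)) has_real_derivative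
      - Dx (Dt v) (\<eta>, \<tau>) + Dx v (\<eta>, \<tau>) * Dx (Dx v) (\<eta>, \<tau>) +
      (\<alpha> * Dx v (\<eta>, \<tau>) + \<alpha> * \<eta> * Dx (Dx v) (\<eta>, \<tau>)) + (1 - 2 * \<alpha>) * Dx v (\<eta>, \<tau>)) (at \<eta>)"
    by (rule derivative_eq_intros d1 d2 d3 refl | simp)+
  then show ?thesis
    unfolding rescaled_hj[OF \<tau>] by (rule DERIV_cong) (simp add: mixed algebra_simps)
qed

lemma flow: "rescaled_flow \<alpha> \<theta> a R \<tau>0 \<mu> (\<lambda>z. Dx v z + \<alpha> * fst z) (\<lambda>z. Dx (Dx v) z + \<alpha>) (Dt (Dx v))"
proof (rule rescaled_flow.intro, goal_cases)
  case (10 x t)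
  then have "(x, t) \<in> pos_set" by simp
  from has_derivative_add[OF Ck_on_1_has_derivative[OF vx_C1 this]
      has_derivative_mult_right[OF has_derivative_fst[OF has_derivative_ident], of \<alpha>]]
  show ?case by (rule has_derivative_eq_rhs) (simp add: fun_eq_iff case_prod_unfold algebra_simps)
next
  case 11
  have eq: "{z. snd z > \<tau>0 \<and> \<mu> z > 0} = pos_set" by auto
  show ?case unfolding eq by (intro continuous_intros Ck_on_1_partial_cont[OF vx_C1])
next
  case 12
  have eq: "{z. snd z > \<tau>0 \<and> \<mu> z > 0} = pos_set" by auto
  show ?case unfolding eq by (rule Ck_on_1_partial_cont[OF vx_C1])
next
  case (13 x t)
  then show ?case using rescaled_momentum by simp
next
  case (8 x t)
  then show ?case using rescaled_transport by simp
next
  case 9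
  show ?case by (intro continuous_intros vx_cont)
qed (use theta a_pos mu_uc mu_nonneg mu_zero rescaled_mass rescaled_interval in auto)

section \<open>Uniform limits in the rescaled variables\<close>

lemma mu_le:
  obtains C where "C > 0" "\<And>x t. t > \<tau>0 \<Longrightarrow> \<mu> (x, t) \<le> C"
proof -
  obtain C where C: "\<And>z. z \<in> UNIV \<times> {\<tau>0<..} \<Longrightarrow> norm (\<mu> z) \<le> C"
    using mu_bounded by (auto simp: bounded_iff)
  show ?thesis
  proof (rule that[of "\<bar>C\<bar> + 1"])
    fix x t assume "t > \<tau>0"
    then show "\<mu> (x, t) \<le> \<bar>C\<bar> + 1" using C[of "(x, t)"] by auto
  qed simp
qed

lemma density_limit:
  assumes e: "e > 0"
  shows "\<forall>\<^sub>F t in at_top. \<forall>x. \<bar>\<mu> (x, t) - M_profile \<theta> \<alpha> a x\<bar> \<le> e"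
proof -
  obtain C where C: "C > 0" "\<And>x t. t > \<tau>0 \<Longrightarrow> \<mu> (x, t) \<le> C" by (rule mu_le) blast
  have "\<forall>\<^sub>F t in at_top. \<forall>x. \<bar>\<mu> (x, t) - (case (x, t) of (x, t) \<Rightarrow> M_profile \<theta> \<alpha> a x)\<bar> \<le> e"
    by (rule flow_density_convergence[OF flow profile_flow[OF theta alpha(1,2) a_pos] alpha(1,2) C(2) _ e])
       (auto intro: M_profile_le[OF theta alpha(1,2) a_pos])
  then show ?thesis by simp
qed

text \<open>On the support |x| < R, so a bound B for Dx v gives the bound B + \<alpha> * R for p.
  This starts the exponential decay at t1 = \<tau>0 + 1, a time at which the flow is already
  defined.\<close>

lemma velocity_limit:
  assumes e: "e > 0"
  shows "\<forall>\<^sub>F t in at_top. \<forall>x. \<mu> (x, t) > 0 \<longrightarrow> \<bar>Dx v (x, t) + \<alpha> * x\<bar> \<le> e"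
proof -
  interpret F: rescaled_flow \<alpha> \<theta> a R \<tau>0 \<mu> "\<lambda>z. Dx v z + \<alpha> * fst z" "\<lambda>z. Dx (Dx v) z + \<alpha>" "Dt (Dx v)"
    by (rule flow)
  obtain B where B: "\<And>z. z \<in> {- R<..<R} \<times> {\<tau>0<..} \<Longrightarrow> \<bar>Dx v z\<bar> \<le> B"
    by (rule bounded_of_Lp_norm_infinity[OF vx_bounded])
       (auto intro!: open_Times continuous_on_subset[OF vx_cont])
  define t1 where "t1 = \<tau>0 + 1"
  have t1: "\<tau>0 < t1" by (simp add: t1_def)
  have b: "\<bar>Dx v (x, t) + \<alpha> * x\<bar> \<le> B + \<alpha> * R" if "t \<ge> t1" "\<mu> (x, t) > 0" for x t
  proof -
    have x: "- R < x \<and> x < R" using F.pos_imp_bounds[of t x] that t1 by auto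
    then have "\<bar>Dx v (x, t)\<bar> \<le> B" using that t1 by (intro B) auto
    moreover have "\<bar>x\<bar> \<le> R" using x by linarith
    then have "\<bar>\<alpha> * x\<bar> \<le> \<alpha> * R" using alpha by (simp add: abs_mult)
    ultimately show ?thesis by linarith
  qed
  have "((\<lambda>t. (B + \<alpha> * R) * exp (- \<alpha> * (t - t1))) \<longlongrightarrow> 0) at_top"
    by (rule tendsto_mult_right_zero[OF exp_decay[OF alpha(1)]])
  then have "\<forall>\<^sub>F t in at_top. (B + \<alpha> * R) * exp (- \<alpha> * (t - t1)) < e"
    by (rule order_tendstoD) (rule e)
  then show ?thesis
    using eventually_ge_at_top[of t1]
  proof eventually_elim
    case (elim t)
    show ?case
    proof (intro allI impI)
      fix x assume "\<mu> (x, t) > 0"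
      from F.velocity_decay[OF alpha(1,2) t1 _ elim(2) this, of "B + \<alpha> * R"] b
      show "\<bar>Dx v (x, t) + \<alpha> * x\<bar> \<le> e" using elim(1) by fastforce
    qed
  qed
qed

text \<open>Without the factor \<mu> the bracket need not be small: outside the support of the
  profile it is positive even when \<mu> is tiny. With the factor, the corresponding expression for
  the profile M vanishes identically, either because M does or because the bracket does. It then
  suffices that \<mu> is close to M and that s powr (\<theta> + 1) is uniformly continuous on
  bounded sets.\<close>

lemma pressure_limit:
  assumes e: "e > 0"
  shows "\<forall>\<^sub>F t in at_top. \<forall>x.
    \<bar>\<mu> (x, t) * (\<mu> (x, t) powr \<theta> + \<alpha> * (1 - \<alpha>) / 2 * x\<^sup>2 - R_const \<theta> \<alpha> a)\<bar> \<le> e"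
proof -
  define r where "r = R_const \<theta> \<alpha> a"
  define k where "k = \<alpha> * (1 - \<alpha>) / 2"
  define M where "M = M_profile \<theta> \<alpha> a"
  have r: "r > 0" using R_const_pos[OF theta alpha(1,2) a_pos] by (simp add: r_def)
  have k: "k > 0" using alpha by (simp add: k_def)
  obtain C where C: "C > 0" "\<And>x t. t > \<tau>0 \<Longrightarrow> \<mu> (x, t) \<le> C" by (rule mu_le) blast
  define C' where "C' = max C (r powr (1 / \<theta>))"
  have M: "0 \<le> M x" "M x \<le> C'" for x
    using M_profile_le[OF theta alpha(1,2) a_pos] profile_nonneg[OF theta alpha(1,2)]
    by (auto simp: M_def C'_def r_def M_profile_def le_max_iff_disj)
  have M_eq: "M x * (M x powr \<theta> + k * x\<^sup>2 - r) = 0" for x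
  proof (cases "r - k * x\<^sup>2 \<le> 0")
    case True
    then have "M x = 0" by (simp add: M_def M_profile_def profile_def r_def k_def max_def)
    then show ?thesis by simp
  next
    case False
    then have "M x powr \<theta> = r - k * x\<^sup>2"
      using theta by (simp add: M_def M_profile_def profile_def powr_powr flip: r_def k_def)
    then show ?thesis by simp
  qed
  have "uniformly_continuous_on {0..C'} (\<lambda>s. s powr (\<theta> + 1))"
    by (intro compact_uniformly_continuous continuous_on_powr' continuous_intros) (use theta in auto)
  then obtain d where d: "d > 0" "\<And>s s'. s \<in> {0..C'} \<Longrightarrow> s' \<in> {0..C'} \<Longrightarrow> dist s' s < d \<Longrightarrow>
      dist (s' powr (\<theta> + 1)) (s powr (\<theta> + 1)) < e / 2"
    using half_gt_zero[OF e] unfolding uniformly_continuous_on_def by meson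
  \<comment> \<open>Bounds the absolute value of k * x^2 - r for |x| \<le> R; beyond R the density
    is zero.\<close>
  define K where "K = k * R\<^sup>2 + r"
  have K: "K > 0" using k r by (simp add: K_def add_nonneg_pos)
  define e' where "e' = min (d / 2) (e / 2 / K)"
  have e': "e' > 0" "e' < d" "e' * K \<le> e / 2"
    using d(1) e K by (auto simp: e'_def min_def field_simps)
  show ?thesis
    using density_limit[OF e'(1)] eventually_gt_at_top[of \<tau>0]
  proof eventually_elim
    case (elim t)
    show ?case
      unfolding k_def[symmetric] r_def[symmetric]
    proof
      fix x
      define m1 where "m1 = \<mu> (x, t)"
      have m1: "0 \<le> m1" "m1 \<le> C'" using mu_nonneg[OF elim(2)] C(2)[OF elim(2), of x] by (auto simp: m1_def C'_def)
      have close: "\<bar>m1 - M x\<bar> \<le> e'" using elim(1) by (simp add: m1_def M_def)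
      show "\<bar>\<mu> (x, t) * (\<mu> (x, t) powr \<theta> + k * x\<^sup>2 - r)\<bar> \<le> e"
      proof (cases "\<bar>x\<bar> > R")
        case True
        then show ?thesis using mu_zero[of t x] elim(2) e by simp
      next
        case False
        have pw: "s * s powr \<theta> = s powr (\<theta> + 1)" if "s \<ge> 0" for s :: real
          using that by (simp add: powr_add mult.commute)
        have "m1 * (m1 powr \<theta> + k * x\<^sup>2 - r) =
            (m1 powr (\<theta> + 1) - M x powr (\<theta> + 1)) + (m1 - M x) * (k * x\<^sup>2 - r)"
          using M_eq[of x] pw[OF m1(1)] pw[OF M(1)[of x]] by (simp add: algebra_simps)
        moreover have "\<bar>m1 powr (\<theta> + 1) - M x powr (\<theta> + 1)\<bar> < e / 2"
          using d(2)[of "M x" m1] m1 M[of x] close e'(2) by (simp add: dist_real_def)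
        moreover have "\<bar>(m1 - M x) * (k * x\<^sup>2 - r)\<bar> \<le> e / 2"
        proof -
          have "x\<^sup>2 \<le> R\<^sup>2" using False R_pos by (intro abs_le_square_iff[THEN iffD1]) auto
          then have "k * x\<^sup>2 \<le> k * R\<^sup>2" using k by (intro mult_left_mono) auto
          moreover have "0 \<le> k * x\<^sup>2" using k by simp
          ultimately have "\<bar>k * x\<^sup>2 - r\<bar> \<le> K" using r by (auto simp: K_def abs_le_iff)
          then have "\<bar>m1 - M x\<bar> * \<bar>k * x\<^sup>2 - r\<bar> \<le> e' * K"
            using close e'(1) by (intro mult_mono) auto
          then show ?thesis using e'(3) by (simp add: abs_mult)
        qed
        ultimately show ?thesis unfolding m1_def[symmetric] by linarith
      qed
    qed
  qed
qed

section \<open>Return to the original variables\<close>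

lemma eventually_at_ln:
  "eventually P at_top \<Longrightarrow> \<forall>\<^sub>F t in at_top. t > t0 \<and> P (ln t)"
  by (rule eventually_conj[OF eventually_gt_at_top eventually_compose_filterlim[OF _ ln_at_top]])

lemma m_unscale:
  assumes "t > t0"
  shows "m (x, t) = t powr (- \<alpha>) * \<mu> (x / t powr \<alpha>, ln t)"
  using assms t0 by (simp add: rescaled_m_def powr_minus field_simps)

lemma ux_unscale:
  assumes t: "t > t0"
  shows "Dx u (x, t) = t powr (\<alpha> - 1) * Dx v (x / t powr \<alpha>, ln t)"
proof -
  have t': "t > 0" "ln t > \<tau>0" using t t0 by auto
  have e: "exp (\<alpha> * ln t) = t powr \<alpha>" "exp ((1 - \<alpha>) * ln t) = t powr (1 - \<alpha>)"
    using t' by (simp_all add: powr_def)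
  have "t powr (\<alpha> - 1) * Dx v (x / t powr \<alpha>, ln t) = (t powr (\<alpha> - 1) * t powr (1 - \<alpha>)) * Dx u (x, t)"
    using v_partial(1)[OF t'(2), of "x / t powr \<alpha>"] t' by (simp add: e)
  also have "t powr (\<alpha> - 1) * t powr (1 - \<alpha>) = 1"
    using t' by (simp flip: powr_add)
  finally show ?thesis by simp
qed

end

text \<open>For t > 0 the powers of t cancel and \<open>selfsim_U\<close> is -(\<alpha> / 2) * x^2 /
  t + z t, from which both derivatives are read off.\<close>

lemma selfsim_U_partial:
  assumes t: "t > 0" and z: "(z has_real_derivative z') (at t)"
  shows "Dx (selfsim_U \<alpha> z) (x, t) = - \<alpha> * x / t"
    and "Dt (selfsim_U \<alpha> z) (x, t) = \<alpha> * x\<^sup>2 / (2 * t\<^sup>2) + z'"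
proof -
  have "((\<lambda>y. z (snd y)) has_derivative (\<lambda>y. z' * snd y)) (at (x, t))"
    using has_derivative_compose[OF has_derivative_snd[OF has_derivative_ident], of z "(*) z'" "(x, t)"] z
    by (simp add: has_field_derivative_def)
  moreover have "((\<lambda>y::real \<times> real. - (\<alpha> / 2) * ((fst y)\<^sup>2 / snd y)) has_derivative
      (\<lambda>(h, k). h * (- \<alpha> * x / t) + k * (\<alpha> * x\<^sup>2 / (2 * t\<^sup>2)))) (at (x, t))"
    using t by (auto intro!: derivative_eq_intros simp: fun_eq_iff field_simps power2_eq_square)
  ultimately have "((\<lambda>y. - (\<alpha> / 2) * ((fst y)\<^sup>2 / snd y) + z (snd y)) has_derivative
      (\<lambda>y. (case y of (h, k) \<Rightarrow> h * (- \<alpha> * x / t) + k * (\<alpha> * x\<^sup>2 / (2 * t\<^sup>2))) + z' * snd y)) (at (x, t))"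
    by (rule has_derivative_add[rotated])
  then have "(selfsim_U \<alpha> z has_derivative
      (\<lambda>y. (case y of (h, k) \<Rightarrow> h * (- \<alpha> * x / t) + k * (\<alpha> * x\<^sup>2 / (2 * t\<^sup>2))) + z' * snd y)) (at (x, t))"
  proof (rule has_derivative_transform_within_open[where s = "UNIV \<times> {0<..}"])
    fix y :: "real \<times> real" assume "y \<in> UNIV \<times> {0<..}"
    then have s: "snd y > 0" by auto
    have "snd y powr (2 * \<alpha> - 1) / (snd y powr \<alpha>)\<^sup>2 = 1 / snd y"
      using s by (simp add: powr_diff powr_power field_simps)
    moreover have "snd y powr (2 * \<alpha> - 1) * (fst y / snd y powr \<alpha>)\<^sup>2 =
        snd y powr (2 * \<alpha> - 1) / (snd y powr \<alpha>)\<^sup>2 * (fst y)\<^sup>2"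
      by (simp add: power_divide)
    ultimately have eq: "snd y powr (2 * \<alpha> - 1) * (fst y / snd y powr \<alpha>)\<^sup>2 = (fst y)\<^sup>2 / snd y"
      by simp
    have "selfsim_U \<alpha> z y =
        - (\<alpha> / 2) * (snd y powr (2 * \<alpha> - 1) * (fst y / snd y powr \<alpha>)\<^sup>2) + z (snd y)"
      by (simp only: selfsim_U_def U_profile_def case_prod_unfold mult.left_commute)
    then show "- (\<alpha> / 2) * ((fst y)\<^sup>2 / snd y) + z (snd y) = selfsim_U \<alpha> z y"
      by (simp only: eq)
  qed (use t in \<open>auto intro: open_Times\<close>)
  then have "(selfsim_U \<alpha> z has_derivative
      (\<lambda>(h, k). h * (- \<alpha> * x / t) + k * (\<alpha> * x\<^sup>2 / (2 * t\<^sup>2) + z'))) (at (x, t))"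
    by (rule has_derivative_eq_rhs) (auto simp: fun_eq_iff algebra_simps)
  from has_derivative_imp_partial_deriv[OF this]
  show "Dx (selfsim_U \<alpha> z) (x, t) = - \<alpha> * x / t"
    "Dt (selfsim_U \<alpha> z) (x, t) = \<alpha> * x\<^sup>2 / (2 * t\<^sup>2) + z'" by auto
qed

section \<open>The three convergence statements in L^p\<close>

context mfg_solution
begin

lemma Du_cont_slice:
  assumes "t > t0"
  shows "continuous_on UNIV (\<lambda>x. Dx u (x, t))" "continuous_on UNIV (\<lambda>x. Dt u (x, t))"
  by (auto intro!: continuous_on_compose2[OF Ck_on_1_partial_cont(1)[OF u_C1]]
      continuous_on_compose2[OF Ck_on_1_partial_cont(2)[OF u_C1]] continuous_intros simp: assms)

lemma density_convergence:
  assumes p: "1 \<le> p"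
  shows "((\<lambda>t. ennreal (t powr (\<alpha> * (1 - enn2real (1 / p)))) *
             Lp_norm p lebesgue (\<lambda>x. m (x, t) - selfsim_M \<theta> \<alpha> a (x, t))) \<longlongrightarrow> 0) at_top"
proof -
  define r where "r = R_const \<theta> \<alpha> a"
  have r: "r > 0" using R_const_pos[OF theta alpha(1,2) a_pos] by (simp add: r_def)
  \<comment> \<open>The support of the rescaled density is bounded by R, that of the profile by its
    own radius; the constant \<open>R_const\<close> bounding R from below is not this radius, so the
    larger of the two is taken.\<close>
  define L where "L = max R (sqrt (2 * r / (\<alpha> * (1 - \<alpha>))))"
  have L: "L > 0" using R_pos by (simp add: L_def)
  show ?thesis
  proof (rule scaled_Lp_norm_tendsto_zero[OF p L, where \<gamma> = \<alpha> and \<alpha> = \<alpha> and ?t0.0 = t0])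
    fix t assume t: "t > t0"
    then have t': "t > 0" "t \<ge> t0" using t0 by auto
    have "continuous_on UNIV (\<lambda>x. M_profile \<theta> \<alpha> a (x / t powr \<alpha>))"
      unfolding M_profile_def
      by (rule continuous_on_compose2[OF profile_cont[OF theta alpha(1,2)]])
         (use t' in \<open>auto intro!: continuous_intros\<close>)
    then show "continuous_on UNIV (\<lambda>x. m (x, t) - selfsim_M \<theta> \<alpha> a (x, t))"
      unfolding selfsim_M_def case_prod_conv by (intro continuous_intros m_cont_slice t'(2))
    fix x assume x: "L * t powr \<alpha> < \<bar>x\<bar>"
    have \<eta>: "\<bar>x / t powr \<alpha>\<bar> > L" using x t' by (simp add: abs_divide pos_less_divide_eq)
    have "\<mu> (x / t powr \<alpha>, ln t) = 0" using \<eta> t' t0 by (intro mu_zero) (auto simp: L_def)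
    moreover have "M_profile \<theta> \<alpha> a (x / t powr \<alpha>) = 0"
      unfolding M_profile_def using \<eta> r
      by (intro profile_zero[OF theta alpha(1,2)]) (auto simp: L_def simp flip: r_def)
    ultimately show "m (x, t) - selfsim_M \<theta> \<alpha> a (x, t) = 0"
      using m_unscale[OF t, of x] by (simp add: selfsim_M_def)
  next
    fix e :: real assume e: "e > 0"
    show "\<forall>\<^sub>F t in at_top. \<forall>x. \<bar>m (x, t) - selfsim_M \<theta> \<alpha> a (x, t)\<bar> \<le> t powr (- \<alpha>) * e"
      using eventually_at_ln[OF density_limit[OF e]]
    proof eventually_elim
      case (elim t)
      have diff: "m (x, t) - selfsim_M \<theta> \<alpha> a (x, t) =
          t powr (- \<alpha>) * (\<mu> (x / t powr \<alpha>, ln t) - M_profile \<theta> \<alpha> a (x / t powr \<alpha>))" for x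
        using m_unscale[of t x] elim by (simp add: selfsim_M_def algebra_simps)
      show ?case unfolding diff abs_mult using elim by (auto intro!: mult_mono)
    qed
  qed (simp add: algebra_simps)
qed

text \<open>The difference of the two space derivatives is t powr (\<alpha> - 1) times p at the
  rescaled point. Squared and multiplied by m it becomes t powr (-(2 - \<alpha>)) * \<mu> * p^2,
  where \<mu> is bounded and p is uniformly small on the support.\<close>

lemma momentum_convergence:
  assumes p: "1 \<le> p" and z: "\<And>t. t > 0 \<Longrightarrow> (z has_real_derivative z' t) (at t)"
  shows "((\<lambda>t. ennreal (t powr (2 - \<alpha> * (1 + enn2real (1 / p)))) *
             Lp_norm p lebesgue (\<lambda>x. m (x, t) * \<bar>Dx u (x, t) - Dx (selfsim_U \<alpha> z) (x, t)\<bar>\<^sup>2)) \<longlongrightarrow> 0) at_top"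
proof -
  have U: "Dx (selfsim_U \<alpha> z) (x, t) = - \<alpha> * x / t" if "t > 0" for x t
    by (rule selfsim_U_partial(1)[OF that z[OF that]])
  show ?thesis
proof (rule scaled_Lp_norm_tendsto_zero[OF p R_pos, where \<gamma> = "2 - \<alpha>" and \<alpha> = \<alpha> and ?t0.0 = t0])
  fix e :: real assume e: "e > 0"
  obtain C where C: "C > 0" "\<And>\<eta> \<tau>. \<tau> > \<tau>0 \<Longrightarrow> \<mu> (\<eta>, \<tau>) \<le> C" by (rule mu_le) blast
  define e' where "e' = sqrt (e / C)"
  have e': "e' > 0" "C * e'\<^sup>2 = e" using e C(1) by (auto simp: e'_def)
  show "\<forall>\<^sub>F t in at_top. \<forall>x. \<bar>m (x, t) * \<bar>Dx u (x, t) - Dx (selfsim_U \<alpha> z) (x, t)\<bar>\<^sup>2\<bar> \<le> t powr (- (2 - \<alpha>)) * e"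
    using eventually_at_ln[OF velocity_limit[OF e'(1)]]
  proof eventually_elim
    case (elim t)
    have t: "t > 0" "t \<ge> t0" "ln t > \<tau>0" using elim t0 by auto
    have eq: "m (x, t) * \<bar>Dx u (x, t) - Dx (selfsim_U \<alpha> z) (x, t)\<bar>\<^sup>2 =
        t powr (- (2 - \<alpha>)) * (\<mu> (x / t powr \<alpha>, ln t) * (Dx v (x / t powr \<alpha>, ln t) + \<alpha> * (x / t powr \<alpha>))\<^sup>2)" for x
    proof -
      have "\<alpha> * x / t = t powr (\<alpha> - 1) * (\<alpha> * (x / t powr \<alpha>))" using t(1) by (simp add: powr_diff)
      then have "Dx u (x, t) - Dx (selfsim_U \<alpha> z) (x, t) =
          t powr (\<alpha> - 1) * (Dx v (x / t powr \<alpha>, ln t) + \<alpha> * (x / t powr \<alpha>))"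
        using ux_unscale[of t x] elim by (simp add: U[OF t(1)] algebra_simps)
      moreover have "t powr (- \<alpha>) * (t powr (\<alpha> - 1))\<^sup>2 = t powr (- (2 - \<alpha>))"
        using t(1) by (simp add: power2_eq_square flip: powr_add)
      ultimately show ?thesis
        using m_unscale[of t x] elim by (simp add: power_mult_distrib mult_ac)
    qed
    show ?case
    proof
      fix x
      define m1 p1 where "m1 = \<mu> (x / t powr \<alpha>, ln t)"
        and "p1 = Dx v (x / t powr \<alpha>, ln t) + \<alpha> * (x / t powr \<alpha>)"
      have m1: "0 \<le> m1" "m1 \<le> C" using mu_nonneg[OF t(3)] C(2)[OF t(3)] by (auto simp: m1_def)
      have "m1 * p1\<^sup>2 \<le> e"
      proof (cases "m1 = 0")
        case False
        then have "m1 > 0" using m1 by simp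
        then have "\<bar>p1\<bar> \<le> e'"
          unfolding m1_def p1_def by (rule elim[THEN conjunct2, rule_format])
        then have "p1\<^sup>2 \<le> e'\<^sup>2" using e'(1) by (intro abs_le_square_iff[THEN iffD1]) auto
        then have "m1 * p1\<^sup>2 \<le> C * e'\<^sup>2" using m1 C(1) by (intro mult_mono) auto
        then show ?thesis using e'(2) by simp
      qed (use e in simp)
      then show "\<bar>m (x, t) * \<bar>Dx u (x, t) - Dx (selfsim_U \<alpha> z) (x, t)\<bar>\<^sup>2\<bar> \<le> t powr (- (2 - \<alpha>)) * e"
        unfolding eq m1_def[symmetric] p1_def[symmetric] abs_mult using m1 by (intro mult_mono) auto
    qed
  qed
next
  fix t assume t: "t > t0"
  then have t': "t > 0" "t \<ge> t0" using t0 by auto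
  show "continuous_on UNIV (\<lambda>x. m (x, t) * \<bar>Dx u (x, t) - Dx (selfsim_U \<alpha> z) (x, t)\<bar>\<^sup>2)"
    unfolding U[OF t'(1)] using t t' by (intro continuous_intros m_cont_slice Du_cont_slice) auto
  show "m (x, t) * \<bar>Dx u (x, t) - Dx (selfsim_U \<alpha> z) (x, t)\<bar>\<^sup>2 = 0" if "R * t powr \<alpha> < \<bar>x\<bar>" for x
    using m_zero[OF t'(2) that] by simp
qed (simp add: algebra_simps)
qed

text \<open>Expressing Dt u by the Hamilton-Jacobi equation, the difference of the time derivatives
  equals t powr (2\<alpha> - 2) times p^2 / 2 - \<alpha> * \<eta> * p - q, with q the bracket of
  \<open>pressure_limit\<close>. The first two terms are small by the velocity limit; q is small
  only after multiplication by \<mu>, which is what the weight m provides.\<close>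

lemma time_derivative_convergence:
  assumes p: "1 \<le> p"
    and z: "\<And>t. t > 0 \<Longrightarrow> (z has_real_derivative - R_const \<theta> \<alpha> a * t powr (2 * \<alpha> - 2)) (at t)"
  shows "((\<lambda>t. ennreal (t powr (2 - \<alpha> * (1 + enn2real (1 / p)))) *
             Lp_norm p lebesgue (\<lambda>x. m (x, t) * \<bar>Dt u (x, t) - Dt (selfsim_U \<alpha> z) (x, t)\<bar>)) \<longlongrightarrow> 0) at_top"
proof -
  have U: "Dt (selfsim_U \<alpha> z) (x, t) = \<alpha> * x\<^sup>2 / (2 * t\<^sup>2) + - R_const \<theta> \<alpha> a * t powr (2 * \<alpha> - 2)" if "t > 0" for x t
    by (rule selfsim_U_partial(2)[OF that z[OF that]])
  show ?thesis
proof (rule scaled_Lp_norm_tendsto_zero[OF p R_pos, where \<gamma> = "2 - \<alpha>" and \<alpha> = \<alpha> and ?t0.0 = t0])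
  fix e :: real assume e: "e > 0"
  define r where "r = R_const \<theta> \<alpha> a"
  define k where "k = \<alpha> * (1 - \<alpha>) / 2"
  obtain C where C: "C > 0" "\<And>\<eta> \<tau>. \<tau> > \<tau>0 \<Longrightarrow> \<mu> (\<eta>, \<tau>) \<le> C" by (rule mu_le) blast
  define K where "K = C * (1 + \<alpha> * R)"
  have K: "K > 0" using C(1) alpha R_pos by (simp add: K_def add_pos_pos)
  \<comment> \<open>The cap at 1 gives p1^2 \<le> e', so that p1^2 / 2 and \<alpha> * \<eta> * p1
    are both linear in e' and K absorbs their constants.\<close>
  define e' where "e' = min 1 (e / 2 / K)"
  have e': "e' > 0" "e' \<le> 1" "K * e' \<le> e / 2" using e K by (auto simp: e'_def min_def field_simps)
  have e2: "e / 2 > 0" using e by simp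
  show "\<forall>\<^sub>F t in at_top. \<forall>x. \<bar>m (x, t) * \<bar>Dt u (x, t) - Dt (selfsim_U \<alpha> z) (x, t)\<bar>\<bar> \<le> t powr (- (2 - \<alpha>)) * e"
    using eventually_at_ln[OF velocity_limit[OF e'(1)]] eventually_at_ln[OF pressure_limit[OF e2]]
  proof eventually_elim
    case (elim t)
    have t: "t > 0" "t \<ge> t0" "ln t > \<tau>0" "t > t0" using elim t0 by auto
    show ?case
    proof
      fix x
      define \<eta> where "\<eta> = x / t powr \<alpha>"
      define m1 p1 where "m1 = \<mu> (\<eta>, ln t)" and "p1 = Dx v (\<eta>, ln t) + \<alpha> * \<eta>"
      define q where "q = m1 powr \<theta> + k * \<eta>\<^sup>2 - r"
      have m1: "0 \<le> m1" "m1 \<le> C" using mu_nonneg[OF t(3)] C(2)[OF t(3)] by (auto simp: m1_def)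
      have mx: "m (x, t) = t powr (- \<alpha>) * m1"
        using m_unscale[OF t(4), of x] by (simp add: m1_def \<eta>_def)
      have sq: "(t powr (\<alpha> - 1))\<^sup>2 = t powr (2 * \<alpha> - 2)"
        using t(1) by (simp add: power2_eq_square flip: powr_add)
      have x_eq: "x / t = t powr (\<alpha> - 1) * \<eta>" using t(1) by (simp add: \<eta>_def powr_diff)
      have "\<alpha> * x\<^sup>2 / (2 * t\<^sup>2) = \<alpha> / 2 * (x / t)\<^sup>2" by (simp add: power_divide)
      also have "\<dots> = t powr (2 * \<alpha> - 2) * (\<alpha> / 2 * \<eta>\<^sup>2)"
        unfolding x_eq by (simp add: power_mult_distrib sq)
      finally have Ut: "Dt (selfsim_U \<alpha> z) (x, t) = t powr (2 * \<alpha> - 2) * (\<alpha> / 2 * \<eta>\<^sup>2 - r)"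
        unfolding U[OF t(1)] by (simp add: r_def algebra_simps)
      have "m (x, t) powr \<theta> = t powr (2 * \<alpha> - 2) * m1 powr \<theta>"
        using m1(1) alpha(3) by (simp add: mx powr_mult powr_powr)
      moreover have "Dx u (x, t) = t powr (\<alpha> - 1) * (p1 - \<alpha> * \<eta>)"
        using ux_unscale[OF t(4), of x] by (simp add: p1_def \<eta>_def)
      then have "(Dx u (x, t))\<^sup>2 = t powr (2 * \<alpha> - 2) * (p1 - \<alpha> * \<eta>)\<^sup>2"
        by (simp add: power_mult_distrib sq)
      ultimately have ut: "Dt u (x, t) = t powr (2 * \<alpha> - 2) * (1 / 2 * (p1 - \<alpha> * \<eta>)\<^sup>2 - m1 powr \<theta>)"
        using hj[OF t(4), of x] by (simp add: algebra_simps)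
      have "Dt u (x, t) - Dt (selfsim_U \<alpha> z) (x, t) = t powr (2 * \<alpha> - 2) * (1 / 2 * p1\<^sup>2 - \<alpha> * \<eta> * p1 - q)"
        unfolding ut Ut q_def k_def by (simp add: field_simps power2_eq_square)
      moreover have "t powr (- \<alpha>) * t powr (2 * \<alpha> - 2) = t powr (- (2 - \<alpha>))"
        by (simp flip: powr_add)
      ultimately have eq: "m (x, t) * \<bar>Dt u (x, t) - Dt (selfsim_U \<alpha> z) (x, t)\<bar> =
          t powr (- (2 - \<alpha>)) * (m1 * \<bar>1 / 2 * p1\<^sup>2 - \<alpha> * \<eta> * p1 - q\<bar>)"
        by (simp add: mx abs_mult mult_ac)
      have "m1 * \<bar>1 / 2 * p1\<^sup>2 - \<alpha> * \<eta> * p1 - q\<bar> \<le> e"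
      proof (cases "m1 = 0")
        case False
        then have pos: "m1 > 0" using m1 by simp
        then have p1: "\<bar>p1\<bar> \<le> e'"
          unfolding m1_def p1_def by (rule elim(1)[THEN conjunct2, rule_format])
        have "\<bar>\<eta>\<bar> \<le> R" using pos mu_zero[of "ln t" \<eta>] t(3) by (force simp: m1_def)
        then have "\<bar>\<alpha> * \<eta> * p1\<bar> \<le> \<alpha> * R * e'"
          unfolding abs_mult using p1 alpha R_pos by (intro mult_mono) auto
        moreover have "p1\<^sup>2 \<le> e'"
        proof -
          have "\<bar>p1\<bar> * \<bar>p1\<bar> \<le> e' * 1" using p1 e' by (intro mult_mono) auto
          then show ?thesis by (simp add: power2_eq_square flip: abs_mult)
        qed
        moreover have "0 \<le> p1\<^sup>2" by simp
        moreover have "(1 + \<alpha> * R) * e' = e' + \<alpha> * R * e'" by (simp add: algebra_simps)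
        ultimately have "\<bar>1 / 2 * p1\<^sup>2 - \<alpha> * \<eta> * p1\<bar> \<le> (1 + \<alpha> * R) * e'" by linarith
        then have "m1 * \<bar>1 / 2 * p1\<^sup>2 - \<alpha> * \<eta> * p1\<bar> \<le> C * ((1 + \<alpha> * R) * e')"
          using m1 C(1) by (intro mult_mono) auto
        also have "\<dots> \<le> e / 2" using e'(3) by (simp add: K_def mult.assoc)
        finally have 1: "m1 * \<bar>1 / 2 * p1\<^sup>2 - \<alpha> * \<eta> * p1\<bar> \<le> e / 2" .
        have "\<bar>m1 * q\<bar> \<le> e / 2"
          unfolding q_def m1_def k_def r_def by (rule elim(2)[THEN conjunct2, rule_format])
        then have 2: "m1 * \<bar>q\<bar> \<le> e / 2" using m1(1) by (simp add: abs_mult)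
        have "m1 * \<bar>1 / 2 * p1\<^sup>2 - \<alpha> * \<eta> * p1 - q\<bar> \<le> m1 * (\<bar>1 / 2 * p1\<^sup>2 - \<alpha> * \<eta> * p1\<bar> + \<bar>q\<bar>)"
          using m1(1) by (intro mult_left_mono abs_triangle_ineq4)
        then show ?thesis using 1 2 by (simp add: distrib_left)
      qed (use e in simp)
      then show "\<bar>m (x, t) * \<bar>Dt u (x, t) - Dt (selfsim_U \<alpha> z) (x, t)\<bar>\<bar> \<le> t powr (- (2 - \<alpha>)) * e"
        unfolding eq abs_mult using m1 by (intro mult_mono) auto
    qed
  qed
next
  fix t assume t: "t > t0"
  then have t': "t > 0" "t \<ge> t0" using t0 by auto
  show "continuous_on UNIV (\<lambda>x. m (x, t) * \<bar>Dt u (x, t) - Dt (selfsim_U \<alpha> z) (x, t)\<bar>)"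
    unfolding U[OF t'(1)] using t t' by (intro continuous_intros m_cont_slice Du_cont_slice) auto
  show "m (x, t) * \<bar>Dt u (x, t) - Dt (selfsim_U \<alpha> z) (x, t)\<bar> = 0" if "R * t powr \<alpha> < \<bar>x\<bar>" for x
    using m_zero[OF t'(2) that] by simp
qed (simp add: algebra_simps)
qed

end

theorem proposition3p1:
  fixes \<theta> \<alpha> t0 \<tau>0 a \<rho> R :: real
    and u m v \<mu> :: "real \<times> real \<Rightarrow> real"
    and \<gamma>L \<gamma>R z :: "real \<Rightarrow> real"
    and p :: ennreal
  assumes "\<theta> > 0" and "\<alpha> = 2 / (2 + \<theta>)" and "t0 > 0" and "\<tau>0 = ln t0"
    and "Ck_on 1 (UNIV \<times> {t0<..}) u"
    and "continuous_on (UNIV \<times> {t0..}) m"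
    and "\<forall>x. \<forall>t\<ge>t0. m (x, t) \<ge> 0"
    and "\<forall>x. \<forall>t>t0. - Dt u (x, t) + 1 / 2 * (Dx u (x, t))\<^sup>2 = m (x, t) powr \<theta>"
    and "\<forall>\<phi>\<in>test_functions (UNIV \<times> {t0<..}).
           (LINT y|lebesgue_on (UNIV \<times> {t0<..}). - (m y * Dt \<phi> y) + m y * Dx u y * Dx \<phi> y) = 0"
    and "W1inf_loc {t0<..} \<gamma>L" and "W1inf_loc {t0<..} \<gamma>R"
    and "\<forall>t>t0. \<gamma>L t < \<gamma>R t"
    and "\<forall>t>t0. {x. m (x, t) > 0} = {\<gamma>L t<..<\<gamma>R t}"
    and "a = (LINT x|lebesgue. m (x, t0))" and "a > 0"
    and "v = rescaled_u \<alpha> u" and "\<mu> = rescaled_m \<alpha> m"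
    and "bounded (\<mu> ` (UNIV \<times> {\<tau>0<..}))"
    and "uniformly_continuous_on (UNIV \<times> {\<tau>0<..}) \<mu>"
    and "\<rho> > 0"
    and "(SUP \<tau>1\<in>{\<tau>0 + \<rho><..}. H1_norm (UNIV \<times> {\<tau>1 - \<rho><..<\<tau>1 + \<rho>}) (\<lambda>y. \<mu> y powr \<theta>)) < \<infinity>"
    and "R \<ge> R_const \<theta> \<alpha> a"
    and "closure (support_on (UNIV \<times> {\<tau>0..}) \<mu>) \<subseteq> {-R..R} \<times> {\<tau>0..}"
    and "\<forall>b\<in>Basis. Ck_on 1 {y \<in> UNIV \<times> {\<tau>0<..}. \<mu> y > 0} (partial_deriv b v)"
    and "\<forall>b\<in>Basis. Lp_norm \<infinity> (lebesgue_on ({-R<..<R} \<times> {\<tau>0<..})) (partial_deriv b v) < \<infinity>"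
    and "\<forall>t>0. (z has_real_derivative - R_const \<theta> \<alpha> a * t powr (2 * \<alpha> - 2)) (at t)"
    and "1 \<le> p"
  shows "((\<lambda>t. ennreal (t powr (\<alpha> * (1 - enn2real (1 / p)))) *
             Lp_norm p lebesgue (\<lambda>x. m (x, t) - selfsim_M \<theta> \<alpha> a (x, t))) \<longlongrightarrow> 0) at_top \<and>
         ((\<lambda>t. ennreal (t powr (2 - \<alpha> * (1 + enn2real (1 / p)))) *
             Lp_norm p lebesgue (\<lambda>x. m (x, t) * \<bar>Dx u (x, t) - Dx (selfsim_U \<alpha> z) (x, t)\<bar>\<^sup>2)) \<longlongrightarrow> 0) at_top \<and>
         ((\<lambda>t. ennreal (t powr (2 - \<alpha> * (1 + enn2real (1 / p)))) *
             Lp_norm p lebesgue (\<lambda>x. m (x, t) * \<bar>Dt u (x, t) - Dt (selfsim_U \<alpha> z) (x, t)\<bar>)) \<longlongrightarrow> 0) at_top"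
proof -
  have \<alpha>: "0 < \<alpha>" "\<alpha> < 1" using assms(1,2) by auto
  have v: "v = rescaled_u \<alpha> u" and \<mu>: "\<mu> = rescaled_m \<alpha> m" and \<tau>0: "\<tau>0 = ln t0" by fact+
  have R: "R > 0" using R_const_pos[OF assms(1) \<alpha> \<open>a > 0\<close>] \<open>R \<ge> R_const \<theta> \<alpha> a\<close> by linarith
  interpret mfg_solution \<theta> \<alpha> t0 a R u m
  proof (rule mfg_solution.intro)
    show "\<exists>l r. {x. m (x, t) > 0} = {l<..<r}" if "t > t0" for t
      using assms(13) that by blast
    show "bounded (rescaled_m \<alpha> m ` (UNIV \<times> {ln t0<..}))"
      "uniformly_continuous_on (UNIV \<times> {ln t0<..}) (rescaled_m \<alpha> m)"
      "closure (support_on (UNIV \<times> {ln t0..}) (rescaled_m \<alpha> m)) \<subseteq> {- R..R} \<times> {ln t0..}"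
      "\<forall>b\<in>Basis. Ck_on 1 {y \<in> UNIV \<times> {ln t0<..}. rescaled_m \<alpha> m y > 0} (partial_deriv b (rescaled_u \<alpha> u))"
      unfolding \<mu>[symmetric] \<tau>0[symmetric] v[symmetric] by fact+
    show "Lp_norm \<infinity> (lebesgue_on ({- R<..<R} \<times> {ln t0<..})) (Dx (rescaled_u \<alpha> u)) < \<infinity>"
      unfolding \<tau>0[symmetric] v[symmetric]
      by (rule bspec[OF assms(25)]) (simp add: Basis_real_prod)
  qed (use assms R in simp_all)
  have z: "(z has_real_derivative - R_const \<theta> \<alpha> a * t powr (2 * \<alpha> - 2)) (at t)" if "t > 0" for t
    using assms(26) that by blast
  show ?thesis
    using density_convergence[OF \<open>1 \<le> p\<close>] momentum_convergence[OF \<open>1 \<le> p\<close> z]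
      time_derivative_convergence[OF \<open>1 \<le> p\<close> z] by blast
qed

end
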